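(* Let $d\ge 1$, let $g:\mathbb{R}^d\to\mathbb{R}^d$ be an invertible map with inverse $h=g^{-1}$, let $H$ be the Jacobian matrix of $h$, $\eta=\det H$, and $A=H^{-1}(H^{-1})^T:\mathbb{R}^d\to\mathbb{R}^{d\times d}$. Assume that $(H^{-1})^T\nabla\log\eta\in L^\infty(\mathbb{R}^d)$ and $\operatorname{div}\left[H^{-1}(H^{-1})^T\nabla\log\eta\right]\in L^\infty(\mathbb{R}^d)$. Let $\alpha\in\mathbb{R}$ be such that $2\alpha-\frac d2-3\in(0,\infty)\setminus\mathbb{Z}$. Define $\varepsilon:=\operatorname{dist}\left(2\alpha-\frac d2-1,\mathbb{Z}_{\ge0}\right)$ and, for some $\delta\in(0,1)$, set $$T_0=\varepsilon\sqrt{1-\delta}\,\left\|2\operatorname{div}\left[H^{-1}(H^{-1})^T\nabla\log\eta\right]+\left|(H^{-1})^T\nabla\log\eta\right|^2\right\|_{L^\infty(\mathbb{R}^d)}^{-1}.$$ Then there is a constant $C=C(\varepsilon,\delta)$, depending only on $\varepsilon$ and $\delta$, such that for every $u\in C_0^\infty\left(\mathbb{R}^d\times(0,T_0)\setminus\{(0,0)\}\right)$, $$\int_0^{T_0}\int_{\mathbb{R}^d}|u(x,t)|^2\,t^{-2\alpha}e^{-\frac{|h(x)|^2}{4t}}\,dx\,dt\le C(\varepsilon,\delta)\int_0^{T_0}\int_{\mathbb{R}^d}\left|\operatorname{div}(A\nabla u)+\partial_t u\right|^2 t^{-2\alpha+2}e^{-\frac{|h(x)|^2}{4t}}\,dx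\,dt.$$
   Context: Here $\nabla$ and $\operatorname{div}$ are taken with respect to $x\in\mathbb{R}^d$. The map $g$ is assumed to be a $C^3$ diffeomorphism of $\mathbb{R}^d$ onto $\mathbb{R}^d$ with positive Jacobian determinant, so that $\eta>0$ and $\log\eta$ is defined. The Jacobian matrix of $h=(h_1,\dots,h_d)$ is $H(x)=\left(\frac{\partial h_i}{\partial x_j}(x)\right)_{i,j}$. If the $L^\infty$ norm in the definition of $T_0$ is $0$, then $T_0=+\infty$. $C_0^\infty$ denotes smooth functions with compact support. *)

theory Defs
  imports
    "HOL-Probability.Probability"
    "Jordan_Normal_Form.Determinant"
    "Jordan_Normal_Form.Gauss_Jordan_Elimination"
begin

text \<open>The constant in the theorem depends on neither the map nor the dimension \<open>d\<close>, so \<open>d\<close> is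
  quantified inside the statement and cannot be a type.  A point of d-dimensional space is therefore
  an extensional function on \<open>{..<d}\<close>; vector and matrix values use the types
  \<open>real vec\<close> and \<open>real mat\<close>.\<close>

abbreviation Rd :: "nat \<Rightarrow> (nat \<Rightarrow> real) set" where
  "Rd d \<equiv> (\<Pi>\<^sub>E i\<in>{..<d}. UNIV)"

abbreviation lborel_Rd :: "nat \<Rightarrow> (nat \<Rightarrow> real) measure" where
  "lborel_Rd d \<equiv> (\<Pi>\<^sub>M i\<in>{..<d}. lborel)"

definition origin :: "nat \<Rightarrow> nat \<Rightarrow> real" where
  "origin d = (\<lambda>i\<in>{..<d}. 0)"

definition vlen :: "real vec \<Rightarrow> real" where
  "vlen v = sqrt (scalar_prod v v)"

definition partial_deriv :: "nat \<Rightarrow> ((nat \<Rightarrow> real) \<Rightarrow> real) \<Rightarrow> (nat \<Rightarrow> real) \<Rightarrow> real" where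
  "partial_deriv i f x = deriv (\<lambda>s. f (x(i := s))) (x i)"

definition grad :: "nat \<Rightarrow> ((nat \<Rightarrow> real) \<Rightarrow> real) \<Rightarrow> (nat \<Rightarrow> real) \<Rightarrow> real vec" where
  "grad d f x = Matrix.vec d (\<lambda>i. partial_deriv i f x)"

definition divergence :: "nat \<Rightarrow> ((nat \<Rightarrow> real) \<Rightarrow> real vec) \<Rightarrow> (nat \<Rightarrow> real) \<Rightarrow> real" where
  "divergence d F x = (\<Sum>i<d. partial_deriv i (\<lambda>y. vec_index (F y) i) x)"

definition jacobian_mat ::
    "nat \<Rightarrow> ((nat \<Rightarrow> real) \<Rightarrow> nat \<Rightarrow> real) \<Rightarrow> (nat \<Rightarrow> real) \<Rightarrow> real mat" where
  "jacobian_mat d h x = Matrix.mat d d (\<lambda>(i, j). partial_deriv j (\<lambda>y. h y i) x)"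

text \<open>\<open>mat_inverse\<close> returns an option; the value is only meaningful for invertible matrices.\<close>

definition minv :: "real mat \<Rightarrow> real mat" where
  "minv M = the (mat_inverse M)"

text \<open>\<open>C_class d k f\<close>: all partial derivatives of \<open>f\<close> of order at most \<open>k\<close> exist and are
  continuous on the whole space.\<close>

fun C_class :: "nat \<Rightarrow> nat \<Rightarrow> ((nat \<Rightarrow> real) \<Rightarrow> real) \<Rightarrow> bool" where
  "C_class d 0 f \<longleftrightarrow> continuous_on (Rd d) f"
| "C_class d (Suc k) f \<longleftrightarrow> continuous_on (Rd d) f \<and>
     (\<forall>i<d. (\<forall>x\<in>Rd d. (\<lambda>s. f (x(i := s))) field_differentiable at (x i)) \<and>
            C_class d k (partial_deriv i f))"

definition C3_diffeo :: "nat \<Rightarrow> ((nat \<Rightarrow> real) \<Rightarrow> nat \<Rightarrow> real) \<Rightarrow> bool" where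
  "C3_diffeo d g \<longleftrightarrow> bij_betw g (Rd d) (Rd d) \<and>
     (\<forall>i<d. C_class d 3 (\<lambda>x. g x i)) \<and>
     (\<forall>i<d. C_class d 3 (\<lambda>y. inv_into (Rd d) g y i))"

definition Linf_norm :: "nat \<Rightarrow> ((nat \<Rightarrow> real) \<Rightarrow> real) \<Rightarrow> ereal" where
  "Linf_norm d f = esssup (lborel_Rd d) (\<lambda>x. ereal \<bar>f x\<bar>)"

definition Linf :: "nat \<Rightarrow> ((nat \<Rightarrow> real) \<Rightarrow> real) set" where
  "Linf d = {f \<in> borel_measurable (lborel_Rd d). Linf_norm d f < \<infinity>}"

text \<open>Smooth functions with compact support in an open subset of space-time.  For the regularity,
  the time variable is taken as coordinate number \<open>d\<close> of a space of dimension \<open>Suc d\<close>.  As usual,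
  a test function is a function on all of space-time, vanishing outside its support.\<close>

definition test_functions ::
    "nat \<Rightarrow> ((nat \<Rightarrow> real) \<times> real) set \<Rightarrow> ((nat \<Rightarrow> real) \<Rightarrow> real \<Rightarrow> real) set" where
  "test_functions d \<Omega> =
     {u. (\<forall>k. C_class (Suc d) k (\<lambda>z. u (restrict z {..<d}) (z d))) \<and>
         compact (closure {(x, t). x \<in> Rd d \<and> u x t \<noteq> 0}) \<and>
         closure {(x, t). x \<in> Rd d \<and> u x t \<noteq> 0} \<subseteq> \<Omega>}"

end

theory Submission
  imports Defs "HOL-Real_Asymp.Real_Asymp"
begin

text \<open>Put \<open>w = \<eta>\<^sup>-\<^sup>1\<^sup>/\<^sup>2 u\<close> and change variables to \<open>y = h x\<close>.  Then
  \<open>div (A \<nabla> u) + \<partial>\<^sub>t u\<close> becomes the backward heat operator applied to \<open>w\<close> plus the potential term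
  \<open>V w / 4\<close>, where \<open>V = 2 div (A \<nabla> log \<eta>) + |(H\<^sup>-\<^sup>1)\<^sup>T \<nabla> log \<eta>|\<^sup>2\<close>.  Pairing with the
  derivatives of order \<open>a\<close> of the heat kernel at time \<open>2 t\<close> gives coefficients \<open>c\<^sub>a t\<close> whose time
  derivatives are the coefficients of the backward heat operator, since those kernels solve the heat
  equation.  By Parseval for Hermite polynomials, the two sides of the inequality are sums over the
  multi-indices \<open>a\<close> of integrals of \<open>t\<^sup>p c\<^sub>a\<^sup>2\<close> and \<open>t\<^sup>p\<^sup>+\<^sup>2 c\<^sub>a'\<^sup>2\<close> with
  \<open>p + 1 = |a| - (2 \<alpha> - d / 2 - 1)\<close>.  As \<open>|p + 1| \<ge> \<epsilon>\<close>, Hardy's inequality bounds the former by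
  \<open>4 / \<epsilon>\<^sup>2\<close> times the latter, and the potential is absorbed because \<open>|t V| \<le> \<epsilon>\<close> for \<open>t < T\<^sub>0\<close>.\<close>

section \<open>Hermite expansions in Gaussian spaces\<close>

text \<open>The change of variables is never performed on \<open>u\<close>: derivatives of the heat
  kernel are pulled back by \<open>h\<close> and multiplied by \<eta>^(1/2), and these modes serve
  as test functions in x. Green's identity moves the elliptic operator onto a mode, where the Piola
  identity (the columns of \<eta> H^(-1) are divergence free) evaluates it. Integration in y enters
  only through Parseval, for which the image of \<eta> dx under \<open>h\<close> must be a multiple
  of Lebesgue measure; this again follows from Piola, since integrals of products of bumps in
  \<open>h\<close> depend on each factor only through its mean. Parseval itself rests on a spectral
  gap: a function orthogonal to low degrees is the Gaussian divergence of something small.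

  The squared pairing with a kernel derivative of order a carries t^(|a| + d/2), whence p = |a| +
  d/2 - 2 \<alpha>. As for the constant, (P - V u / 4)^2 \<le> 2 P^2 + V^2 u^2 / 8 puts 2 on P and
  \<epsilon>^2 / 8 on u; Hardy's factor 4 / \<epsilon>^2 turns these into 8 / \<epsilon>^2 and 1/2,
  and absorbing the half doubles the former to 16 / \<epsilon>^2.\<close>

definition gwt :: "real \<Rightarrow> real \<Rightarrow> real" where
  "gwt \<sigma> y = exp (- y\<^sup>2 / (2 * \<sigma>))"

text \<open>For \<sigma> > 0 these are the monic Hermite polynomials of the Gaussian of variance
  \<sigma>, that is \<sigma>^(k/2) He_k(y / sqrt \<sigma>) with He_k the probabilists'
  polynomial.\<close>

fun hermite :: "real \<Rightarrow> nat \<Rightarrow> real \<Rightarrow> real" where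
  "hermite \<sigma> 0 y = 1"
| "hermite \<sigma> (Suc 0) y = y"
| "hermite \<sigma> (Suc (Suc k)) y = y * hermite \<sigma> (Suc k) y - \<sigma> * real (Suc k) * hermite \<sigma> k y"

text \<open>A class that contains the polynomials and the bounded continuous functions, is
  integrable against every Gaussian, and is closed under products and under the solution operator of
  \<open>gaussian_divergence_solve\<close>.\<close>

definition exp_growth :: "(real \<Rightarrow> real) \<Rightarrow> bool" where
  "exp_growth f \<longleftrightarrow> continuous_on UNIV f \<and> (\<exists>C a. \<forall>y. \<bar>f y\<bar> \<le> C * exp (a * \<bar>y\<bar>))"

lemma hermite_Suc: "hermite \<sigma> (Suc k) y = y * hermite \<sigma> k y - \<sigma> * real k * hermite \<sigma> (k - 1) y"
  by (cases k) auto

lemma has_derivative_hermite: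
  "(hermite \<sigma> k has_field_derivative real k * hermite \<sigma> (k - 1) y) (at y)"
proof (induction \<sigma> k y rule: hermite.induct)
  case (3 \<sigma> k y)
  have "((\<lambda>y. y * hermite \<sigma> (Suc k) y - \<sigma> * real (Suc k) * hermite \<sigma> k y) has_field_derivative
      (hermite \<sigma> (Suc k) y + y * (real (Suc k) * hermite \<sigma> k y)
        - \<sigma> * real (Suc k) * (real k * hermite \<sigma> (k - 1) y))) (at y)"
    using 3 by (auto intro!: derivative_eq_intros)
  moreover have "hermite \<sigma> (Suc k) y + y * (real (Suc k) * hermite \<sigma> k y)
        - \<sigma> * real (Suc k) * (real k * hermite \<sigma> (k - 1) y) = real (Suc (Suc k)) * hermite \<sigma> (Suc k) y"
    unfolding hermite_Suc by (simp add: algebra_simps)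
  moreover have "(\<lambda>y. y * hermite \<sigma> (Suc k) y - \<sigma> * real (Suc k) * hermite \<sigma> k y) = hermite \<sigma> (Suc (Suc k))"
    by auto
  ultimately show ?case by simp
qed (auto intro!: derivative_eq_intros)

lemma exp_growth_contD: "exp_growth f \<Longrightarrow> continuous_on UNIV f"
  by (simp add: exp_growth_def)

lemma exp_growth_boundE:
  assumes "exp_growth f"
  obtains C a where "C \<ge> 0" "a \<ge> 0" "\<And>y. \<bar>f y\<bar> \<le> C * exp (a * \<bar>y\<bar>)"
proof -
  obtain C a where Ca: "\<And>y. \<bar>f y\<bar> \<le> C * exp (a * \<bar>y\<bar>)" using assms by (auto simp: exp_growth_def)
  have "C \<ge> 0" using Ca[of 0] by simp
  moreover have "\<bar>f y\<bar> \<le> C * exp (\<bar>a\<bar> * \<bar>y\<bar>)" for y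
    using Ca[of y] \<open>C \<ge> 0\<close> by (elim order_trans) (auto intro!: mult_left_mono mult_right_mono)
  ultimately show ?thesis using that[of C "\<bar>a\<bar>"] by auto
qed

lemma exp_growth_bounded:
  assumes "continuous_on UNIV f" "\<And>y. \<bar>f y\<bar> \<le> B"
  shows "exp_growth f"
  unfolding exp_growth_def using assms by (intro conjI exI[of _ B] exI[of _ 0]) auto

lemma exp_growth_const: "exp_growth (\<lambda>y. c)"
  by (rule exp_growth_bounded[of _ "\<bar>c\<bar>"]) auto

lemma exp_growth_ident: "exp_growth (\<lambda>y. y)"
proof -
  have "\<bar>y\<bar> \<le> 1 * exp (1 * \<bar>y\<bar>)" for y :: real
    using exp_ge_add_one_self[of "\<bar>y\<bar>"] by (simp del: exp_ge_add_one_self)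
  then show ?thesis unfolding exp_growth_def by (intro conjI exI[of _ 1] allI) (auto intro!: continuous_intros)
qed

lemma exp_growth_add:
  assumes "exp_growth f" "exp_growth g" shows "exp_growth (\<lambda>y. f y + g y)"
proof -
  obtain C a where C: "C \<ge> 0" "a \<ge> 0" "\<And>y. \<bar>f y\<bar> \<le> C * exp (a * \<bar>y\<bar>)" using exp_growth_boundE[OF assms(1)] by blast
  obtain D b where D: "D \<ge> 0" "b \<ge> 0" "\<And>y. \<bar>g y\<bar> \<le> D * exp (b * \<bar>y\<bar>)" using exp_growth_boundE[OF assms(2)] by blast
  have "\<bar>f y + g y\<bar> \<le> (C + D) * exp ((a + b) * \<bar>y\<bar>)" for y
  proof -
    have "C * exp (a * \<bar>y\<bar>) \<le> C * exp ((a + b) * \<bar>y\<bar>)" "D * exp (b * \<bar>y\<bar>) \<le> D * exp ((a + b) * \<bar>y\<bar>)"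
      using C D by (auto intro!: mult_left_mono mult_right_mono)
    with C(3)[of y] D(3)[of y] abs_triangle_ineq[of "f y" "g y"] show ?thesis
      unfolding distrib_right[of C D] by linarith
  qed
  then show ?thesis using assms unfolding exp_growth_def by (auto intro!: continuous_intros)
qed

lemma exp_growth_mult:
  assumes "exp_growth f" "exp_growth g" shows "exp_growth (\<lambda>y. f y * g y)"
proof -
  obtain C a where C: "C \<ge> 0" "a \<ge> 0" "\<And>y. \<bar>f y\<bar> \<le> C * exp (a * \<bar>y\<bar>)" using exp_growth_boundE[OF assms(1)] by blast
  obtain D b where D: "D \<ge> 0" "b \<ge> 0" "\<And>y. \<bar>g y\<bar> \<le> D * exp (b * \<bar>y\<bar>)" using exp_growth_boundE[OF assms(2)] by blast
  have "\<bar>f y * g y\<bar> \<le> (C * D) * exp ((a + b) * \<bar>y\<bar>)" for y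
  proof -
    have "\<bar>f y\<bar> * \<bar>g y\<bar> \<le> (C * exp (a * \<bar>y\<bar>)) * (D * exp (b * \<bar>y\<bar>))"
      using C D by (intro mult_mono) auto
    then show ?thesis by (simp add: abs_mult distrib_right distrib_left exp_add mult_ac)
  qed
  then show ?thesis using assms unfolding exp_growth_def by (auto intro!: continuous_intros)
qed

lemma exp_growth_cmult: "exp_growth f \<Longrightarrow> exp_growth (\<lambda>y. c * f y)"
  by (intro exp_growth_mult exp_growth_const)

lemma exp_growth_minus: "exp_growth f \<Longrightarrow> exp_growth (\<lambda>y. - f y)"
  using exp_growth_cmult[of f "-1"] by simp

lemma exp_growth_diff: "exp_growth f \<Longrightarrow> exp_growth g \<Longrightarrow> exp_growth (\<lambda>y. f y - g y)"
  using exp_growth_add[of f "\<lambda>y. - g y"] exp_growth_minus by auto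

lemma exp_growth_divide: "exp_growth f \<Longrightarrow> exp_growth (\<lambda>y. f y / c)"
  using exp_growth_cmult[of f "1/c"] by simp

lemma exp_growth_power: "exp_growth f \<Longrightarrow> exp_growth (\<lambda>y. f y ^ n)"
  by (induction n) (auto intro!: exp_growth_const exp_growth_mult)

lemma exp_growth_sum: "(\<And>i. i \<in> I \<Longrightarrow> exp_growth (f i)) \<Longrightarrow> exp_growth (\<lambda>y. \<Sum>i\<in>I. f i y)"
  by (induction I rule: infinite_finite_induct) (auto intro!: exp_growth_const exp_growth_add)

lemma exp_growth_hermite: "exp_growth (hermite \<sigma> k)"
proof (induction k rule: less_induct)
  case (less k)
  have eq: "hermite \<sigma> 0 = (\<lambda>y. 1)" "hermite \<sigma> (Suc 0) = (\<lambda>y. y)"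
    "hermite \<sigma> (Suc (Suc m)) = (\<lambda>y. y * hermite \<sigma> (Suc m) y - \<sigma> * real (Suc m) * hermite \<sigma> m y)" for m
    by auto
  consider "k = 0" | "k = Suc 0" | m where "k = Suc (Suc m)" by (metis not0_implies_Suc)
  then show ?case
  proof cases
    case (3 m)
    then show ?thesis unfolding 3 eq
      using 3 by (intro exp_growth_diff exp_growth_mult exp_growth_const exp_growth_ident less) auto
  qed (simp_all add: eq exp_growth_const exp_growth_ident)
qed

lemmas exp_growth_intros = exp_growth_const exp_growth_ident exp_growth_add exp_growth_mult
  exp_growth_minus exp_growth_diff exp_growth_divide exp_growth_power exp_growth_sum exp_growth_hermite

lemma has_antiderivative_UNIV:
  fixes f :: "real \<Rightarrow> real"
  assumes "continuous_on UNIV f"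
  obtains F where "\<And>y. (F has_field_derivative f y) (at y)"
proof -
  have "\<exists>F. \<forall>x::real. -\<infinity> < x \<longrightarrow> x < \<infinity> \<longrightarrow> (F has_vector_derivative f x) (at x)"
    by (rule einterval_antiderivative) (use assms in \<open>auto simp: continuous_on_eq_continuous_at\<close>)
  then show ?thesis using that by (auto simp: has_real_derivative_iff_has_vector_derivative)
qed

section \<open>The Gaussian weight\<close>

context
  fixes \<sigma> :: real
  assumes \<sigma>: "\<sigma> > 0"
begin

lemma gwt_pos: "gwt \<sigma> y > 0"
  by (simp add: gwt_def)

lemma continuous_gwt: "continuous_on S (gwt \<sigma>)"
  unfolding gwt_def using \<sigma> by (auto intro!: continuous_intros)

lemma has_derivative_gwt: "(gwt \<sigma> has_field_derivative - (y / \<sigma>) * gwt \<sigma> y) (at y)"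
  unfolding gwt_def using \<sigma> by (auto intro!: derivative_eq_intros simp: field_simps)

text \<open>Completing the square, a |y| \<le> \<sigma> a^2 + y^2 / (4 \<sigma>): an exponential
  factor costs a constant and half of the Gaussian exponent, hence a doubled variance.\<close>

lemma gwt_bound:
  "exp (a * \<bar>y\<bar>) * gwt \<sigma> y \<le> exp (\<sigma> * a\<^sup>2) * gwt (2 * \<sigma>) y"
proof -
  have "0 \<le> (\<bar>y\<bar> - 2 * \<sigma> * a)\<^sup>2" by simp
  then have "4 * \<sigma> * (a * \<bar>y\<bar>) - y\<^sup>2 \<le> 4 * \<sigma> * (\<sigma> * a\<^sup>2)"
    by (simp add: power2_eq_square algebra_simps)
  then have "a * \<bar>y\<bar> - y\<^sup>2 / (2 * \<sigma>) \<le> \<sigma> * a\<^sup>2 - y\<^sup>2 / (2 * (2 * \<sigma>))"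
    using \<sigma> divide_right_mono[of _ _ "4 * \<sigma>"] by (fastforce simp: diff_divide_distrib)
  then show ?thesis unfolding gwt_def
    by (simp flip: exp_add)
qed

end

lemma gwt_eq_normal_density:
  "\<sigma> > 0 \<Longrightarrow> gwt \<sigma> y = sqrt (2 * pi * \<sigma>) * normal_density 0 (sqrt \<sigma>) y"
  by (simp add: gwt_def normal_density_def)

lemma integrable_gwt: "\<sigma> > 0 \<Longrightarrow> integrable lborel (gwt \<sigma>)"
  by (subst Bochner_Integration.integrable_cong[OF refl gwt_eq_normal_density]) auto

lemma integral_gwt: "\<sigma> > 0 \<Longrightarrow> (LINT y|lborel. gwt \<sigma> y) = sqrt (2 * pi * \<sigma>)"
  by (simp add: gwt_eq_normal_density)

lemma gwt_tendsto_0: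
  assumes "\<sigma> > 0" shows "(gwt \<sigma> \<longlongrightarrow> 0) at_top" "(gwt \<sigma> \<longlongrightarrow> 0) at_bot"
  unfolding gwt_def using assms by real_asymp+

section \<open>Calculus in the Gaussian space of variance \<sigma>\<close>

context
  fixes \<sigma> :: real
  assumes \<sigma>: "\<sigma> > 0"
begin

lemma exp_growth_gwt_bound:
  assumes "exp_growth f"
  obtains C where "C \<ge> 0" "\<And>y. \<bar>f y * gwt \<sigma> y\<bar> \<le> C * gwt (2 * \<sigma>) y"
proof -
  obtain C a where C: "C \<ge> 0" "a \<ge> 0" "\<And>y. \<bar>f y\<bar> \<le> C * exp (a * \<bar>y\<bar>)" using exp_growth_boundE[OF assms] by blast
  have "\<bar>f y * gwt \<sigma> y\<bar> \<le> (C * exp (\<sigma> * a\<^sup>2)) * gwt (2 * \<sigma>) y" for y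
  proof -
    have "\<bar>f y * gwt \<sigma> y\<bar> \<le> C * (exp (a * \<bar>y\<bar>) * gwt \<sigma> y)"
      using C(3)[of y] gwt_pos[OF \<sigma>, of y] by (simp add: abs_mult mult_right_mono)
    also have "\<dots> \<le> C * (exp (\<sigma> * a\<^sup>2) * gwt (2 * \<sigma>) y)"
      by (intro mult_left_mono gwt_bound \<sigma> C)
    finally show ?thesis by simp
  qed
  then show ?thesis using C(1) by (intro that[of "C * exp (\<sigma> * a\<^sup>2)"]) auto
qed

lemma integrable_exp_growth:
  assumes "exp_growth f" shows "integrable lborel (\<lambda>y. f y * gwt \<sigma> y)"
proof -
  obtain C where C: "C \<ge> 0" "\<And>y. \<bar>f y * gwt \<sigma> y\<bar> \<le> C * gwt (2 * \<sigma>) y"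
    using exp_growth_gwt_bound[OF assms] by blast
  show ?thesis
  proof (rule Bochner_Integration.integrable_bound)
    show "integrable lborel (\<lambda>y. C * gwt (2 * \<sigma>) y)"
      using integrable_gwt[of "2 * \<sigma>"] \<sigma> by auto
    show "(\<lambda>y. f y * gwt \<sigma> y) \<in> borel_measurable lborel"
      using continuous_on_mult[OF exp_growth_contD[OF assms] continuous_gwt[OF \<sigma>]]
      by (simp add: borel_measurable_continuous_onI)
    show "AE y in lborel. norm (f y * gwt \<sigma> y) \<le> norm (C * gwt (2 * \<sigma>) y)"
    proof (rule AE_I2)
      fix y
      show "norm (f y * gwt \<sigma> y) \<le> norm (C * gwt (2 * \<sigma>) y)"
        unfolding real_norm_def using C(2)[of y] abs_ge_self[of "C * gwt (2 * \<sigma>) y"] by linarith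
    qed
  qed
qed

lemma exp_growth_tendsto_0:
  assumes "exp_growth f"
  shows "((\<lambda>y. f y * gwt \<sigma> y) \<longlongrightarrow> 0) at_top" "((\<lambda>y. f y * gwt \<sigma> y) \<longlongrightarrow> 0) at_bot"
proof -
  obtain C where C: "C \<ge> 0" "\<And>y. \<bar>f y * gwt \<sigma> y\<bar> \<le> C * gwt (2 * \<sigma>) y"
    using exp_growth_gwt_bound[OF assms] by blast
  have lim: "((\<lambda>y. C * gwt (2 * \<sigma>) y) \<longlongrightarrow> 0) at_top" "((\<lambda>y. C * gwt (2 * \<sigma>) y) \<longlongrightarrow> 0) at_bot"
    using gwt_tendsto_0[of "2 * \<sigma>"] \<sigma> by (auto intro!: tendsto_mult_right_zero)
  show "((\<lambda>y. f y * gwt \<sigma> y) \<longlongrightarrow> 0) at_top" "((\<lambda>y. f y * gwt \<sigma> y) \<longlongrightarrow> 0) at_bot"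
    using C(2) by (auto intro!: Lim_null_comparison[OF _ lim(1)] Lim_null_comparison[OF _ lim(2)] always_eventually)
qed

text \<open>The integrand is the derivative of \<open>f\<close> times the weight, which tends to 0
  at both ends.\<close>

lemma gaussian_by_parts:
  assumes f: "exp_growth f" "exp_growth f'" "\<And>y. (f has_field_derivative f' y) (at y)"
  shows "(LINT y|lborel. (f' y - y * f y / \<sigma>) * gwt \<sigma> y) = 0"
proof -
  let ?D = "\<lambda>y. (f' y - y * f y / \<sigma>) * gwt \<sigma> y"
  have eg: "exp_growth (\<lambda>y. f' y - y * f y / \<sigma>)"
    by (intro exp_growth_intros f)
  have cont: "continuous_on UNIV ?D"
    by (intro continuous_on_mult exp_growth_contD[OF eg] continuous_gwt \<sigma>)
  have int: "integrable lborel ?D"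
    by (rule integrable_exp_growth[OF eg])
  have "(LBINT y=-\<infinity>..\<infinity>. ?D y) = 0 - 0"
  proof (rule interval_integral_FTC_integrable[where F = "\<lambda>y. f y * gwt \<sigma> y"])
    fix y :: real
    have "((\<lambda>y. f y * gwt \<sigma> y) has_field_derivative ?D y) (at y)"
      by (rule derivative_eq_intros f(3) has_derivative_gwt[OF \<sigma>] refl)+ (simp add: field_simps)
    then show "((\<lambda>y. f y * gwt \<sigma> y) has_vector_derivative ?D y) (at y)"
      by (simp add: has_real_derivative_iff_has_vector_derivative)
    show "isCont ?D y" using cont by (simp add: continuous_on_eq_continuous_at)
    show "set_integrable lborel (einterval (-\<infinity>) \<infinity>) ?D"
      using int by (simp add: set_integrable_def einterval_def)
    show "(((\<lambda>y. f y * gwt \<sigma> y) \<circ> real_of_ereal) \<longlongrightarrow> 0) (at_right (-\<infinity>))"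
      "(((\<lambda>y. f y * gwt \<sigma> y) \<circ> real_of_ereal) \<longlongrightarrow> 0) (at_left \<infinity>)"
      using exp_growth_tendsto_0[OF f(1)] by (simp_all add: ereal_tendsto_simps)
  qed simp
  then show ?thesis
    by (simp add: interval_lebesgue_integral_def set_lebesgue_integral_def einterval_def)
qed

text \<open>The shift \<open>s = y - \<tau>\<close> and \<open>s\<^sup>2 \<ge> y\<^sup>2 + \<tau>\<^sup>2\<close> for \<open>y\<close>, \<open>-\<tau>\<close> of the same sign.\<close>

lemma gaussian_tail_bound:
  assumes r: "exp_growth r"
  obtains C a where "\<And>y. y \<le> 0 \<Longrightarrow> \<bar>LINT s|lborel. indicator {..y} s * (r s * gwt \<sigma> s)\<bar> \<le> C * exp (a * \<bar>y\<bar>) * gwt \<sigma> y"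
    "\<And>y. y \<ge> 0 \<Longrightarrow> \<bar>LINT s|lborel. indicator {y<..} s * (r s * gwt \<sigma> s)\<bar> \<le> C * exp (a * \<bar>y\<bar>) * gwt \<sigma> y"
proof -
  obtain C a where C: "C \<ge> 0" "a \<ge> 0" "\<And>y. \<bar>r y\<bar> \<le> C * exp (a * \<bar>y\<bar>)" using exp_growth_boundE[OF r] by blast
  have eg: "exp_growth (\<lambda>\<tau>. exp (a * \<bar>\<tau>\<bar>))"
    unfolding exp_growth_def by (intro conjI exI[of _ 1] exI[of _ a]) (auto intro!: continuous_intros)
  let ?w = "\<lambda>\<tau>. exp (a * \<bar>\<tau>\<bar>) * gwt \<sigma> \<tau>"
  have w: "integrable lborel ?w" by (rule integrable_exp_growth[OF eg])
  have ir: "integrable lborel (\<lambda>s. r s * gwt \<sigma> s)" by (rule integrable_exp_growth[OF r])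
  define D where "D = (LINT \<tau>|lborel. ?w \<tau>)"
  have shift: "integrable lborel (\<lambda>s. ?w (s - y))" "(LINT s|lborel. ?w (s - y)) = D" for y
    using lborel_integrable_real_affine[OF w, of 1 "-y"] lborel_integral_real_affine[of 1 ?w "-y"]
    by (simp_all add: D_def)
  have pt: "\<bar>r s * gwt \<sigma> s\<bar> \<le> C * exp (a * \<bar>y\<bar>) * gwt \<sigma> y * ?w (s - y)" if "y * (s - y) \<ge> 0" for y s
  proof -
    have "y\<^sup>2 + (s - y)\<^sup>2 \<le> s\<^sup>2" using that by (simp add: power2_eq_square algebra_simps)
    then have "- s\<^sup>2 / (2 * \<sigma>) \<le> - y\<^sup>2 / (2 * \<sigma>) + - (s - y)\<^sup>2 / (2 * \<sigma>)"
      using \<sigma> by (simp add: field_simps)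
    then have 1: "gwt \<sigma> s \<le> gwt \<sigma> y * gwt \<sigma> (s - y)"
      unfolding gwt_def by (simp flip: exp_add)
    have "a * \<bar>s\<bar> \<le> a * (\<bar>y\<bar> + \<bar>s - y\<bar>)" using C by (intro mult_left_mono) auto
    then have 2: "exp (a * \<bar>s\<bar>) \<le> exp (a * \<bar>y\<bar>) * exp (a * \<bar>s - y\<bar>)"
      by (simp flip: exp_add add: distrib_left)
    have "\<bar>r s * gwt \<sigma> s\<bar> \<le> (C * exp (a * \<bar>s\<bar>)) * gwt \<sigma> s"
      using C(3)[of s] gwt_pos[OF \<sigma>, of s] by (simp add: abs_mult mult_right_mono)
    also have "\<dots> \<le> (C * (exp (a * \<bar>y\<bar>) * exp (a * \<bar>s - y\<bar>))) * (gwt \<sigma> y * gwt \<sigma> (s - y))"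
      using 1 2 C(1) gwt_pos[OF \<sigma>] by (intro mult_mono mult_left_mono) (auto simp: less_imp_le)
    finally show ?thesis by (simp add: mult_ac)
  qed
  have main: "\<bar>LINT s|lborel. indicator A s * (r s * gwt \<sigma> s)\<bar> \<le> (C * D) * exp (a * \<bar>y\<bar>) * gwt \<sigma> y"
    if A: "A \<in> sets borel" "\<And>s. s \<in> A \<Longrightarrow> y * (s - y) \<ge> 0" for A y
  proof -
    have "\<bar>LINT s|lborel. indicator A s * (r s * gwt \<sigma> s)\<bar> \<le> (LINT s|lborel. \<bar>indicator A s * (r s * gwt \<sigma> s)\<bar>)"
      by (rule integral_abs_bound)
    also have "\<dots> \<le> (LINT s|lborel. (C * exp (a * \<bar>y\<bar>) * gwt \<sigma> y) * ?w (s - y))"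
    proof (rule integral_mono)
      show "integrable lborel (\<lambda>s. \<bar>indicator A s * (r s * gwt \<sigma> s)\<bar>)"
        using integrable_mult_indicator[OF _ ir, of A] A by (intro integrable_abs) simp
      show "integrable lborel (\<lambda>s. (C * exp (a * \<bar>y\<bar>) * gwt \<sigma> y) * ?w (s - y))"
        by (intro integrable_mult_right shift)
      fix s
      show "\<bar>indicator A s * (r s * gwt \<sigma> s)\<bar> \<le> (C * exp (a * \<bar>y\<bar>) * gwt \<sigma> y) * ?w (s - y)"
        using pt[OF A(2), of s] C gwt_pos[OF \<sigma>] by (auto simp: indicator_def less_imp_le)
    qed
    also have "\<dots> = (C * exp (a * \<bar>y\<bar>) * gwt \<sigma> y) * D"
      by (simp only: integral_mult_right_zero shift)
    finally show ?thesis by (simp add: mult_ac)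
  qed
  show ?thesis
    by (rule that[of "C * D" a]) (rule main; simp add: mult_nonneg_nonneg mult_nonpos_nonpos)+
qed

text \<open>With w the weight, the equation reads r w = -(g w)', so g is minus the primitive of r w
  from minus infinity, divided by w. Division by w is harmless only because the primitive decays
  like w: on the negative axis as a left tail, and on the positive axis, by the vanishing mean, as
  minus a right tail.\<close>

lemma gaussian_divergence_solve:
  assumes r: "exp_growth r" and int0: "(LINT y|lborel. r y * gwt \<sigma> y) = 0"
  obtains g g' where "exp_growth g" "exp_growth g'" "\<And>y. (g has_field_derivative g' y) (at y)"
    "\<And>y. r y = y * g y / \<sigma> - g' y"
proof -
  let ?f = "\<lambda>y. r y * gwt \<sigma> y"
  have cf: "continuous_on UNIV ?f"
    by (intro continuous_on_mult exp_growth_contD[OF r] continuous_gwt \<sigma>)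
  obtain \<Psi> where \<Psi>: "\<And>y. (\<Psi> has_field_derivative ?f y) (at y)" using has_antiderivative_UNIV[OF cf] by blast
  have ir: "integrable lborel ?f" by (rule integrable_exp_growth[OF r])
  have iA: "integrable lborel (\<lambda>s. indicator A s * ?f s)" if "A \<in> sets borel" for A
    using integrable_mult_indicator[OF _ ir, of A] that by simp
  define \<Phi> where "\<Phi> y = (LINT s|lborel. indicator {..y} s * ?f s)" for y
  have diff: "\<Phi> y - \<Phi> x = \<Psi> y - \<Psi> x" if "x \<le> y" for x y
  proof -
    have "\<Phi> y - \<Phi> x = (LINT s|lborel. indicator {..y} s * ?f s - indicator {..x} s * ?f s)"
      unfolding \<Phi>_def by (intro Bochner_Integration.integral_diff[symmetric] iA) auto
    also have "\<dots> = (LINT s|lborel. indicator {x<..y} s *\<^sub>R ?f s)"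
      using that by (intro Bochner_Integration.integral_cong) (auto simp: indicator_def)
    also have "\<dots> = (LINT s|lborel. indicator {x..y} s *\<^sub>R ?f s)"
    proof (rule integral_cong_AE)
      show "AE s in lborel. indicator {x<..y} s *\<^sub>R ?f s = indicator {x..y} s *\<^sub>R ?f s"
        using AE_lborel_singleton[of x] by eventually_elim (auto simp: indicator_def)
    qed (use borel_measurable_integrable[OF iA[of "{x<..y}"]] borel_measurable_integrable[OF iA[of "{x..y}"]] in auto)
    also have "\<dots> = \<Psi> y - \<Psi> x"
      by (rule integral_FTC_atLeastAtMost[OF that])
        (auto intro!: has_field_derivative_subset[OF \<Psi>] continuous_on_subset[OF cf]
           simp flip: has_real_derivative_iff_has_vector_derivative)
    finally show ?thesis .
  qed
  have \<Phi>eq: "\<Phi> = (\<lambda>y. \<Psi> y + (\<Phi> 0 - \<Psi> 0))"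
  proof
    fix y show "\<Phi> y = \<Psi> y + (\<Phi> 0 - \<Psi> 0)" using diff[of 0 y] diff[of y 0] by (cases "y \<ge> 0") auto
  qed
  have d\<Phi>: "(\<Phi> has_field_derivative ?f y) (at y)" for y
    by (subst \<Phi>eq) (auto intro!: derivative_eq_intros \<Psi>)
  obtain C a where tail: "\<And>y. y \<le> 0 \<Longrightarrow> \<bar>LINT s|lborel. indicator {..y} s * (r s * gwt \<sigma> s)\<bar> \<le> C * exp (a * \<bar>y\<bar>) * gwt \<sigma> y"
    "\<And>y. y \<ge> 0 \<Longrightarrow> \<bar>LINT s|lborel. indicator {y<..} s * (r s * gwt \<sigma> s)\<bar> \<le> C * exp (a * \<bar>y\<bar>) * gwt \<sigma> y"
    by (rule gaussian_tail_bound[OF r]) (rule that, assumption+)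
  have \<Phi>bound: "\<bar>\<Phi> y\<bar> \<le> C * exp (a * \<bar>y\<bar>) * gwt \<sigma> y" for y
  proof (cases "y \<le> 0")
    case True then show ?thesis using tail(1) unfolding \<Phi>_def by simp
  next
    case False
    have "\<Phi> y + (LINT s|lborel. indicator {y<..} s * ?f s) = (LINT s|lborel. indicator {..y} s * ?f s + indicator {y<..} s * ?f s)"
      unfolding \<Phi>_def by (intro Bochner_Integration.integral_add[symmetric] iA) auto
    also have "\<dots> = (LINT s|lborel. ?f s)"
      by (intro Bochner_Integration.integral_cong) (auto simp: indicator_def)
    finally show ?thesis using tail(2)[of y] False int0 by simp
  qed
  define g where "g y = - \<Phi> y / gwt \<sigma> y" for y
  define g' where "g' y = y * g y / \<sigma> - r y" for y
  have dg: "(g has_field_derivative g' y) (at y)" for y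
    unfolding g_def[abs_def] g'_def using gwt_pos[OF \<sigma>, of y] \<sigma>
    by (auto intro!: derivative_eq_intros d\<Phi> has_derivative_gwt simp: field_simps power2_eq_square g_def)
  have eg: "exp_growth g"
    unfolding exp_growth_def
  proof
    show "continuous_on UNIV g" using dg by (meson DERIV_continuous_on has_field_derivative_at_within)
    show "\<exists>C a. \<forall>y. \<bar>g y\<bar> \<le> C * exp (a * \<bar>y\<bar>)"
      using \<Phi>bound gwt_pos[OF \<sigma>]
      by (intro exI[of _ C] exI[of _ a]) (auto simp: g_def pos_divide_le_eq abs_of_pos)
  qed
  have eg': "exp_growth g'"
    unfolding g'_def[abs_def] by (intro exp_growth_intros r eg)
  show ?thesis by (rule that[OF eg eg' dg]) (simp add: g'_def)
qed


text \<open>Integration by parts for the product \<open>g f\<close>: in the weighted space the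
  operator taking g to y g / \<sigma> - g' is the adjoint of d/dy.\<close>

lemma gaussian_adjoint:
  assumes g: "exp_growth g" "exp_growth g'" "\<And>y. (g has_field_derivative g' y) (at y)"
    and f: "exp_growth f" "exp_growth f'" "\<And>y. (f has_field_derivative f' y) (at y)"
  shows "(LINT y|lborel. (y * g y / \<sigma> - g' y) * f y * gwt \<sigma> y) = (LINT y|lborel. g y * f' y * gwt \<sigma> y)"
proof -
  have "(LINT y|lborel. ((g y * f' y + g' y * f y) - y * (g y * f y) / \<sigma>) * gwt \<sigma> y) = 0"
    by (rule gaussian_by_parts) (auto intro!: exp_growth_intros derivative_eq_intros f g simp: algebra_simps)
  moreover have "(LINT y|lborel. ((g y * f' y + g' y * f y) - y * (g y * f y) / \<sigma>) * gwt \<sigma> y)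
    = (LINT y|lborel. g y * f' y * gwt \<sigma> y - (y * g y / \<sigma> - g' y) * f y * gwt \<sigma> y)"
    by (intro Bochner_Integration.integral_cong) (auto simp: algebra_simps)
  moreover have "\<dots> = (LINT y|lborel. g y * f' y * gwt \<sigma> y) - (LINT y|lborel. (y * g y / \<sigma> - g' y) * f y * gwt \<sigma> y)"
    by (intro Bochner_Integration.integral_diff integrable_exp_growth exp_growth_intros f g)
  ultimately show ?thesis by simp
qed

text \<open>The commutator of d/dy with its adjoint is multiplication by 1 / \<sigma>. To see this
  without a second derivative of \<open>g\<close>, the null integral obtained by parts from y g^2 /
  \<sigma> is added to the square, which cancels the mixed term.\<close>

lemma gaussian_divergence_norm:
  assumes g: "exp_growth g" "exp_growth g'" "\<And>y. (g has_field_derivative g' y) (at y)"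
  shows "(LINT y|lborel. (y * g y / \<sigma> - g' y)\<^sup>2 * gwt \<sigma> y)
    = (LINT y|lborel. (g' y)\<^sup>2 * gwt \<sigma> y) + (LINT y|lborel. (g y)\<^sup>2 * gwt \<sigma> y) / \<sigma>"
proof -
  have "(LINT y|lborel. (((g y)\<^sup>2 / \<sigma> + 2 * y * g y * g' y / \<sigma>) - y * (y * (g y)\<^sup>2 / \<sigma>) / \<sigma>) * gwt \<sigma> y) = 0"
    using \<sigma> by (intro gaussian_by_parts) (auto intro!: exp_growth_intros derivative_eq_intros g simp: add_divide_distrib power2_eq_square mult_ac)
  moreover have "(LINT y|lborel. (y * g y / \<sigma> - g' y)\<^sup>2 * gwt \<sigma> y)
     + (LINT y|lborel. (((g y)\<^sup>2 / \<sigma> + 2 * y * g y * g' y / \<sigma>) - y * (y * (g y)\<^sup>2 / \<sigma>) / \<sigma>) * gwt \<sigma> y)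
    = (LINT y|lborel. (y * g y / \<sigma> - g' y)\<^sup>2 * gwt \<sigma> y
     + (((g y)\<^sup>2 / \<sigma> + 2 * y * g y * g' y / \<sigma>) - y * (y * (g y)\<^sup>2 / \<sigma>) / \<sigma>) * gwt \<sigma> y)"
    by (intro Bochner_Integration.integral_add[symmetric] integrable_exp_growth exp_growth_intros g)
  moreover have "\<dots> = (LINT y|lborel. (g' y)\<^sup>2 * gwt \<sigma> y + ((g y)\<^sup>2 / \<sigma>) * gwt \<sigma> y)"
    using \<sigma> by (intro Bochner_Integration.integral_cong) (auto simp: field_simps power2_eq_square)
  moreover have "\<dots> = (LINT y|lborel. (g' y)\<^sup>2 * gwt \<sigma> y) + (LINT y|lborel. ((g y)\<^sup>2 / \<sigma>) * gwt \<sigma> y)"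
    by (intro Bochner_Integration.integral_add integrable_exp_growth exp_growth_intros g)
  ultimately show ?thesis by simp
qed

text \<open>The spectral gap on the complement of the polynomials of degree at most \<open>n\<close>, stated for
  the primitive \<open>g\<close> so that no derivative of \<open>r\<close> is needed: if \<open>r\<close> is orthogonal to degrees up to
  \<open>n + 1\<close>, then \<open>g\<close> is orthogonal to degrees up to \<open>n\<close>.\<close>

lemma gaussian_gap:
  assumes "exp_growth r" "\<And>j. j \<le> n \<Longrightarrow> (LINT y|lborel. r y * hermite \<sigma> j y * gwt \<sigma> y) = 0"
  obtains g g' where "exp_growth g" "exp_growth g'" "\<And>y. (g has_field_derivative g' y) (at y)"
    "\<And>y. r y = y * g y / \<sigma> - g' y"
    "real (Suc n) / \<sigma> * (LINT y|lborel. (g y)\<^sup>2 * gwt \<sigma> y) \<le> (LINT y|lborel. (r y)\<^sup>2 * gwt \<sigma> y)"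
  using assms
proof (induction n arbitrary: r thesis)
  case (0 r)
  have "(LINT y|lborel. r y * gwt \<sigma> y) = 0" using 0(3)[of 0] by simp
  then obtain g g' where g: "exp_growth g" "exp_growth g'" "\<And>y. (g has_field_derivative g' y) (at y)"
    "\<And>y. r y = y * g y / \<sigma> - g' y" using gaussian_divergence_solve[OF 0(2)] by metis
  have "real (Suc 0) / \<sigma> * (LINT y|lborel. (g y)\<^sup>2 * gwt \<sigma> y) \<le> (LINT y|lborel. (r y)\<^sup>2 * gwt \<sigma> y)"
    unfolding g(4) gaussian_divergence_norm[OF g(1-3)]
    using gwt_pos[OF \<sigma>] by (auto intro!: Bochner_Integration.integral_nonneg simp: less_imp_le)
  then show ?case using 0(1) g by blast
next
  case (Suc n r)
  have "(LINT y|lborel. r y * gwt \<sigma> y) = 0" using Suc(4)[of 0] by simp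
  then obtain g g' where g: "exp_growth g" "exp_growth g'" "\<And>y. (g has_field_derivative g' y) (at y)"
    "\<And>y. r y = y * g y / \<sigma> - g' y" using gaussian_divergence_solve[OF Suc(3)] by metis
  have orth: "(LINT y|lborel. g y * hermite \<sigma> j y * gwt \<sigma> y) = 0" if "j \<le> n" for j
  proof -
    have "(LINT y|lborel. r y * hermite \<sigma> (Suc j) y * gwt \<sigma> y)
      = (LINT y|lborel. g y * (real (Suc j) * hermite \<sigma> j y) * gwt \<sigma> y)"
      unfolding g(4) using has_derivative_hermite[of \<sigma> "Suc j"]
      by (intro gaussian_adjoint g) (auto intro!: exp_growth_intros)
    also have "\<dots> = (LINT y|lborel. real (Suc j) * (g y * hermite \<sigma> j y * gwt \<sigma> y))"
      by (intro Bochner_Integration.integral_cong) auto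
    finally show ?thesis using Suc(4)[of "Suc j"] that by simp
  qed
  obtain k k' where k: "exp_growth k" "exp_growth k'" "\<And>y. (k has_field_derivative k' y) (at y)"
    "\<And>y. g y = y * k y / \<sigma> - k' y"
    "real (Suc n) / \<sigma> * (LINT y|lborel. (k y)\<^sup>2 * gwt \<sigma> y) \<le> (LINT y|lborel. (g y)\<^sup>2 * gwt \<sigma> y)"
    using Suc.IH[OF _ g(1) orth] by blast
  define s where "s = real (Suc n) / \<sigma>"
  have s: "s > 0" using \<sigma> by (simp add: s_def)
  let ?G = "LINT y|lborel. (g y)\<^sup>2 * gwt \<sigma> y" and ?K = "LINT y|lborel. (k y)\<^sup>2 * gwt \<sigma> y"
    and ?G' = "LINT y|lborel. (g' y)\<^sup>2 * gwt \<sigma> y"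
  \<comment> \<open>\<open>g\<close> is the adjoint operator applied to \<open>k\<close>, so its
    square norm is the pairing of \<open>k\<close> with \<open>g'\<close>. Young's inequality with
    weight \<open>s\<close> gives \<open>?G\<close> \<le> s \<open>?K\<close> / 2 +
    \<open>?G'\<close> / (2 s), and the induction hypothesis s \<open>?K\<close> \<le>
    \<open>?G\<close> turns this into s \<open>?G\<close> \<le> \<open>?G'\<close>.\<close>
  have "?G = (LINT y|lborel. (y * k y / \<sigma> - k' y) * g y * gwt \<sigma> y)"
    by (simp add: k(4) power2_eq_square mult_ac)
  also have "\<dots> = (LINT y|lborel. k y * g' y * gwt \<sigma> y)"
    by (rule gaussian_adjoint[OF k(1-3) g(1-3)])
  also have "\<dots> \<le> (LINT y|lborel. (s / 2) * ((k y)\<^sup>2 * gwt \<sigma> y) + (1 / (2 * s)) * ((g' y)\<^sup>2 * gwt \<sigma> y))"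
  proof (rule integral_mono)
    show "integrable lborel (\<lambda>y. k y * g' y * gwt \<sigma> y)"
      by (intro integrable_exp_growth exp_growth_intros k g)
    show "integrable lborel (\<lambda>y. (s / 2) * ((k y)\<^sup>2 * gwt \<sigma> y) + (1 / (2 * s)) * ((g' y)\<^sup>2 * gwt \<sigma> y))"
      by (intro Bochner_Integration.integrable_add integrable_mult_right integrable_exp_growth exp_growth_intros k g)
    fix y
    have "0 \<le> (s * k y - g' y)\<^sup>2 / (2 * s)" using s by simp
    then have "k y * g' y \<le> (s / 2) * (k y)\<^sup>2 + (1 / (2 * s)) * (g' y)\<^sup>2"
      using s by (simp add: power2_eq_square field_simps)
    from mult_right_mono[OF this less_imp_le[OF gwt_pos[OF \<sigma>, of y]]]
    show "k y * g' y * gwt \<sigma> y \<le> (s / 2) * ((k y)\<^sup>2 * gwt \<sigma> y) + (1 / (2 * s)) * ((g' y)\<^sup>2 * gwt \<sigma> y)"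
      by (simp only: distrib_right mult.assoc)
  qed
  also have "\<dots> = (s / 2) * ?K + (1 / (2 * s)) * ?G'"
    by (subst Bochner_Integration.integral_add)
       (auto intro!: integrable_mult_right integrable_exp_growth exp_growth_intros k g simp del: times_divide_eq_left)
  finally have "?G \<le> (s * ?K) / 2 + ?G' / (2 * s)" by simp
  with k(5) have "?G \<le> ?G' / s" unfolding s_def[symmetric] by simp
  then have "s * ?G \<le> ?G'" using s by (simp add: field_simps)
  \<comment> \<open>The commutator term \<open>?G\<close> / \<sigma> raises the gap by one step,
    from (n + 1) / \<sigma> to (n + 2) / \<sigma>.\<close>
  moreover have "(LINT y|lborel. (r y)\<^sup>2 * gwt \<sigma> y) = ?G' + ?G / \<sigma>"
    unfolding g(4) by (rule gaussian_divergence_norm[OF g(1-3)])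
  moreover have "real (Suc (Suc n)) / \<sigma> * ?G = s * ?G + ?G / \<sigma>"
    using \<sigma> by (simp add: s_def field_simps)
  ultimately have "real (Suc (Suc n)) / \<sigma> * ?G \<le> (LINT y|lborel. (r y)\<^sup>2 * gwt \<sigma> y)" by linarith
  then show ?case using Suc(2) g by blast
qed

text \<open>By the recurrence, \<open>hermite \<sigma> (Suc k)\<close> is \<sigma> times the adjoint
  of d/dy applied to \<open>hermite \<sigma> k\<close>.\<close>

lemma hermite_Suc_adjoint:
  assumes f: "exp_growth f" "exp_growth f'" "\<And>y. (f has_field_derivative f' y) (at y)"
  shows "(LINT y|lborel. hermite \<sigma> (Suc k) y * f y * gwt \<sigma> y) = \<sigma> * (LINT y|lborel. hermite \<sigma> k y * f' y * gwt \<sigma> y)"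
proof -
  have "hermite \<sigma> (Suc k) y = \<sigma> * (y * hermite \<sigma> k y / \<sigma> - real k * hermite \<sigma> (k - 1) y)" for y
    using \<sigma> by (simp add: hermite_Suc right_diff_distrib)
  then have "(LINT y|lborel. hermite \<sigma> (Suc k) y * f y * gwt \<sigma> y)
    = \<sigma> * (LINT y|lborel. (y * hermite \<sigma> k y / \<sigma> - real k * hermite \<sigma> (k - 1) y) * f y * gwt \<sigma> y)"
    by (simp add: mult.assoc)
  also have "(LINT y|lborel. (y * hermite \<sigma> k y / \<sigma> - real k * hermite \<sigma> (k - 1) y) * f y * gwt \<sigma> y)
    = (LINT y|lborel. hermite \<sigma> k y * f' y * gwt \<sigma> y)"
    by (intro gaussian_adjoint f has_derivative_hermite exp_growth_intros)
  finally show ?thesis .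
qed

text \<open>The squared norm of \<open>hermite \<sigma> k\<close> in the weighted space; this is the
  diagonal case of \<open>hermite_orthogonal\<close>.\<close>

definition hermite_norm :: "nat \<Rightarrow> real" where
  "hermite_norm k = fact k * \<sigma> ^ k * sqrt (2 * pi * \<sigma>)"

lemma hermite_norm_pos: "hermite_norm k > 0"
  using \<sigma> by (simp add: hermite_norm_def)

lemma hermite_orthogonal:
  "(LINT y|lborel. hermite \<sigma> j y * hermite \<sigma> k y * gwt \<sigma> y) = (if j = k then hermite_norm k else 0)"
proof (induction j arbitrary: k)
  case 0
  show ?case
  proof (cases k)
    case 0 then show ?thesis by (simp add: integral_gwt[OF \<sigma>] hermite_norm_def)
  next
    case (Suc m)
    have "(LINT y|lborel. hermite \<sigma> (Suc m) y * 1 * gwt \<sigma> y) = \<sigma> * (LINT y|lborel. hermite \<sigma> m y * 0 * gwt \<sigma> y)"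
      by (rule hermite_Suc_adjoint) (auto intro!: exp_growth_intros)
    then show ?thesis using Suc by (simp add: mult_ac)
  qed
next
  case (Suc j)
  have "(LINT y|lborel. hermite \<sigma> (Suc j) y * hermite \<sigma> k y * gwt \<sigma> y)
    = \<sigma> * (LINT y|lborel. hermite \<sigma> j y * (real k * hermite \<sigma> (k - 1) y) * gwt \<sigma> y)"
    by (intro hermite_Suc_adjoint has_derivative_hermite exp_growth_intros)
  also have "\<dots> = \<sigma> * (real k * (LINT y|lborel. hermite \<sigma> j y * hermite \<sigma> (k - 1) y * gwt \<sigma> y))"
    by (subst (2) integral_mult_right_zero[symmetric]) (simp add: mult_ac)
  also have "\<dots> = (if Suc j = k then hermite_norm k else 0)"
    unfolding Suc.IH by (cases k) (auto simp: hermite_norm_def)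
  finally show ?case .
qed

text \<open>\<open>F\<close> is the mean of \<open>f\<close> over a short interval {y..y+h}, written
  as a difference quotient of a primitive: it is again bounded by \<open>B\<close>, its derivative
  is bounded for each fixed h, and dominated convergence applies as h tends to 0.\<close>

lemma smooth_approximation:
  assumes f: "continuous_on UNIV f" "\<And>y. \<bar>f y\<bar> \<le> B" and "e > 0"
  obtains F F' where "exp_growth F" "exp_growth F'" "\<And>y. (F has_field_derivative F' y) (at y)"
    "(LINT y|lborel. (f y - F y)\<^sup>2 * gwt \<sigma> y) < e"
proof -
  obtain \<Psi> where \<Psi>: "\<And>y. (\<Psi> has_field_derivative f y) (at y)" using has_antiderivative_UNIV[OF f(1)] by blast
  define h where "h m = inverse (real (Suc m))" for m
  have h: "h m > 0" for m by (simp add: h_def)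
  define F where "F m y = (\<Psi> (y + h m) - \<Psi> y) / h m" for m y
  define F' where "F' m y = (f (y + h m) - f y) / h m" for m y
  have dF: "(F m has_field_derivative F' m y) (at y)" for m y
  proof -
    have "((\<lambda>y. \<Psi> (y + h m)) has_field_derivative f (y + h m)) (at y)"
      using \<Psi>[of "y + h m"] by (simp add: DERIV_shift)
    then show ?thesis unfolding F_def[abs_def] F'_def using h[of m] by (auto intro!: derivative_eq_intros \<Psi>)
  qed
  have FB: "\<bar>F m y\<bar> \<le> B" for m y
  proof -
    obtain z where "\<Psi> (y + h m) - \<Psi> y = (y + h m - y) * f z"
      using MVT2[of y "y + h m" \<Psi> f] \<Psi> h[of m] by auto
    then show ?thesis using f(2)[of z] h[of m] by (simp add: F_def)
  qed
  have eF: "exp_growth (F m)" for m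
    using dF FB by (intro exp_growth_bounded) (auto intro: DERIV_continuous_on has_field_derivative_at_within)
  have ef: "exp_growth f" by (rule exp_growth_bounded[OF f])
  have eF': "exp_growth (F' m)" for m
  proof -
    have "exp_growth (\<lambda>y. f (y + h m))"
      by (rule exp_growth_bounded[of _ B])
         (auto intro!: f(2) continuous_on_compose2[OF f(1)] continuous_intros)
    then show ?thesis unfolding F'_def by (intro exp_growth_intros ef)
  qed
  have lim: "(\<lambda>m. F m y) \<longlonglongrightarrow> f y" for y
  proof -
    have "(h \<longlongrightarrow> 0) sequentially" unfolding h_def[abs_def] by (rule LIMSEQ_inverse_real_of_nat)
    moreover have "((\<lambda>h. (\<Psi> (y + h) - \<Psi> y) / h) \<longlongrightarrow> f y) (at 0)" using \<Psi>[of y] by (simp add: DERIV_def)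
    ultimately show ?thesis unfolding F_def
      by (rule_tac filterlim_compose[of "\<lambda>h. (\<Psi> (y + h) - \<Psi> y) / h" _ "at 0"])
        (use h in \<open>auto simp: filterlim_at less_imp_neq[OF h, symmetric] intro!: always_eventually\<close>)
  qed
  have "(\<lambda>m. LINT y|lborel. (f y - F m y)\<^sup>2 * gwt \<sigma> y) \<longlonglongrightarrow> (LINT y|lborel. (f y - f y)\<^sup>2 * gwt \<sigma> y)"
  proof (rule integral_dominated_convergence[where w = "\<lambda>y. (2 * B)\<^sup>2 * gwt \<sigma> y"])
    show "(\<lambda>y. (f y - f y)\<^sup>2 * gwt \<sigma> y) \<in> borel_measurable lborel" by simp
    show "(\<lambda>y. (f y - F m y)\<^sup>2 * gwt \<sigma> y) \<in> borel_measurable lborel" for m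
      by (intro borel_measurable_integrable integrable_exp_growth exp_growth_intros ef eF)
    show "integrable lborel (\<lambda>y. (2 * B)\<^sup>2 * gwt \<sigma> y)" using integrable_gwt[OF \<sigma>] by simp
    show "AE y in lborel. (\<lambda>m. (f y - F m y)\<^sup>2 * gwt \<sigma> y) \<longlonglongrightarrow> (f y - f y)\<^sup>2 * gwt \<sigma> y"
      by (intro AE_I2 tendsto_intros lim)
    show "AE y in lborel. norm ((f y - F m y)\<^sup>2 * gwt \<sigma> y) \<le> (2 * B)\<^sup>2 * gwt \<sigma> y" for m
    proof (rule AE_I2)
      fix y
      have "\<bar>f y - F m y\<bar> \<le> 2 * B" using f(2)[of y] FB[of m y] by linarith
      then have "(f y - F m y)\<^sup>2 \<le> (2 * B)\<^sup>2" using power_mono[of "\<bar>f y - F m y\<bar>" "2 * B" 2] by simp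
      then show "norm ((f y - F m y)\<^sup>2 * gwt \<sigma> y) \<le> (2 * B)\<^sup>2 * gwt \<sigma> y"
        using gwt_pos[OF \<sigma>, of y] by (simp add: abs_mult mult_right_mono)
    qed
  qed
  then have "(\<lambda>m. LINT y|lborel. (f y - F m y)\<^sup>2 * gwt \<sigma> y) \<longlonglongrightarrow> 0" by simp
  then have "eventually (\<lambda>m. (LINT y|lborel. (f y - F m y)\<^sup>2 * gwt \<sigma> y) < e) sequentially"
    using \<open>e > 0\<close> by (rule order_tendstoD)
  then obtain m where "(LINT y|lborel. (f y - F m y)\<^sup>2 * gwt \<sigma> y) < e" by (auto simp: eventually_sequentially)
  then show ?thesis using that eF eF' dF by blast
qed

text \<open>Completeness comes from the spectral gap instead of a density argument for polynomials.
  The remainder \<open>r n\<close> is orthogonal to all degrees below n, so it is the adjoint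
  operator applied to a \<open>g\<close> whose square norm is at most \<sigma> / n times its own;
  its pairing with a fixed differentiable \<open>F\<close> equals that of \<open>g\<close> with
  \<open>F'\<close> and so becomes negligible.\<close>

theorem hermite_parseval:
  assumes f: "continuous_on UNIV f" "\<And>y. \<bar>f y\<bar> \<le> B"
  shows "(\<lambda>k. (LINT y|lborel. f y * hermite \<sigma> k y * gwt \<sigma> y)\<^sup>2 / hermite_norm k) sums
    (LINT y|lborel. (f y)\<^sup>2 * gwt \<sigma> y)"
proof -
  have ef: "exp_growth f" by (rule exp_growth_bounded[OF f])
  define c where "c k = (LINT y|lborel. f y * hermite \<sigma> k y * gwt \<sigma> y)" for k
  define r where "r n y = f y - (\<Sum>k<n. c k / hermite_norm k * hermite \<sigma> k y)" for n y
  have er: "exp_growth (r n)" for n unfolding r_def by (intro exp_growth_intros ef)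
  have rip: "(LINT y|lborel. r n y * g y * gwt \<sigma> y) = (LINT y|lborel. f y * g y * gwt \<sigma> y)
      - (\<Sum>k<n. c k / hermite_norm k * (LINT y|lborel. hermite \<sigma> k y * g y * gwt \<sigma> y))" if g: "exp_growth g" for g n
  proof -
    have "(LINT y|lborel. r n y * g y * gwt \<sigma> y) = (LINT y|lborel. f y * g y * gwt \<sigma> y
      - (\<Sum>k<n. c k / hermite_norm k * (hermite \<sigma> k y * g y * gwt \<sigma> y)))"
      by (intro Bochner_Integration.integral_cong) (auto simp: r_def left_diff_distrib right_diff_distrib sum_distrib_left sum_distrib_right mult_ac)
    also have "\<dots> = (LINT y|lborel. f y * g y * gwt \<sigma> y)
      - (\<Sum>k<n. LINT y|lborel. c k / hermite_norm k * (hermite \<sigma> k y * g y * gwt \<sigma> y))"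
      by (subst Bochner_Integration.integral_diff, (intro Bochner_Integration.integrable_sum integrable_mult_right integrable_exp_growth exp_growth_intros ef g)+,
          subst Bochner_Integration.integral_sum, intro integrable_mult_right integrable_exp_growth exp_growth_intros g) simp
    finally show ?thesis by (simp only: integral_mult_right_zero)
  qed
  have orth: "(LINT y|lborel. r (Suc n) y * hermite \<sigma> j y * gwt \<sigma> y) = 0" if "j \<le> n" for j n
  proof -
    have "(\<Sum>k<Suc n. c k / hermite_norm k * (if k = j then hermite_norm j else 0)) = (\<Sum>k<Suc n. if k = j then c j else 0)"
      using hermite_norm_pos[of j] by (intro sum.cong) auto
    also have "\<dots> = c j" using that by (subst sum.delta) auto
    finally show ?thesis
      by (subst rip[OF exp_growth_hermite]) (simp add: hermite_orthogonal c_def)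
  qed
  define R where "R n = (LINT y|lborel. (r n y)\<^sup>2 * gwt \<sigma> y)" for n
  have R0: "R n \<ge> 0" for n
    unfolding R_def by (intro Bochner_Integration.integral_nonneg) (simp add: less_imp_le gwt_pos[OF \<sigma>])
  have R1: "R n = (LINT y|lborel. f y * r n y * gwt \<sigma> y)" for n
  proof (cases n)
    case (Suc m)
    have "R n = (LINT y|lborel. r n y * r n y * gwt \<sigma> y)" by (simp add: R_def power2_eq_square)
    also have "\<dots> = (LINT y|lborel. f y * r n y * gwt \<sigma> y)"
      by (subst rip[OF er]) (use orth[of _ m] Suc in \<open>simp add: mult.commute[of "hermite \<sigma> _ _"]\<close>)
    finally show ?thesis .
  qed (simp add: R_def r_def power2_eq_square)
  have R2: "R n = (LINT y|lborel. (f y)\<^sup>2 * gwt \<sigma> y) - (\<Sum>k<n. (c k)\<^sup>2 / hermite_norm k)" for n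
    using rip[OF ef, of n] R1[of n] by (simp add: c_def power2_eq_square mult_ac)
  have "R \<longlonglongrightarrow> 0"
  proof (rule LIMSEQ_I)
    fix e :: real assume "e > 0"
    then obtain F F' where F: "exp_growth F" "exp_growth F'" "\<And>y. (F has_field_derivative F' y) (at y)"
      "(LINT y|lborel. (f y - F y)\<^sup>2 * gwt \<sigma> y) < e / 4" using smooth_approximation[OF f, of "e / 4"] by auto
    define E where "E = (LINT y|lborel. (F' y)\<^sup>2 * gwt \<sigma> y)"
    \<comment> \<open>Makes \<open>E / s\<close> < e / 8 below. Together with the two quarters of
      \<open>R n\<close> split off by Young's inequality this yields \<open>R n\<close> < 3 e /
      4.\<close>
    obtain N where N: "8 * \<sigma> * E / e < real N" using reals_Archimedean2 by blast
    have "norm (R n - 0) < e" if "n \<ge> Suc N" for n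
    proof -
      obtain m where m: "n = Suc m" "m \<ge> N" using \<open>n \<ge> Suc N\<close> by (cases n) auto
      obtain g g' where g: "exp_growth g" "exp_growth g'" "\<And>y. (g has_field_derivative g' y) (at y)"
        "\<And>y. r n y = y * g y / \<sigma> - g' y"
        "real (Suc m) / \<sigma> * (LINT y|lborel. (g y)\<^sup>2 * gwt \<sigma> y) \<le> R n"
        by (rule gaussian_gap[OF er[of n], of m]) (use orth[of _ m] in \<open>simp add: m\<close>, rule that, (assumption | simp add: R_def)+)
      define s where "s = real (Suc m) / \<sigma>"
      have s: "s > 0" using \<sigma> by (simp add: s_def)
      \<comment> \<open>The remainder is orthogonal to its own partial sum, so \<open>R n\<close> is
        its pairing with \<open>f\<close>; \<open>f\<close> is then replaced by \<open>F\<close> at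
        the price of the approximation error.\<close>
      have "R n = (LINT y|lborel. (f y - F y) * r n y * gwt \<sigma> y + r n y * F y * gwt \<sigma> y)"
        unfolding R1 by (intro Bochner_Integration.integral_cong) (auto simp: algebra_simps)
      also have "\<dots> = (LINT y|lborel. (f y - F y) * r n y * gwt \<sigma> y) + (LINT y|lborel. r n y * F y * gwt \<sigma> y)"
        by (intro Bochner_Integration.integral_add integrable_exp_growth exp_growth_intros ef er F)
      also have "(LINT y|lborel. r n y * F y * gwt \<sigma> y) = (LINT y|lborel. g y * F' y * gwt \<sigma> y)"
        unfolding g(4) by (intro gaussian_adjoint g F)
      also have "\<dots> \<le> (LINT y|lborel. (s / 4) * ((g y)\<^sup>2 * gwt \<sigma> y) + (1 / s) * ((F' y)\<^sup>2 * gwt \<sigma> y))"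
      proof (rule integral_mono)
        fix y
        have "0 \<le> (s / 2 * g y - F' y)\<^sup>2 / s" using s by simp
        then have "g y * F' y \<le> (s / 4) * (g y)\<^sup>2 + (1 / s) * (F' y)\<^sup>2"
          using s by (simp add: power2_eq_square field_simps)
        from mult_right_mono[OF this less_imp_le[OF gwt_pos[OF \<sigma>, of y]]]
        show "g y * F' y * gwt \<sigma> y \<le> (s / 4) * ((g y)\<^sup>2 * gwt \<sigma> y) + (1 / s) * ((F' y)\<^sup>2 * gwt \<sigma> y)"
          by (simp only: distrib_right mult.assoc)
      qed (intro Bochner_Integration.integrable_add integrable_mult_right integrable_exp_growth exp_growth_intros g F)+
      also have "\<dots> = (s / 4) * (LINT y|lborel. (g y)\<^sup>2 * gwt \<sigma> y) + (1 / s) * E"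
        by (subst Bochner_Integration.integral_add)
          (auto intro!: integrable_mult_right integrable_exp_growth exp_growth_intros g F simp: E_def simp del: times_divide_eq_left)
      also have "\<dots> \<le> R n / 4 + E / s" using g(5) unfolding s_def[symmetric] by simp
      also have "(LINT y|lborel. (f y - F y) * r n y * gwt \<sigma> y)
        \<le> (LINT y|lborel. 1 * ((f y - F y)\<^sup>2 * gwt \<sigma> y) + (1 / 4) * ((r n y)\<^sup>2 * gwt \<sigma> y))"
      proof (rule integral_mono)
        fix y
        have "0 \<le> (f y - F y - r n y / 2)\<^sup>2" by simp
        then have "(f y - F y) * r n y \<le> 1 * (f y - F y)\<^sup>2 + (1 / 4) * (r n y)\<^sup>2"
          by (simp add: power2_eq_square field_simps)
        from mult_right_mono[OF this less_imp_le[OF gwt_pos[OF \<sigma>, of y]]]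
        show "(f y - F y) * r n y * gwt \<sigma> y \<le> 1 * ((f y - F y)\<^sup>2 * gwt \<sigma> y) + (1 / 4) * ((r n y)\<^sup>2 * gwt \<sigma> y)"
          by (simp only: distrib_right mult.assoc)
      qed (intro Bochner_Integration.integrable_add integrable_mult_right integrable_exp_growth exp_growth_intros ef er F)+
      also have "\<dots> = (LINT y|lborel. (f y - F y)\<^sup>2 * gwt \<sigma> y) + R n / 4"
        by (subst Bochner_Integration.integral_add)
          (auto intro!: integrable_mult_right integrable_exp_growth exp_growth_intros ef er F simp: R_def simp del: times_divide_eq_left)
      finally have "R n < (e / 4 + R n / 4) + (R n / 4 + E / s)" using F(4) by linarith
      moreover have "E / s < e / 8"
      proof -
        have "8 * \<sigma> * E / e < real (Suc m)" using N m by linarith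
        then show ?thesis using \<open>e > 0\<close> \<sigma> by (simp add: s_def field_simps)
      qed
      ultimately show ?thesis using R0[of n] unfolding real_norm_def by linarith
    qed
    then show "\<exists>no. \<forall>n\<ge>no. norm (R n - 0) < e" by blast
  qed
  then have "(\<lambda>n. (LINT y|lborel. (f y)\<^sup>2 * gwt \<sigma> y) - R n) \<longlonglongrightarrow> (LINT y|lborel. (f y)\<^sup>2 * gwt \<sigma> y) - 0"
    by (intro tendsto_intros)
  then show ?thesis by (simp add: R2 sums_def c_def)
qed

end

text \<open>Continuity in each variable separately is what one-dimensional Parseval consumes, and
  joint measurability is what Tonelli consumes; the combination with boundedness survives taking a
  Hermite coefficient in one variable.\<close>

definition sep_cont :: "'i set \<Rightarrow> (('i \<Rightarrow> real) \<Rightarrow> real) \<Rightarrow> bool" where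
  "sep_cont I f \<longleftrightarrow> f \<in> borel_measurable (\<Pi>\<^sub>M i\<in>I. lborel) \<and> (\<exists>B. \<forall>x\<in>(\<Pi>\<^sub>E i\<in>I. UNIV). \<bar>f x\<bar> \<le> B) \<and>
     (\<forall>x\<in>(\<Pi>\<^sub>E i\<in>I. UNIV). \<forall>i\<in>I. continuous_on UNIV (\<lambda>s. f (x(i := s))))"

text \<open>The series appears as an integral against counting measure so that Tonelli can exchange
  it with the integrals over the remaining variables.\<close>

lemma hermite_parseval_nn:
  assumes "\<sigma> > 0" and f: "continuous_on UNIV f" "\<And>y. \<bar>f y\<bar> \<le> B"
  shows "(\<integral>\<^sup>+y. ennreal ((f y)\<^sup>2 * gwt \<sigma> y) \<partial>lborel) =
    (\<integral>\<^sup>+k. ennreal ((LINT y|lborel. f y * (hermite \<sigma> k y * gwt \<sigma> y))\<^sup>2 / hermite_norm \<sigma> k) \<partial>count_space UNIV)"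
proof -
  have ef: "exp_growth f" by (rule exp_growth_bounded[OF f])
  note ps = hermite_parseval[OF \<open>\<sigma> > 0\<close> f]
  have "(\<integral>\<^sup>+y. ennreal ((f y)\<^sup>2 * gwt \<sigma> y) \<partial>lborel) = ennreal (LINT y|lborel. (f y)\<^sup>2 * gwt \<sigma> y)"
    using gwt_pos[OF \<open>\<sigma> > 0\<close>]
    by (intro nn_integral_eq_integral integrable_exp_growth exp_growth_intros ef AE_I2) (auto simp: less_imp_le \<open>\<sigma> > 0\<close>)
  also have "\<dots> = (\<Sum>k. ennreal ((LINT y|lborel. f y * hermite \<sigma> k y * gwt \<sigma> y)\<^sup>2 / hermite_norm \<sigma> k))"
    unfolding sums_unique[OF ps]
    by (rule suminf_ennreal2[OF _ sums_summable[OF ps], symmetric])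
       (simp add: divide_nonneg_pos hermite_norm_pos[OF \<open>\<sigma> > 0\<close>])
  finally show ?thesis unfolding nn_integral_count_space_nat mult.assoc .
qed

section \<open>Parseval in finitely many variables\<close>

interpretation lebesgue_product: product_sigma_finite "\<lambda>_. lborel :: real measure"
  by (intro product_sigma_finite.intro) (rule sigma_finite_lborel)

interpretation count_product: product_sigma_finite "\<lambda>_. count_space (UNIV :: nat set)"
  by (intro product_sigma_finite.intro sigma_finite_measure_count_space_countable) simp

lemma sep_cont_update:
  assumes "sep_cont (insert i I) f" "x \<in> (\<Pi>\<^sub>E j\<in>I. UNIV)"
  shows "continuous_on UNIV (\<lambda>y. f (x(i := y)))"
proof -
  have "x(i := 0) \<in> (\<Pi>\<^sub>E j\<in>insert i I. UNIV)" using assms(2) by (auto simp: PiE_def extensional_def)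
  then have "continuous_on UNIV (\<lambda>y. f ((x(i := 0))(i := y)))" using assms(1) unfolding sep_cont_def by blast
  then show ?thesis by simp
qed

lemma measurable_update_section:
  assumes "f \<in> borel_measurable (\<Pi>\<^sub>M i\<in>insert i I. (lborel :: real measure))"
  shows "(\<lambda>(x, y). f (x(i := y))) \<in> borel_measurable ((\<Pi>\<^sub>M i\<in>I. lborel) \<Otimes>\<^sub>M lborel)"
  using measurable_comp[OF measurable_add_dim assms] by (simp add: comp_def case_prod_beta)

lemma integrable_hermite_gwt:
  "\<sigma> > 0 \<Longrightarrow> integrable lborel (\<lambda>y. hermite \<sigma> k y * gwt \<sigma> y)"
  by (intro integrable_exp_growth exp_growth_intros)

text \<open>The invariant of the induction over the variables. Continuity in a remaining variable is
  dominated convergence, with the majorant \<open>B\<close> times the absolute value of the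
  integrable factor.\<close>

lemma sep_cont_coefficient:
  fixes f :: "('i \<Rightarrow> real) \<Rightarrow> real"
  assumes "\<sigma> > 0" and I: "i \<notin> I" and f: "sep_cont (insert i I) f"
  shows "sep_cont I (\<lambda>x. LINT y|lborel. f (x(i := y)) * (hermite \<sigma> k y * gwt \<sigma> y))"
proof -
  let ?w = "\<lambda>y. hermite \<sigma> k y * gwt \<sigma> y"
  have w: "integrable lborel ?w" by (rule integrable_hermite_gwt[OF \<open>\<sigma> > 0\<close>])
  have fm: "f \<in> borel_measurable (\<Pi>\<^sub>M i\<in>insert i I. lborel)" using f by (simp add: sep_cont_def)
  obtain B where B: "\<And>x. x \<in> (\<Pi>\<^sub>E i\<in>insert i I. UNIV) \<Longrightarrow> \<bar>f x\<bar> \<le> B" using f unfolding sep_cont_def by blast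
  have upd: "x(i := y) \<in> (\<Pi>\<^sub>E i\<in>insert i I. UNIV)" if "x \<in> (\<Pi>\<^sub>E i\<in>I. UNIV)" for x and y :: real
    using that by (auto simp: PiE_def extensional_def)
  have wm[measurable]: "?w \<in> borel_measurable borel" using borel_measurable_integrable[OF w] by simp
  note [measurable] = measurable_update_section[OF fm]
  have fxm: "(\<lambda>y. f (x(i := y))) \<in> borel_measurable borel" if "x \<in> (\<Pi>\<^sub>E i\<in>I. UNIV)" for x
    by (rule borel_measurable_continuous_onI[OF sep_cont_update[OF f that]])
  have bd: "norm (f (x(i := y)) * ?w y) \<le> B * \<bar>?w y\<bar>" if "x \<in> (\<Pi>\<^sub>E i\<in>I. UNIV)" for x y
    using B[OF upd[OF that, of y]] by (simp add: abs_mult mult_right_mono)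
  have Bi: "integrable lborel (\<lambda>y. B * \<bar>?w y\<bar>)" using integrable_norm[OF w] by simp
  show ?thesis
    unfolding sep_cont_def
  proof (intro conjI ballI)
    show "(\<lambda>x. LINT y|lborel. f (x(i := y)) * ?w y) \<in> borel_measurable (\<Pi>\<^sub>M i\<in>I. lborel)"
      by measurable
    have "\<bar>LINT y|lborel. f (x(i := y)) * ?w y\<bar> \<le> (LINT y|lborel. B * \<bar>?w y\<bar>)" if x: "x \<in> (\<Pi>\<^sub>E i\<in>I. UNIV)" for x
    proof -
      have "integrable lborel (\<lambda>y. f (x(i := y)) * ?w y)"
        by (rule Bochner_Integration.integrable_bound[OF Bi])
          (use fxm[OF x] in simp, intro AE_I2 order_trans[OF bd[OF x]], simp)
      then have "(LINT y|lborel. norm (f (x(i := y)) * ?w y)) \<le> (LINT y|lborel. B * \<bar>?w y\<bar>)"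
        by (intro integral_mono bd[OF x] Bi integrable_norm)
      then show ?thesis
        using integral_norm_bound[of lborel "\<lambda>y. f (x(i := y)) * ?w y"]
        unfolding real_norm_def by linarith
    qed
    then show "\<exists>B. \<forall>x\<in>(\<Pi>\<^sub>E i\<in>I. UNIV). \<bar>LINT y|lborel. f (x(i := y)) * ?w y\<bar> \<le> B" by blast
    fix x :: "'i \<Rightarrow> real" and j assume x: "x \<in> (\<Pi>\<^sub>E i\<in>I. UNIV)" and j: "j \<in> I"
    have xs: "x(j := s) \<in> (\<Pi>\<^sub>E i\<in>I. UNIV)" for s using x j by (auto simp: PiE_def extensional_def)
    have ij: "i \<noteq> j" using I j by auto
    show "continuous_on UNIV (\<lambda>s. LINT y|lborel. f ((x(j := s))(i := y)) * ?w y)"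
    proof (subst continuous_on_eq_continuous_at, simp, intro ballI, subst continuous_at_sequentially, intro allI impI)
      fix s and S :: "nat \<Rightarrow> real" assume S: "S \<longlonglongrightarrow> s"
      have "(\<lambda>n. LINT y|lborel. f ((x(j := S n))(i := y)) * ?w y) \<longlonglongrightarrow> (LINT y|lborel. f ((x(j := s))(i := y)) * ?w y)"
      proof (rule integral_dominated_convergence[OF _ _ Bi])
        show "(\<lambda>y. f ((x(j := s))(i := y)) * ?w y) \<in> borel_measurable lborel"
          "(\<lambda>y. f ((x(j := S n))(i := y)) * ?w y) \<in> borel_measurable lborel" for n
          using fxm[OF xs] by auto
        show "AE y in lborel. norm (f ((x(j := S n))(i := y)) * ?w y) \<le> B * \<bar>?w y\<bar>" for n
          by (intro AE_I2 bd xs)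
        have "(\<lambda>n. f ((x(i := y))(j := S n))) \<longlonglongrightarrow> f ((x(i := y))(j := s))" for y
        proof -
          have "continuous_on UNIV (\<lambda>s. f ((x(i := y))(j := s)))"
            using f upd[OF x, of y] j unfolding sep_cont_def by blast
          then have "isCont (\<lambda>s. f ((x(i := y))(j := s))) s" by (simp add: continuous_on_eq_continuous_at)
          then show ?thesis using S by (rule isCont_tendsto_compose)
        qed
        then show "AE y in lborel. (\<lambda>n. f ((x(j := S n))(i := y)) * ?w y) \<longlonglongrightarrow> f ((x(j := s))(i := y)) * ?w y"
          by (intro AE_I2 tendsto_intros) (simp add: fun_upd_twist[OF ij])
      qed
      then show "((\<lambda>s. LINT y|lborel. f ((x(j := s))(i := y)) * ?w y) \<circ> S) \<longlonglongrightarrow> (LINT y|lborel. f ((x(j := s))(i := y)) * ?w y)"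
        by (simp add: comp_def)
    qed
  qed
qed

lemma prod_fun_upd:
  fixes g :: "'i \<Rightarrow> 'b \<Rightarrow> 'c::comm_monoid_mult"
  assumes "finite I" "i \<notin> I"
  shows "(\<Prod>j\<in>insert i I. g j ((x(i := y)) j)) = g i y * (\<Prod>j\<in>I. g j (x j))"
proof -
  have "(\<Prod>j\<in>I. g j ((x(i := y)) j)) = (\<Prod>j\<in>I. g j (x j))"
    using assms by (intro prod.cong) auto
  then show ?thesis using assms by simp
qed

text \<open>For the new variable i, Parseval on the line is applied at each point x of the old
  variables; Tonelli then moves the sum over k outside, and the induction hypothesis applies to each
  coefficient function \<open>F k\<close>.\<close>

theorem hermite_parseval_PiM:
  assumes "finite I" "\<sigma> > 0" "sep_cont I f"
  shows "(\<integral>\<^sup>+x. ennreal ((f x)\<^sup>2 * (\<Prod>i\<in>I. gwt \<sigma> (x i))) \<partial>(\<Pi>\<^sub>M i\<in>I. lborel)) =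
    (\<integral>\<^sup>+a. ennreal ((LINT x|(\<Pi>\<^sub>M i\<in>I. lborel). f x * (\<Prod>i\<in>I. hermite \<sigma> (a i) (x i) * gwt \<sigma> (x i)))\<^sup>2
        / (\<Prod>i\<in>I. hermite_norm \<sigma> (a i))) \<partial>(\<Pi>\<^sub>M i\<in>I. count_space UNIV))"
  using assms(1,3)
proof (induction I arbitrary: f rule: finite_induct)
  case empty
  show ?case by (simp add: PiM_empty nn_integral_count_space_finite lebesgue_integral_count_space_finite)
next
  case (insert i I f)
  let ?L = "\<lambda>I. \<Pi>\<^sub>M i\<in>I. (lborel :: real measure)"
  let ?w = "\<lambda>k y. hermite \<sigma> k y * gwt \<sigma> y"
  let ?P = "\<lambda>x. \<Prod>j\<in>I. gwt \<sigma> (x j)"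
  define F where "F k x = (LINT y|lborel. f (x(i := y)) * ?w k y)" for k x
  have Fs: "sep_cont I (F k)" for k
    unfolding F_def by (rule sep_cont_coefficient[OF \<open>\<sigma> > 0\<close> insert.hyps(2) insert.prems])
  have fm[measurable]: "f \<in> borel_measurable (?L (insert i I))" using insert.prems by (simp add: sep_cont_def)
  have Fm[measurable]: "F k \<in> borel_measurable (?L I)" for k using Fs by (simp add: sep_cont_def)
  have gm[measurable]: "gwt \<sigma> \<in> borel_measurable borel"
    by (rule borel_measurable_continuous_onI[OF continuous_gwt[OF \<open>\<sigma> > 0\<close>]])
  have hm[measurable]: "hermite \<sigma> k \<in> borel_measurable borel" for k
    by (rule borel_measurable_continuous_onI[OF exp_growth_contD[OF exp_growth_hermite]])
  obtain B where B: "\<And>x. x \<in> (\<Pi>\<^sub>E i\<in>insert i I. UNIV) \<Longrightarrow> \<bar>f x\<bar> \<le> B"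
    using insert.prems unfolding sep_cont_def by blast
  have gp: "gwt \<sigma> y > 0" "?P x > 0" for x y using gwt_pos[OF \<open>\<sigma> > 0\<close>] by (auto intro!: prod_pos)
  have np: "hermite_norm \<sigma> k > 0" "(\<Prod>j\<in>I. hermite_norm \<sigma> (a j)) > 0" for a k
    using hermite_norm_pos[OF \<open>\<sigma> > 0\<close>] by (auto intro!: prod_pos)
  note prod_upd = prod_fun_upd[OF insert.hyps]
  have inner: "(\<integral>\<^sup>+y. ennreal ((f (x(i := y)))\<^sup>2 * (\<Prod>j\<in>insert i I. gwt \<sigma> ((x(i := y)) j))) \<partial>lborel)
    = (\<integral>\<^sup>+k. ennreal ((F k x)\<^sup>2 / hermite_norm \<sigma> k * ?P x) \<partial>count_space UNIV)"
    if x: "x \<in> space (?L I)" for x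
  proof -
    have x': "x \<in> (\<Pi>\<^sub>E j\<in>I. UNIV)" using x by (simp add: space_PiM)
    have bd: "\<bar>f (x(i := y))\<bar> \<le> B" for y
      using x' by (intro B) (auto simp: PiE_def extensional_def)
    note cont = sep_cont_update[OF insert.prems x']
    have "(\<integral>\<^sup>+y. ennreal ((f (x(i := y)))\<^sup>2 * (\<Prod>j\<in>insert i I. gwt \<sigma> ((x(i := y)) j))) \<partial>lborel)
      = (\<integral>\<^sup>+y. ennreal ((f (x(i := y)))\<^sup>2 * gwt \<sigma> y) * ennreal (?P x) \<partial>lborel)"
      unfolding prod_upd[of "\<lambda>_. gwt \<sigma>"] using gp
      by (intro nn_integral_cong) (simp add: ennreal_mult[symmetric] less_imp_le mult_ac)
    also have "\<dots> = (\<integral>\<^sup>+y. ennreal ((f (x(i := y)))\<^sup>2 * gwt \<sigma> y) \<partial>lborel) * ennreal (?P x)"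
    proof (rule nn_integral_multc)
      note [measurable] = borel_measurable_continuous_onI[OF cont]
      show "(\<lambda>y. ennreal ((f (x(i := y)))\<^sup>2 * gwt \<sigma> y)) \<in> borel_measurable lborel" by measurable
    qed
    also have "\<dots> = (\<integral>\<^sup>+k. ennreal ((F k x)\<^sup>2 / hermite_norm \<sigma> k) \<partial>count_space UNIV) * ennreal (?P x)"
      unfolding hermite_parseval_nn[OF \<open>\<sigma> > 0\<close> cont bd] F_def ..
    also have "\<dots> = (\<integral>\<^sup>+k. ennreal ((F k x)\<^sup>2 / hermite_norm \<sigma> k * ?P x) \<partial>count_space UNIV)"
      using gp np by (subst nn_integral_multc[symmetric]) (auto intro!: nn_integral_cong simp: ennreal_mult[symmetric] less_imp_le)
    finally show ?thesis .
  qed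
  define G where "G k a = (LINT x|?L (insert i I). f x * (\<Prod>j\<in>insert i I. ?w ((a(i := k)) j) (x j)))" for k a
  \<comment> \<open>The multi-index coefficient of a one-variable coefficient is the full
    coefficient. This is Fubini, justified by the integrable majorant \<open>B\<close> times the
    product of Hermite functions.\<close>
  have GF: "(LINT x|?L I. F k x * (\<Prod>j\<in>I. ?w (a j) (x j))) = G k a" for k a
  proof -
    let ?h = "\<lambda>x. \<Prod>j\<in>insert i I. ?w ((a(i := k)) j) (x j)"
    have "integrable (?L (insert i I)) ?h"
      using insert.hyps by (intro lebesgue_product.product_integrable_prod integrable_hermite_gwt \<open>\<sigma> > 0\<close>) auto
    then have "integrable (?L (insert i I)) (\<lambda>x. B * norm (?h x))"
      by (intro integrable_mult_right integrable_norm)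
    then have "integrable (?L (insert i I)) (\<lambda>x. f x * ?h x)"
    proof (rule Bochner_Integration.integrable_bound, goal_cases)
      case 1
      show ?case using insert.hyps by measurable
    next
      case 2
      show ?case
      proof (rule AE_I2)
      fix x assume "x \<in> space (?L (insert i I))"
      then have "\<bar>f x\<bar> \<le> B" by (intro B) (simp add: space_PiM)
      then show "norm (f x * ?h x) \<le> norm (B * norm (?h x))"
        using abs_ge_zero[of "f x"] by (simp add: abs_mult mult_right_mono)
      qed
    qed
    then have "G k a = (LINT x|?L I. LINT y|lborel. f (x(i := y)) * ?h (x(i := y)))"
      unfolding G_def by (rule lebesgue_product.product_integral_insert[OF insert.hyps])
    also have "\<dots> = (LINT x|?L I. F k x * (\<Prod>j\<in>I. ?w (a j) (x j)))"
    proof (rule Bochner_Integration.integral_cong[OF refl])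
      fix x
      have "(\<Prod>j\<in>I. ?w ((a(i := k)) j) (x j)) = (\<Prod>j\<in>I. ?w (a j) (x j))"
        using insert.hyps by (intro prod.cong) auto
      then have "?h (x(i := y)) = ?w k y * (\<Prod>j\<in>I. ?w (a j) (x j))" for y
        unfolding prod_upd[of "\<lambda>j. ?w ((a(i := k)) j)"] by simp
      then have "(LINT y|lborel. f (x(i := y)) * ?h (x(i := y)))
        = (LINT y|lborel. (f (x(i := y)) * ?w k y) * (\<Prod>j\<in>I. ?w (a j) (x j)))"
        by (simp add: mult_ac)
      then show "(LINT y|lborel. f (x(i := y)) * ?h (x(i := y))) = F k x * (\<Prod>j\<in>I. ?w (a j) (x j))"
        by (simp only: integral_mult_left_zero F_def)
    qed
    finally show ?thesis ..
  qed
  \<comment> \<open>A finite product of counting measures on the naturals is counting measure on the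
    multi-indices, so every function on them is measurable.\<close>
  have cs: "count_space (\<Pi>\<^sub>E i\<in>I. UNIV) = (\<Pi>\<^sub>M i\<in>I. count_space (UNIV :: nat set))"
     "count_space (\<Pi>\<^sub>E i\<in>insert i I. UNIV) = (\<Pi>\<^sub>M i\<in>insert i I. count_space (UNIV :: nat set))"
    using insert.hyps by (auto intro!: count_space_PiM_finite[symmetric])
  have "(\<integral>\<^sup>+x. ennreal ((f x)\<^sup>2 * (\<Prod>i\<in>insert i I. gwt \<sigma> (x i))) \<partial>?L (insert i I))
    = (\<integral>\<^sup>+x. (\<integral>\<^sup>+y. ennreal ((f (x(i := y)))\<^sup>2 * (\<Prod>j\<in>insert i I. gwt \<sigma> ((x(i := y)) j))) \<partial>lborel) \<partial>?L I)"
    using insert.hyps by (intro lebesgue_product.product_nn_integral_insert) measurable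
  also have "\<dots> = (\<integral>\<^sup>+x. (\<integral>\<^sup>+k. ennreal ((F k x)\<^sup>2 / hermite_norm \<sigma> k * ?P x) \<partial>count_space UNIV) \<partial>?L I)"
    by (intro nn_integral_cong inner)
  also have "\<dots> = (\<integral>\<^sup>+k. (\<integral>\<^sup>+x. ennreal ((F k x)\<^sup>2 / hermite_norm \<sigma> k * ?P x) \<partial>?L I) \<partial>count_space UNIV)"
    using insert.hyps by (intro nn_integral_count_space_nn_integral) (auto, measurable)
  also have "\<dots> = (\<integral>\<^sup>+k. (\<integral>\<^sup>+a. ennreal ((G k a)\<^sup>2 / (\<Prod>j\<in>insert i I. hermite_norm \<sigma> ((a(i := k)) j)))
      \<partial>(\<Pi>\<^sub>M i\<in>I. count_space UNIV)) \<partial>count_space UNIV)"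
  proof (rule nn_integral_cong)
    fix k
    have "(\<integral>\<^sup>+x. ennreal ((F k x)\<^sup>2 / hermite_norm \<sigma> k * ?P x) \<partial>?L I)
      = (\<integral>\<^sup>+x. ennreal (1 / hermite_norm \<sigma> k) * ennreal ((F k x)\<^sup>2 * ?P x) \<partial>?L I)"
      using np gp by (intro nn_integral_cong) (simp add: ennreal_mult[symmetric] less_imp_le)
    also have "\<dots> = ennreal (1 / hermite_norm \<sigma> k) * (\<integral>\<^sup>+x. ennreal ((F k x)\<^sup>2 * ?P x) \<partial>?L I)"
      using insert.hyps by (intro nn_integral_cmult) measurable
    also have "\<dots> = ennreal (1 / hermite_norm \<sigma> k) * (\<integral>\<^sup>+a. ennreal ((G k a)\<^sup>2 / (\<Prod>j\<in>I. hermite_norm \<sigma> (a j))) \<partial>(\<Pi>\<^sub>M i\<in>I. count_space UNIV))"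
      by (subst insert.IH[OF Fs]) (simp only: GF)
    also have "\<dots> = (\<integral>\<^sup>+a. ennreal (1 / hermite_norm \<sigma> k) * ennreal ((G k a)\<^sup>2 / (\<Prod>j\<in>I. hermite_norm \<sigma> (a j))) \<partial>(\<Pi>\<^sub>M i\<in>I. count_space UNIV))"
      by (intro nn_integral_cmult[symmetric]) (simp flip: cs)
    also have "\<dots> = (\<integral>\<^sup>+a. ennreal ((G k a)\<^sup>2 / (\<Prod>j\<in>insert i I. hermite_norm \<sigma> ((a(i := k)) j))) \<partial>(\<Pi>\<^sub>M i\<in>I. count_space UNIV))"
      unfolding prod_upd[of "\<lambda>_. hermite_norm \<sigma>"]
      using np by (intro nn_integral_cong) (simp add: ennreal_mult[symmetric] less_imp_le)
    finally show "(\<integral>\<^sup>+x. ennreal ((F k x)\<^sup>2 / hermite_norm \<sigma> k * ?P x) \<partial>?L I) = \<dots>" .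
  qed
  also have "\<dots> = (\<integral>\<^sup>+a. ennreal ((LINT x|?L (insert i I). f x * (\<Prod>j\<in>insert i I. ?w (a j) (x j)))\<^sup>2
        / (\<Prod>j\<in>insert i I. hermite_norm \<sigma> (a j))) \<partial>(\<Pi>\<^sub>M i\<in>insert i I. count_space UNIV))"
    unfolding G_def using insert.hyps
    by (subst count_product.product_nn_integral_insert_rev) (simp_all flip: cs)
  finally show ?case .
qed

text \<open>For \<sigma> > 0 this is (-1)^k times the k-th y-derivative of \<sigma>^(-1/2) exp(-y^2
  / (2 \<sigma>)), the heat kernel up to the factor sqrt(2 pi). The recurrence is that of the
  Hermite polynomials divided by the matching power of \<sigma>.\<close>

fun heat_kernel :: "nat \<Rightarrow> real \<Rightarrow> real \<Rightarrow> real" where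
  "heat_kernel 0 \<sigma> y = gwt \<sigma> y / sqrt \<sigma>"
| "heat_kernel (Suc 0) \<sigma> y = y * heat_kernel 0 \<sigma> y / \<sigma>"
| "heat_kernel (Suc (Suc k)) \<sigma> y = (y * heat_kernel (Suc k) \<sigma> y - real (Suc k) * heat_kernel k \<sigma> y) / \<sigma>"

lemma heat_kernel_eq:
  assumes "\<sigma> > 0"
  shows "heat_kernel k \<sigma> y = hermite \<sigma> k y * gwt \<sigma> y / (\<sigma> ^ k * sqrt \<sigma>)"
  using assms
  by (induction k \<sigma> y rule: heat_kernel.induct) (simp_all add: field_simps)

lemma has_derivative_heat_kernel_space:
  assumes "\<sigma> > 0"
  shows "(heat_kernel k \<sigma> has_field_derivative - heat_kernel (Suc k) \<sigma> y) (at y)"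
proof -
  have "((\<lambda>y. hermite \<sigma> k y * gwt \<sigma> y / (\<sigma> ^ k * sqrt \<sigma>)) has_field_derivative
     (real k * hermite \<sigma> (k - 1) y * gwt \<sigma> y + - (y / \<sigma>) * gwt \<sigma> y * hermite \<sigma> k y) / (\<sigma> ^ k * sqrt \<sigma>)) (at y)"
    by (intro DERIV_cdivide DERIV_mult has_derivative_hermite has_derivative_gwt assms)
  moreover have "(real k * hermite \<sigma> (k - 1) y * gwt \<sigma> y + - (y / \<sigma>) * gwt \<sigma> y * hermite \<sigma> k y) / (\<sigma> ^ k * sqrt \<sigma>)
     = - heat_kernel (Suc k) \<sigma> y"
    using assms by (simp add: heat_kernel_eq hermite_Suc field_simps)
  moreover have "(\<lambda>y. hermite \<sigma> k y * gwt \<sigma> y / (\<sigma> ^ k * sqrt \<sigma>)) = heat_kernel k \<sigma>"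
    using heat_kernel_eq[OF assms] by auto
  ultimately show ?thesis by simp
qed

text \<open>The heat equation in the variance, with \<sigma>-derivative equal to half the second
  y-derivative. Only order 0 differentiates the Gaussian itself; the higher orders follow from the
  recurrence.\<close>

lemma has_derivative_heat_kernel_time:
  assumes "\<sigma> > 0"
  shows "((\<lambda>\<sigma>. heat_kernel k \<sigma> y) has_field_derivative heat_kernel (Suc (Suc k)) \<sigma> y / 2) (at \<sigma>)"
  using assms
proof (induction k \<sigma> y rule: heat_kernel.induct)
  case (1 \<sigma> y)
  have "((\<lambda>\<sigma>. gwt \<sigma> y) has_field_derivative gwt \<sigma> y * (y\<^sup>2 / (2 * \<sigma>\<^sup>2))) (at \<sigma>)"
    unfolding gwt_def using 1 by (auto intro!: derivative_eq_intros simp: field_simps power2_eq_square)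
  then have "((\<lambda>\<sigma>. gwt \<sigma> y / sqrt \<sigma>) has_field_derivative
     (gwt \<sigma> y * (y\<^sup>2 / (2 * \<sigma>\<^sup>2)) * sqrt \<sigma> - gwt \<sigma> y * (inverse (sqrt \<sigma>) / 2)) / (sqrt \<sigma> * sqrt \<sigma>)) (at \<sigma>)"
    using 1 by (intro DERIV_divide DERIV_real_sqrt) auto
  moreover have "(gwt \<sigma> y * (y\<^sup>2 / (2 * \<sigma>\<^sup>2)) * sqrt \<sigma> - gwt \<sigma> y * (inverse (sqrt \<sigma>) / 2)) / (sqrt \<sigma> * sqrt \<sigma>)
     = heat_kernel (Suc (Suc 0)) \<sigma> y / 2"
  proof -
    define s where "s = sqrt \<sigma>"
    have "\<sigma> = s * s" "s > 0" using 1 by (auto simp: s_def)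
    then show ?thesis by (simp add: s_def[symmetric] field_simps power2_eq_square)
  qed
  ultimately show ?case by simp
next
  case (2 \<sigma> y)
  have "((\<lambda>\<sigma>. y * heat_kernel 0 \<sigma> y / \<sigma>) has_field_derivative
    ((y * (heat_kernel (Suc (Suc 0)) \<sigma> y / 2)) * \<sigma> - (y * heat_kernel 0 \<sigma> y) * 1) / (\<sigma> * \<sigma>)) (at \<sigma>)"
    using 2 by (intro DERIV_divide DERIV_cmult DERIV_ident) auto
  moreover have "((y * (heat_kernel (Suc (Suc 0)) \<sigma> y / 2)) * \<sigma> - (y * heat_kernel 0 \<sigma> y) * 1) / (\<sigma> * \<sigma>)
    = heat_kernel (Suc (Suc (Suc 0))) \<sigma> y / 2"
    using 2 by (simp add: field_simps del: heat_kernel.simps(1))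
  ultimately show ?case by simp
next
  case (3 k \<sigma> y)
  have "((\<lambda>\<sigma>. (y * heat_kernel (Suc k) \<sigma> y - real (Suc k) * heat_kernel k \<sigma> y) / \<sigma>) has_field_derivative
    ((y * (heat_kernel (Suc (Suc (Suc k))) \<sigma> y / 2) - real (Suc k) * (heat_kernel (Suc (Suc k)) \<sigma> y / 2)) * \<sigma>
      - (y * heat_kernel (Suc k) \<sigma> y - real (Suc k) * heat_kernel k \<sigma> y) * 1) / (\<sigma> * \<sigma>)) (at \<sigma>)"
    using 3 by (intro DERIV_divide DERIV_diff DERIV_cmult DERIV_ident) auto
  moreover have "((y * (heat_kernel (Suc (Suc (Suc k))) \<sigma> y / 2) - real (Suc k) * (heat_kernel (Suc (Suc k)) \<sigma> y / 2)) * \<sigma>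
      - (y * heat_kernel (Suc k) \<sigma> y - real (Suc k) * heat_kernel k \<sigma> y) * 1) / (\<sigma> * \<sigma>)
    = heat_kernel (Suc (Suc (Suc (Suc k)))) \<sigma> y / 2"
  proof -
    have a: "y * heat_kernel (Suc k) \<sigma> y - real (Suc k) * heat_kernel k \<sigma> y = \<sigma> * heat_kernel (Suc (Suc k)) \<sigma> y"
      using 3 unfolding heat_kernel.simps(3)[of k] by simp
    have b: "heat_kernel (Suc (Suc (Suc (Suc k)))) \<sigma> y = (y * heat_kernel (Suc (Suc (Suc k))) \<sigma> y - real (Suc (Suc (Suc k))) * heat_kernel (Suc (Suc k)) \<sigma> y) / \<sigma>"
      by (rule heat_kernel.simps)
    show ?thesis unfolding a b using 3 by (simp add: field_simps del: heat_kernel.simps)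
  qed
  ultimately show ?case by simp
qed

lemma continuous_on_heat_kernel:
  fixes f g :: "'a::topological_space \<Rightarrow> real"
  assumes f: "continuous_on S f" "\<And>z. z \<in> S \<Longrightarrow> f z > 0" and g: "continuous_on S g"
  shows "continuous_on S (\<lambda>z. heat_kernel k (f z) (g z))"
proof (induction k rule: less_induct)
  case (less k)
  have f0: "\<And>z. z \<in> S \<Longrightarrow> f z \<noteq> 0" "\<And>z. z \<in> S \<Longrightarrow> sqrt (f z) \<noteq> 0" using f(2) by force+
  have 0: "continuous_on S (\<lambda>z. heat_kernel 0 (f z) (g z))"
    unfolding heat_kernel.simps(1) gwt_def using f0 by (auto intro!: continuous_intros f g)
  consider "k = 0" | "k = Suc 0" | m where "k = Suc (Suc m)" by (metis not0_implies_Suc)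
  then show ?case
  proof cases
    case 2
    then show ?thesis unfolding 2 heat_kernel.simps(2) using f0 by (auto intro!: continuous_intros f g 0 simp del: heat_kernel.simps)
  next
    case (3 m)
    then show ?thesis unfolding 3 heat_kernel.simps(3)
      using f0 less 3 by (auto intro!: continuous_intros f g simp del: heat_kernel.simps)
  qed (use 0 in auto)
qed

section \<open>Functions with continuous partial derivatives\<close>

abbreviation has_pd :: "((nat \<Rightarrow> real) \<Rightarrow> real) \<Rightarrow> nat \<Rightarrow> (nat \<Rightarrow> real) \<Rightarrow> real \<Rightarrow> bool" where
  "has_pd f i x D \<equiv> ((\<lambda>s. f (x(i := s))) has_field_derivative D) (at (x i))"

lemma Rd_update [simp]: "x \<in> Rd d \<Longrightarrow> i < d \<Longrightarrow> x(i := s) \<in> Rd d"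
  by (auto simp: PiE_def extensional_def)

lemma partial_deriv_eqI: "has_pd f i x D \<Longrightarrow> partial_deriv i f x = D"
  unfolding partial_deriv_def by (rule DERIV_imp_deriv)

lemma partial_deriv_cong:
  assumes "\<And>x. x \<in> Rd d \<Longrightarrow> f x = g x" "x \<in> Rd d" "i < d"
  shows "partial_deriv i f x = partial_deriv i g x"
proof -
  have "(\<lambda>s. f (x(i := s))) = (\<lambda>s. g (x(i := s)))" using assms by auto
  then show ?thesis by (simp add: partial_deriv_def)
qed

lemma has_pd_coordinate: "has_pd (\<lambda>y. y j) i x (if i = j then 1 else 0)"
  by (cases "i = j") auto

lemma C_class_continuous: "C_class d k f \<Longrightarrow> continuous_on (Rd d) f"
  by (cases k) auto

lemma C_class_SucD:
  assumes "C_class d (Suc k) f" "i < d"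
  shows "C_class d k (partial_deriv i f)" "x \<in> Rd d \<Longrightarrow> has_pd f i x (partial_deriv i f x)"
  using assms by (simp_all add: partial_deriv_def DERIV_deriv_iff_field_differentiable)

lemma C_class_cong:
  assumes "\<And>x. x \<in> Rd d \<Longrightarrow> f x = g x"
  shows "C_class d k f \<longleftrightarrow> C_class d k g"
  using assms
proof (induction k arbitrary: f g)
  case 0
  then show ?case by (simp cong: continuous_on_cong)
next
  case (Suc k)
  have "C_class d k (partial_deriv i f) \<longleftrightarrow> C_class d k (partial_deriv i g)" if "i < d" for i
    by (rule Suc.IH) (rule partial_deriv_cong[OF Suc.prems _ that])
  moreover have "(\<lambda>s. f (x(i := s))) = (\<lambda>s. g (x(i := s)))" if "i < d" "x \<in> Rd d" for i x
    by (intro ext Suc.prems Rd_update that)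
  moreover have "continuous_on (Rd d) f \<longleftrightarrow> continuous_on (Rd d) g"
    using Suc.prems by (simp cong: continuous_on_cong)
  ultimately show ?case by simp
qed

lemma C_class_SucI:
  assumes "continuous_on (Rd d) f" "\<And>i x. i < d \<Longrightarrow> x \<in> Rd d \<Longrightarrow> has_pd f i x (f' i x)"
    "\<And>i. i < d \<Longrightarrow> C_class d k (f' i)"
  shows "C_class d (Suc k) f"
proof -
  have "C_class d k (partial_deriv i f)" if "i < d" for i
  proof -
    have "partial_deriv i f x = f' i x" if "x \<in> Rd d" for x
      by (rule partial_deriv_eqI[OF assms(2)[OF \<open>i < d\<close> that]])
    with assms(3)[OF that] show ?thesis using C_class_cong by metis
  qed
  then show ?thesis using assms(1,2) by (auto simp: field_differentiable_def)
qed

lemma C_class_mono_Suc: "C_class d (Suc k) f \<Longrightarrow> C_class d k f"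
  by (induction k arbitrary: f) (auto simp del: C_class.simps(2) dest: C_class_continuous simp: C_class.simps(2)[of d "_ :: nat"])

lemma C_class_mono: "C_class d k f \<Longrightarrow> j \<le> k \<Longrightarrow> C_class d j f"
  by (induction k) (auto simp del: C_class.simps(2) simp: le_Suc_eq dest: C_class_mono_Suc)

lemma C_class_const: "C_class d k (\<lambda>x. c)"
proof (induction k arbitrary: c)
  case (Suc k)
  show ?case by (rule C_class_SucI[where f' = "\<lambda>i x. 0"]) (auto intro: Suc)
qed auto

lemma C_class_add: "C_class d k f \<Longrightarrow> C_class d k g \<Longrightarrow> C_class d k (\<lambda>x. f x + g x)"
proof (induction k arbitrary: f g)
  case (Suc k)
  note fg = C_class_SucD[OF Suc.prems(1)] C_class_SucD[OF Suc.prems(2)]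
  show ?case
    by (rule C_class_SucI[where f' = "\<lambda>i x. partial_deriv i f x + partial_deriv i g x"])
      (intro continuous_on_add Suc.IH DERIV_add fg C_class_continuous[OF Suc.prems(1)] C_class_continuous[OF Suc.prems(2)]; assumption)+
qed (auto intro: continuous_on_add)

lemma C_class_mult: "C_class d k f \<Longrightarrow> C_class d k g \<Longrightarrow> C_class d k (\<lambda>x. f x * g x)"
proof (induction k arbitrary: f g)
  case (Suc k)
  show ?case
  proof (rule C_class_SucI[where f' = "\<lambda>i x. partial_deriv i f x * g x + partial_deriv i g x * f x"])
    fix i x assume i: "i < d" and x: "x \<in> Rd d"
    show "has_pd (\<lambda>x. f x * g x) i x (partial_deriv i f x * g x + partial_deriv i g x * f x)"
      by (rule DERIV_cong[OF DERIV_mult[OF C_class_SucD(2)[OF Suc.prems(1) i x] C_class_SucD(2)[OF Suc.prems(2) i x]]]) simp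
  next
    show "continuous_on (Rd d) (\<lambda>x. f x * g x)"
      by (intro continuous_on_mult C_class_continuous[OF Suc.prems(1)] C_class_continuous[OF Suc.prems(2)])
    fix i assume i: "i < d"
    show "C_class d k (\<lambda>x. partial_deriv i f x * g x + partial_deriv i g x * f x)"
      by (intro C_class_add Suc.IH C_class_SucD(1)[OF Suc.prems(1) i] C_class_SucD(1)[OF Suc.prems(2) i]
          C_class_mono_Suc[OF Suc.prems(1)] C_class_mono_Suc[OF Suc.prems(2)])
  qed
qed (auto intro: continuous_on_mult)

lemma C_class_minus: "C_class d k f \<Longrightarrow> C_class d k (\<lambda>x. - f x)"
  using C_class_mult[OF C_class_const[of d k "-1"]] by fastforce

lemma C_class_diff: "C_class d k f \<Longrightarrow> C_class d k g \<Longrightarrow> C_class d k (\<lambda>x. f x - g x)"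
  using C_class_add[OF _ C_class_minus] by fastforce

lemma C_class_sum: "(\<And>i. i \<in> I \<Longrightarrow> C_class d k (f i)) \<Longrightarrow> C_class d k (\<lambda>x. \<Sum>i\<in>I. f i x)"
  by (induction I rule: infinite_finite_induct) (auto intro: C_class_const C_class_add)

lemma C_class_prod: "(\<And>i. i \<in> I \<Longrightarrow> C_class d k (f i)) \<Longrightarrow> C_class d k (\<lambda>x. \<Prod>i\<in>I. f i x)"
  by (induction I rule: infinite_finite_induct) (auto intro: C_class_const C_class_mult)

text \<open>The caller supplies the whole tower of derivatives \<open>\<phi> 0\<close>, ...,
  \<open>\<phi> k\<close>; the induction shifts the tower by one.\<close>

lemma C_class_compose_real:
  assumes "\<And>n y. n < k \<Longrightarrow> (\<phi> n has_field_derivative \<phi> (Suc n) y) (at y)"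
    and "continuous_on UNIV (\<phi> k)" and "C_class d k f"
  shows "C_class d k (\<lambda>x. \<phi> 0 (f x))"
  using assms
proof (induction k arbitrary: \<phi>)
  case 0
  then show ?case by (auto intro: continuous_on_compose2)
next
  case (Suc k)
  show ?case
  proof (rule C_class_SucI[where f' = "\<lambda>i x. \<phi> (Suc 0) (f x) * partial_deriv i f x"])
    have "continuous_on UNIV (\<phi> 0)"
      using Suc.prems(1)[of 0] by (meson DERIV_continuous_on has_field_derivative_at_within zero_less_Suc)
    then show "continuous_on (Rd d) (\<lambda>x. \<phi> 0 (f x))"
      using C_class_continuous[OF Suc.prems(3)] by (auto intro: continuous_on_compose2)
    fix i assume i: "i < d"
    show "C_class d k (\<lambda>x. \<phi> (Suc 0) (f x) * partial_deriv i f x)"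
      using Suc.IH[of "\<lambda>n. \<phi> (Suc n)"] Suc.prems(1,2) C_class_mono_Suc[OF Suc.prems(3)] C_class_SucD(1)[OF Suc.prems(3) i]
      by (intro C_class_mult) auto
    fix x assume x: "x \<in> Rd d"
    show "has_pd (\<lambda>x. \<phi> 0 (f x)) i x (\<phi> (Suc 0) (f x) * partial_deriv i f x)"
      by (rule DERIV_chain2[of "\<phi> 0", OF _ C_class_SucD(2)[OF Suc.prems(3) i x]]) (use Suc.prems(1)[of 0] in simp)
  qed
qed

lemma C_class_exp: "C_class d k f \<Longrightarrow> C_class d k (\<lambda>x. exp (f x))"
  by (rule C_class_compose_real[where \<phi> = "\<lambda>_. exp"]) (auto intro: continuous_on_exp continuous_on_id)

lemma C_class_inverse:
  assumes "C_class d k f" "\<And>x. x \<in> Rd d \<Longrightarrow> f x \<noteq> 0"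
  shows "C_class d k (\<lambda>x. inverse (f x))"
  using assms
proof (induction k)
  case (Suc k)
  show ?case
  proof (rule C_class_SucI[where f' = "\<lambda>i x. - (partial_deriv i f x * (inverse (f x) * inverse (f x)))"])
    fix i x assume i: "i < d" and x: "x \<in> Rd d"
    show "has_pd (\<lambda>x. inverse (f x)) i x (- (partial_deriv i f x * (inverse (f x) * inverse (f x))))"
      by (rule DERIV_cong[OF DERIV_inverse_fun[OF C_class_SucD(2)[OF Suc.prems(1) i x]]]) (use Suc.prems(2)[OF x] in \<open>simp_all add: mult_ac\<close>)
  next
    show "continuous_on (Rd d) (\<lambda>x. inverse (f x))"
      by (rule continuous_on_inverse[OF C_class_continuous[OF Suc.prems(1)]]) (use Suc.prems(2) in blast)
    fix i assume i: "i < d"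
    show "C_class d k (\<lambda>x. - (partial_deriv i f x * (inverse (f x) * inverse (f x))))"
      by (intro C_class_minus C_class_mult Suc.IH C_class_SucD(1)[OF Suc.prems(1) i] C_class_mono_Suc[OF Suc.prems(1)] Suc.prems(2))
  qed
qed (auto intro: continuous_on_inverse)

lemma C_class_ln:
  assumes "C_class d k f" "\<And>x. x \<in> Rd d \<Longrightarrow> f x > 0"
  shows "C_class d k (\<lambda>x. ln (f x))"
proof (cases k)
  case 0
  then show ?thesis using assms(1) continuous_on_ln[of "Rd d" f] assms(2) by (simp add: less_imp_neq[symmetric])
next
  case (Suc j)
  have f0: "f x \<noteq> 0" if "x \<in> Rd d" for x using assms(2)[OF that] by simp
  show ?thesis unfolding Suc
  proof (rule C_class_SucI[where f' = "\<lambda>i x. partial_deriv i f x * inverse (f x)"])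
    show "continuous_on (Rd d) (\<lambda>x. ln (f x))"
      by (rule continuous_on_ln[OF C_class_continuous[OF assms(1)]]) (use f0 in auto)
    fix i assume i: "i < d"
    show "C_class d j (\<lambda>x. partial_deriv i f x * inverse (f x))"
      using assms(1) unfolding Suc
      by (intro C_class_mult C_class_inverse f0) (simp_all only: C_class_SucD(1)[OF _ i] C_class_mono_Suc)
    fix x assume x: "x \<in> Rd d"
    show "has_pd (\<lambda>x. ln (f x)) i x (partial_deriv i f x * inverse (f x))"
      using DERIV_chain2[OF DERIV_ln, OF _ C_class_SucD(2)[OF _ i x], of f j] assms(1) assms(2)[OF x] Suc
      by (simp add: mult.commute)
  qed
qed

text \<open>At a point of \<open>Rd d\<close> the coordinates from \<open>d\<close> on all equal
  \<open>undefined\<close>, so convergence of the first \<open>d\<close> coordinates is convergence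
  in the product topology of the full function space.\<close>

lemma tendsto_Rd:
  assumes f: "continuous_on (Rd d) f" and x: "x \<in> Rd d" and z: "\<And>a. z a \<in> Rd d"
    and lim: "\<And>i. i < d \<Longrightarrow> ((\<lambda>a. z a i) \<longlongrightarrow> x i) F"
  shows "((\<lambda>a. f (z a)) \<longlongrightarrow> f x) F"
proof -
  have "((\<lambda>a. z a i) \<longlongrightarrow> x i) F" for i
  proof (cases "i < d")
    case False
    then have "z a i = x i" for a using x z[of a] by (auto simp: PiE_def extensional_def)
    then show ?thesis by simp
  qed (use lim in auto)
  then have "limitin (product_topology (\<lambda>i. euclidean) UNIV) z x F"
    by (simp add: limitin_componentwise)
  then have "(z \<longlongrightarrow> x) F" by (simp add: euclidean_product_topology)
  then show ?thesis
    by (rule continuous_on_tendsto_compose[OF f _ x]) (use z in auto)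
qed

section \<open>Chain rule and symmetry of second derivatives\<close>

lemma MVT_between:
  fixes \<phi> :: "real \<Rightarrow> real"
  assumes "\<And>s. (\<phi> has_field_derivative \<phi>' s) (at s)"
  obtains \<xi> where "\<phi> b - \<phi> a = (b - a) * \<phi>' \<xi>" "\<bar>\<xi> - a\<bar> \<le> \<bar>b - a\<bar>"
proof (cases a b rule: linorder_cases)
  case less
  then obtain z where "a < z" "z < b" "\<phi> b - \<phi> a = (b - a) * \<phi>' z" using MVT2[of a b \<phi> \<phi>'] assms by blast
  then show ?thesis by (intro that[of z]) auto
next
  case equal then show ?thesis by (intro that[of a]) auto
next
  case greater
  then obtain z where z: "b < z" "z < a" "\<phi> a - \<phi> b = (a - b) * \<phi>' z" using MVT2[of b a \<phi> \<phi>'] assms by blast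
  then have "\<phi> b - \<phi> a = (b - a) * \<phi>' z" by (simp add: algebra_simps)
  with z show ?thesis by (intro that[of z]) auto
qed

lemma has_pd_line:
  assumes "C_class d (Suc k) f" "i < d" "x \<in> Rd d"
  shows "((\<lambda>s. f (x(i := s))) has_field_derivative partial_deriv i f (x(i := s))) (at s)"
  using C_class_SucD(2)[OF assms(1,2) Rd_update[OF assms(3,2), of s]] by simp

text \<open>A staircase argument that uses partial derivatives only: the points \<open>p n s\<close>
  take their first n coordinates from \<open>\<gamma> s\<close> and the others from
  \<open>\<gamma> s0\<close>. Each step changes one coordinate, where the mean value theorem
  applies, and continuity of the partial derivative identifies the limit.\<close>

lemma chain_rule_Rd:
  assumes f: "C_class d (Suc k) f" and \<gamma>: "\<And>s. \<gamma> s \<in> Rd d"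
    and d\<gamma>: "\<And>i. i < d \<Longrightarrow> ((\<lambda>s. \<gamma> s i) has_field_derivative \<gamma>' i) (at s0)"
  shows "((\<lambda>s. f (\<gamma> s)) has_field_derivative (\<Sum>i<d. partial_deriv i f (\<gamma> s0) * \<gamma>' i)) (at s0)"
proof -
  define p where "p n s = (\<lambda>i. if i < n then \<gamma> s i else \<gamma> s0 i)" for n s
  have pR: "p n s \<in> Rd d" if "n \<le> d" for n s
    using \<gamma>[of s] \<gamma>[of s0] that by (auto simp: p_def PiE_def extensional_def)
  have main: "((\<lambda>s. f (p n s)) has_field_derivative (\<Sum>i<n. partial_deriv i f (\<gamma> s0) * \<gamma>' i)) (at s0)" if "n \<le> d" for n
    using that
  proof (induction n)
    case 0
    then show ?case by (simp add: p_def)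
  next
    case (Suc n)
    then have n: "n < d" by simp
    have eq: "p (Suc n) s = (p n s)(n := \<gamma> s n)" "(p n s)(n := \<gamma> s0 n) = p n s" for s
      by (auto simp: p_def less_Suc_eq)
    have "\<exists>\<xi>. f (p (Suc n) s) - f (p n s) = (\<gamma> s n - \<gamma> s0 n) * partial_deriv n f ((p n s)(n := \<xi>))
        \<and> \<bar>\<xi> - \<gamma> s0 n\<bar> \<le> \<bar>\<gamma> s n - \<gamma> s0 n\<bar>" for s
      using MVT_between[of "\<lambda>t. f ((p n s)(n := t))" "\<lambda>t. partial_deriv n f ((p n s)(n := t))" "\<gamma> s n" "\<gamma> s0 n"]
        has_pd_line[OF f n pR] n unfolding eq by (metis less_imp_le)
    then obtain \<xi> where \<xi>: "\<And>s. f (p (Suc n) s) - f (p n s) = (\<gamma> s n - \<gamma> s0 n) * partial_deriv n f ((p n s)(n := \<xi> s))"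
      "\<And>s. \<bar>\<xi> s - \<gamma> s0 n\<bar> \<le> \<bar>\<gamma> s n - \<gamma> s0 n\<bar>" by metis
    have \<gamma>lim: "((\<lambda>s. \<gamma> s i) \<longlongrightarrow> \<gamma> s0 i) (at s0)" if "i < d" for i
      using DERIV_isCont[OF d\<gamma>[OF that]] by (simp add: isCont_def)
    have "((\<lambda>s. \<gamma> s n - \<gamma> s0 n) \<longlongrightarrow> 0) (at s0)" using \<gamma>lim[OF n] by (simp add: LIM_zero)
    then have "((\<lambda>s. \<xi> s - \<gamma> s0 n) \<longlongrightarrow> 0) (at s0)"
      using \<xi>(2) by (rule_tac Lim_null_comparison[OF _ tendsto_rabs_zero]) (auto intro: always_eventually)
    then have \<xi>lim: "(\<xi> \<longlongrightarrow> \<gamma> s0 n) (at s0)" by (simp add: LIM_zero_iff)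
    have "((\<lambda>s. partial_deriv n f ((p n s)(n := \<xi> s))) \<longlongrightarrow> partial_deriv n f (\<gamma> s0)) (at s0)"
    proof (rule tendsto_Rd[OF C_class_continuous[OF C_class_SucD(1)[OF f n]] \<gamma>])
      show "(p n a)(n := \<xi> a) \<in> Rd d" for a using pR n by (intro Rd_update) auto
      show "((\<lambda>a. ((p n a)(n := \<xi> a)) i) \<longlongrightarrow> \<gamma> s0 i) (at s0)" if "i < d" for i
        using \<xi>lim \<gamma>lim[OF that] by (cases "i = n"; cases "i < n") (auto simp: p_def)
    qed
    moreover have "((\<lambda>s. (\<gamma> s n - \<gamma> s0 n) / (s - s0)) \<longlongrightarrow> \<gamma>' n) (at s0)"
      using d\<gamma>[OF n] by (simp add: has_field_derivative_iff)
    ultimately have "((\<lambda>s. partial_deriv n f ((p n s)(n := \<xi> s)) * ((\<gamma> s n - \<gamma> s0 n) / (s - s0))) \<longlongrightarrow> partial_deriv n f (\<gamma> s0) * \<gamma>' n) (at s0)"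
      by (rule tendsto_mult)
    then have "((\<lambda>s. f (p (Suc n) s) - f (p n s)) has_field_derivative partial_deriv n f (\<gamma> s0) * \<gamma>' n) (at s0)"
      unfolding has_field_derivative_iff \<xi>(1) by (simp add: mult.commute)
    from DERIV_add[OF this Suc.IH] Suc.prems show ?case by (simp add: add.commute)
  qed
  have "p d s = \<gamma> s" for s using \<gamma>[of s] \<gamma>[of s0] by (auto simp: p_def PiE_def extensional_def)
  with main[of d] show ?thesis by simp
qed

text \<open>The mean value theorem in coordinate i and then in coordinate j. The second difference
  is symmetric in i and j, so dividing by h^2 and letting h tend to 0 in both orders makes the mixed
  derivatives equal.\<close>

lemma mixed_difference:
  assumes f: "C_class d 2 f" and ij: "i < d" "j < d" "i \<noteq> j" and x: "x \<in> Rd d"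
  obtains \<xi> \<eta> where "f (x(i := x i + h, j := x j + h)) - f (x(i := x i + h)) - f (x(j := x j + h)) + f x
      = h\<^sup>2 * partial_deriv j (partial_deriv i f) (x(i := \<xi>, j := \<eta>))"
    "\<bar>\<xi> - x i\<bar> \<le> \<bar>h\<bar>" "\<bar>\<eta> - x j\<bar> \<le> \<bar>h\<bar>"
proof -
  have f2: "C_class d (Suc (Suc 0)) f" using f by (simp add: numeral_2_eq_2)
  let ?\<phi> = "\<lambda>a. f (x(j := x j + h, i := a)) - f (x(i := a))"
  let ?\<phi>' = "\<lambda>a. partial_deriv i f (x(j := x j + h, i := a)) - partial_deriv i f (x(i := a))"
  have "(?\<phi> has_field_derivative ?\<phi>' s) (at s)" for s
    using ij x by (intro DERIV_diff has_pd_line[OF f2]) auto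
  then obtain \<xi> where \<xi>: "?\<phi> (x i + h) - ?\<phi> (x i) = (x i + h - x i) * ?\<phi>' \<xi>" "\<bar>\<xi> - x i\<bar> \<le> \<bar>x i + h - x i\<bar>"
    by (rule MVT_between[where \<phi> = ?\<phi>])
  have "((\<lambda>b. partial_deriv i f (x(i := \<xi>, j := b))) has_field_derivative partial_deriv j (partial_deriv i f) (x(i := \<xi>, j := s))) (at s)" for s
    using ij x by (intro has_pd_line[OF C_class_SucD(1)[OF f2]]) auto
  then obtain \<eta> where \<eta>: "partial_deriv i f (x(i := \<xi>, j := x j + h)) - partial_deriv i f (x(i := \<xi>, j := x j))
     = (x j + h - x j) * partial_deriv j (partial_deriv i f) (x(i := \<xi>, j := \<eta>))" "\<bar>\<eta> - x j\<bar> \<le> \<bar>x j + h - x j\<bar>"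
    by (rule MVT_between)
  have tw: "x(j := b, i := a) = x(i := a, j := b)" for a b using ij by (simp add: fun_upd_twist)
  have same: "x(i := \<xi>, j := x j) = x(i := \<xi>)" using ij by (auto simp: fun_eq_iff)
  show ?thesis
  proof (rule that[of \<xi> \<eta>])
    show "f (x(i := x i + h, j := x j + h)) - f (x(i := x i + h)) - f (x(j := x j + h)) + f x
      = h\<^sup>2 * partial_deriv j (partial_deriv i f) (x(i := \<xi>, j := \<eta>))"
      using \<xi>(1) \<eta>(1) ij unfolding tw same by (simp add: power2_eq_square fun_upd_triv tw[symmetric])
  qed (use \<xi> \<eta> in auto)
qed

lemma partial_deriv_commute:
  assumes f: "C_class d 2 f" and ij: "i < d" "j < d" and x: "x \<in> Rd d"
  shows "partial_deriv i (partial_deriv j f) x = partial_deriv j (partial_deriv i f) x"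
proof (cases "i = j")
  case False
  have f2: "C_class d (Suc (Suc 0)) f" using f by (simp add: numeral_2_eq_2)
  define h where "h n = inverse (real (Suc n))" for n
  have h: "h n > 0" for n by (simp add: h_def)
  have hlim: "h \<longlonglongrightarrow> 0" unfolding h_def[abs_def] by (rule LIMSEQ_inverse_real_of_nat)
  have main: "(\<lambda>n. (f (x(i := x i + h n, j := x j + h n)) - f (x(i := x i + h n)) - f (x(j := x j + h n)) + f x) / (h n)\<^sup>2)
    \<longlonglongrightarrow> partial_deriv j (partial_deriv i f) x" if ij: "i < d" "j < d" "i \<noteq> j" for i j
  proof -
    have "\<exists>\<xi> \<eta>. f (x(i := x i + h n, j := x j + h n)) - f (x(i := x i + h n)) - f (x(j := x j + h n)) + f x
      = (h n)\<^sup>2 * partial_deriv j (partial_deriv i f) (x(i := \<xi>, j := \<eta>)) \<and> \<bar>\<xi> - x i\<bar> \<le> h n \<and> \<bar>\<eta> - x j\<bar> \<le> h n" for n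
      using mixed_difference[OF f ij x, of "h n"] h[of n] by (metis abs_of_pos)
    then obtain \<xi> \<eta> where e: "\<And>n. f (x(i := x i + h n, j := x j + h n)) - f (x(i := x i + h n)) - f (x(j := x j + h n)) + f x
      = (h n)\<^sup>2 * partial_deriv j (partial_deriv i f) (x(i := \<xi> n, j := \<eta> n))"
      "\<And>n. \<bar>\<xi> n - x i\<bar> \<le> h n" "\<And>n. \<bar>\<eta> n - x j\<bar> \<le> h n" by metis
    have "(\<lambda>n. \<xi> n - x i) \<longlonglongrightarrow> 0" "(\<lambda>n. \<eta> n - x j) \<longlonglongrightarrow> 0"
      using e(2,3) by (auto intro!: Lim_null_comparison[OF _ hlim] always_eventually)
    then have lims: "\<xi> \<longlonglongrightarrow> x i" "\<eta> \<longlonglongrightarrow> x j" by (simp_all add: LIM_zero_iff)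
    have "(\<lambda>n. partial_deriv j (partial_deriv i f) (x(i := \<xi> n, j := \<eta> n))) \<longlonglongrightarrow> partial_deriv j (partial_deriv i f) x"
      using ij x lims
    proof (intro tendsto_Rd[OF C_class_continuous[OF C_class_SucD(1)[OF C_class_SucD(1)[OF f2]]]])
      show "(\<lambda>n. (x(i := \<xi> n, j := \<eta> n)) k) \<longlonglongrightarrow> x k" for k
        using lims ij by (cases "k = j"; cases "k = i") auto
    qed (use ij x in \<open>simp_all only: Rd_update\<close>)
    moreover have "(f (x(i := x i + h n, j := x j + h n)) - f (x(i := x i + h n)) - f (x(j := x j + h n)) + f x) / (h n)\<^sup>2
       = partial_deriv j (partial_deriv i f) (x(i := \<xi> n, j := \<eta> n))" for n
      unfolding e(1) using h[of n] by simp
    ultimately show ?thesis by simp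
  qed
  have eq: "f (x(j := x j + h n, i := x i + h n)) - f (x(j := x j + h n)) - f (x(i := x i + h n)) + f x
     = f (x(i := x i + h n, j := x j + h n)) - f (x(i := x i + h n)) - f (x(j := x j + h n)) + f x" for n
  proof -
    have "x(j := x j + h n, i := x i + h n) = x(i := x i + h n, j := x j + h n)"
      using False by (intro fun_upd_twist) auto
    then show ?thesis by (simp only: algebra_simps)
  qed
  show ?thesis
    using LIMSEQ_unique[OF main[OF ij(2,1) False[symmetric]] main[OF ij False, folded eq]] .
qed simp

lemma C_class_compose_Rd:
  assumes "C_class e k f" "\<And>i. i < e \<Longrightarrow> C_class d k (\<lambda>x. h x i)" "\<And>x. x \<in> Rd d \<Longrightarrow> h x \<in> Rd e"
  shows "C_class d k (\<lambda>x. f (h x))"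
  using assms
proof (induction k arbitrary: f)
  case 0
  have "continuous_on (Rd d) h"
  proof (rule continuous_on_coordinatewise_then_product)
    fix i
    show "continuous_on (Rd d) (\<lambda>x. h x i)"
    proof (cases "i < e")
      case False
      then have "h x i = undefined" if "x \<in> Rd d" for x using 0(3)[OF that] by (auto simp: PiE_def extensional_def)
      then show ?thesis by (simp cong: continuous_on_cong)
    qed (use 0 in auto)
  qed
  then show ?case using 0 by (auto intro!: continuous_on_compose2[of "Rd e" f])
next
  case (Suc k)
  have IH: "C_class d k (\<lambda>x. f' (h x))" if "C_class e k f'" for f'
    using Suc.IH[OF that] Suc.prems(2,3) C_class_mono_Suc by blast
  show ?case
  proof (rule C_class_SucI[where f' = "\<lambda>j x. \<Sum>i<e. partial_deriv i f (h x) * partial_deriv j (\<lambda>x. h x i) x"])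
    show "continuous_on (Rd d) (\<lambda>x. f (h x))"
      using IH[OF C_class_mono_Suc[OF Suc.prems(1)]] by (rule C_class_continuous)
    fix j assume j: "j < d"
    show "C_class d k (\<lambda>x. \<Sum>i<e. partial_deriv i f (h x) * partial_deriv j (\<lambda>x. h x i) x)"
      using j Suc.prems by (intro C_class_sum C_class_mult IH C_class_SucD) (auto simp del: C_class.simps)
    fix x assume x: "x \<in> Rd d"
    have "((\<lambda>s. f (h (x(j := s)))) has_field_derivative (\<Sum>i<e. partial_deriv i f (h (x(j := x j))) * partial_deriv j (\<lambda>x. h x i) x)) (at (x j))"
    proof (rule has_field_derivative_transform_within_open[where S = UNIV])
      show "((\<lambda>s. f (h (x(j := s)))) has_field_derivative (\<Sum>i<e. partial_deriv i f (h (x(j := x j))) * partial_deriv j (\<lambda>x. h x i) x)) (at (x j))"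
        by (intro chain_rule_Rd[OF Suc.prems(1)] C_class_SucD(2)[OF Suc.prems(2)] Suc.prems(3) Rd_update j x)
    qed auto
    then show "has_pd (\<lambda>x. f (h x)) j x (\<Sum>i<e. partial_deriv i f (h x) * partial_deriv j (\<lambda>x. h x i) x)" by simp
  qed
qed

section \<open>The Piola identity\<close>

lemma mat_mult_functions:
  "Matrix.mat d d f * Matrix.mat d d g = Matrix.mat d d (\<lambda>(i, j). \<Sum>k<d. f (i, k) * (g (k, j) :: real))"
  by (rule eq_matI) (auto simp: scalar_prod_def atLeast0LessThan intro!: sum.cong)

lemma mat_eq_one:
  assumes "\<And>i j. i < d \<Longrightarrow> j < d \<Longrightarrow> f (i, j) = (if i = j then 1 else 0 :: real)"
  shows "Matrix.mat d d f = 1\<^sub>m d"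
  by (rule eq_matI) (auto simp: assms)

lemma minv_eqI:
  assumes A: "A \<in> carrier_mat d d" and B: "B \<in> carrier_mat d d" and "A * B = 1\<^sub>m d" "B * A = 1\<^sub>m d"
  shows "minv A = B"
proof -
  have "A \<in> Units (ring_mat TYPE(real) d ())"
    using assms by (auto simp: Units_def ring_mat_def)
  then obtain C where C: "mat_inverse A = Some C"
    using mat_inverse(1)[OF A, of "()"] by (cases "mat_inverse A") auto
  note C' = mat_inverse(2)[OF A C]
  have "C = C * (A * B)" using C' assms by auto
  also have "\<dots> = (C * A) * B" using C' A B by (intro assoc_mult_mat[symmetric]) auto
  also have "\<dots> = B" using C' B by auto
  finally show ?thesis by (simp add: minv_def C)
qed

text \<open>A permutation other than the identity moves at least two points. In the differentiated
  Leibniz formula one factor of a product is replaced, and an off-diagonal factor remains.\<close>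

lemma permutes_nonfixed_two:
  assumes p: "p permutes S" and "p \<noteq> id" "i \<in> S"
  obtains k where "k \<in> S" "k \<noteq> i" "p k \<noteq> k"
proof -
  obtain j where j: "p j \<noteq> j" using \<open>p \<noteq> id\<close> by (auto simp: fun_eq_iff)
  have inj: "inj p" using permutes_inj[OF p] .
  have jS: "j \<in> S" using p j by (auto simp: permutes_def)
  have "p j \<in> S" using permutes_in_image[OF p] jS by simp
  moreover have "p (p j) \<noteq> p j" using inj j by (auto dest: injD)
  ultimately show ?thesis using that j jS by (cases "j = i") auto
qed

text \<open>At the identity matrix the derivative of the determinant is the trace: every Leibniz
  term of a permutation other than the identity keeps a vanishing off-diagonal factor after one
  factor has been differentiated.\<close>

lemma has_derivative_det_at_one:
  fixes B :: "nat \<Rightarrow> nat \<Rightarrow> real \<Rightarrow> real"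
  assumes dB: "\<And>i j. i < d \<Longrightarrow> j < d \<Longrightarrow> (B i j has_field_derivative B' i j) (at s0)"
    and one: "\<And>i j. i < d \<Longrightarrow> j < d \<Longrightarrow> B i j s0 = (if i = j then 1 else 0)"
  shows "((\<lambda>s. Determinant.det (Matrix.mat d d (\<lambda>(i, j). B i j s))) has_field_derivative (\<Sum>i<d. B' i i)) (at s0)"
proof -
  let ?S = "{0..<d}"
  have det: "Determinant.det (Matrix.mat d d (\<lambda>(i, j). B i j s)) = (\<Sum>p | p permutes ?S. signof p * (\<Prod>i\<in>?S. B i (p i) s))" for s
    unfolding Determinant.det_def by (auto intro!: sum.cong prod.cong simp: permutes_in_image)
  have pd: "p i < d" if "p permutes ?S" "i \<in> ?S" for p i
    using permutes_in_image[OF that(1), of i] that(2) by simp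
  have "((\<lambda>s. \<Sum>p | p permutes ?S. signof p * (\<Prod>i\<in>?S. B i (p i) s)) has_field_derivative
    (\<Sum>p | p permutes ?S. signof p * (\<Sum>i\<in>?S. B' i (p i) * (\<Prod>k\<in>?S - {i}. B k (p k) s0)))) (at s0)"
    by (intro DERIV_sum DERIV_cmult has_field_derivative_prod dB) (auto simp: pd)
  moreover have "(\<Sum>p | p permutes ?S. signof p * (\<Sum>i\<in>?S. B' i (p i) * (\<Prod>k\<in>?S - {i}. B k (p k) s0)))
    = (\<Sum>p | p permutes ?S. if p = id then (\<Sum>i<d. B' i i) else 0)"
  proof (rule sum.cong[OF refl])
    fix p assume "p \<in> {p. p permutes ?S}"
    then have p: "p permutes ?S" by simp
    show "signof p * (\<Sum>i\<in>?S. B' i (p i) * (\<Prod>k\<in>?S - {i}. B k (p k) s0)) = (if p = id then (\<Sum>i<d. B' i i) else 0)"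
    proof (cases "p = id")
      case True
      have "(\<Prod>k\<in>?S - {i}. B k k s0) = 1" for i by (rule prod.neutral) (auto simp: one)
      then show ?thesis using True by (simp add: atLeast0LessThan)
    next
      case False
      have "B' i (p i) * (\<Prod>k\<in>?S - {i}. B k (p k) s0) = 0" if "i \<in> ?S" for i
      proof -
        obtain k where "k \<in> ?S" "k \<noteq> i" "p k \<noteq> k" using permutes_nonfixed_two[OF p False \<open>i \<in> ?S\<close>] by blast
        then have "B k (p k) s0 = 0" "k \<in> ?S - {i}" using pd[OF p] by (auto simp: one)
        then have "(\<Prod>k\<in>?S - {i}. B k (p k) s0) = 0" by (intro prod_zero) auto
        then show ?thesis by simp
      qed
      then show ?thesis using False by (simp add: sum.neutral)
    qed
  qed
  moreover have "\<dots> = (\<Sum>i<d. B' i i)"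
    by (subst sum.delta) (auto simp: finite_permutations permutes_id)
  ultimately show ?thesis by (simp add: det)
qed

section \<open>The diffeomorphism, its Jacobian matrices and the Piola identity\<close>

locale oriented_diffeo =
  fixes d :: nat and g :: "(nat \<Rightarrow> real) \<Rightarrow> nat \<Rightarrow> real"
  assumes diffeo: "C3_diffeo d g"
    and orientation: "\<And>x. x \<in> Rd d \<Longrightarrow> Determinant.det (jacobian_mat d g x) > 0"
begin

definition h :: "(nat \<Rightarrow> real) \<Rightarrow> nat \<Rightarrow> real" where
  "h = inv_into (Rd d) g"

definition Dh :: "nat \<Rightarrow> nat \<Rightarrow> (nat \<Rightarrow> real) \<Rightarrow> real" where
  "Dh i j x = partial_deriv j (\<lambda>y. h y i) x"

text \<open>Evaluated at \<open>h x\<close>, so that as a function of x it is the pointwise inverse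
  of the matrix \<open>Dh\<close>, that is H^(-1).\<close>

definition Dg :: "nat \<Rightarrow> nat \<Rightarrow> (nat \<Rightarrow> real) \<Rightarrow> real" where
  "Dg i j x = partial_deriv j (\<lambda>y. g y i) (h x)"

definition jac :: "(nat \<Rightarrow> real) \<Rightarrow> real" where
  "jac x = Determinant.det (jacobian_mat d h x)"

lemma g_h [simp]: "x \<in> Rd d \<Longrightarrow> g (h x) = x"
  and h_g [simp]: "x \<in> Rd d \<Longrightarrow> h (g x) = x"
  and h_Rd [simp]: "x \<in> Rd d \<Longrightarrow> h x \<in> Rd d"
  and g_Rd [simp]: "x \<in> Rd d \<Longrightarrow> g x \<in> Rd d"
proof -
  have b: "bij_betw g (Rd d) (Rd d)" using diffeo by (simp add: C3_diffeo_def)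
  show "x \<in> Rd d \<Longrightarrow> g (h x) = x" unfolding h_def using bij_betw_inv_into_right[OF b] .
  show "x \<in> Rd d \<Longrightarrow> h (g x) = x" unfolding h_def using bij_betw_inv_into_left[OF b] .
  show "x \<in> Rd d \<Longrightarrow> h x \<in> Rd d" unfolding h_def using bij_betwE[OF bij_betw_inv_into[OF b]] by blast
  show "x \<in> Rd d \<Longrightarrow> g x \<in> Rd d" using bij_betwE[OF b] by blast
qed

lemma C_h: "i < d \<Longrightarrow> C_class d (Suc 2) (\<lambda>x. h x i)"
  and C_g: "i < d \<Longrightarrow> C_class d (Suc 2) (\<lambda>x. g x i)"
  using diffeo by (auto simp: C3_diffeo_def h_def numeral_3_eq_3 numeral_2_eq_2 simp del: C_class.simps)

lemma C_h2: "i < d \<Longrightarrow> C_class d 2 (\<lambda>x. h x i)"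
  by (rule C_class_mono_Suc[OF C_h])

lemma C_Dh: "i < d \<Longrightarrow> j < d \<Longrightarrow> C_class d 2 (Dh i j)"
  unfolding Dh_def[abs_def] by (rule C_class_SucD(1)[OF C_h])

lemma C_Dg: "i < d \<Longrightarrow> j < d \<Longrightarrow> C_class d 2 (Dg i j)"
  unfolding Dg_def[abs_def] by (rule C_class_compose_Rd[OF C_class_SucD(1)[OF C_g] C_h2]) auto

lemma has_pd_h: "i < d \<Longrightarrow> j < d \<Longrightarrow> x \<in> Rd d \<Longrightarrow> has_pd (\<lambda>y. h y i) j x (Dh i j x)"
  unfolding Dh_def by (rule C_class_SucD(2)[OF C_h])

lemma Dg_Dh:
  assumes ij: "i < d" "j < d" and x: "x \<in> Rd d"
  shows "(\<Sum>k<d. Dg i k x * Dh k j x) = (if i = j then 1 else 0)"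
proof -
  have "((\<lambda>s. g (h (x(j := s))) i) has_field_derivative
      (\<Sum>k<d. partial_deriv k (\<lambda>y. g y i) (h (x(j := x j))) * Dh k j x)) (at (x j))"
    by (intro chain_rule_Rd[OF C_g] has_pd_h h_Rd Rd_update ij x)
  moreover have "(\<lambda>s. g (h (x(j := s))) i) = (\<lambda>s. (x(j := s)) i)" using ij x by simp
  ultimately have "has_pd (\<lambda>y. y i) j x (\<Sum>k<d. Dg i k x * Dh k j x)" by (simp add: Dg_def)
  from DERIV_unique[OF this has_pd_coordinate] show ?thesis by auto
qed

lemma Dh_Dg:
  assumes ij: "i < d" "j < d" and x: "x \<in> Rd d"
  shows "(\<Sum>k<d. Dh i k x * Dg k j x) = (if i = j then 1 else 0)"
proof -
  define y where "y = h x"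
  have y: "y \<in> Rd d" "g y = x" using x by (auto simp: y_def)
  have "((\<lambda>s. h (g (y(j := s))) i) has_field_derivative
      (\<Sum>k<d. partial_deriv k (\<lambda>y. h y i) (g (y(j := y j))) * partial_deriv j (\<lambda>y. g y k) y)) (at (y j))"
    by (intro chain_rule_Rd[OF C_h] C_class_SucD(2)[OF C_g] g_Rd Rd_update ij y(1))
  moreover have "(\<lambda>s. h (g (y(j := s))) i) = (\<lambda>s. (y(j := s)) i)" using ij y by simp
  ultimately have "has_pd (\<lambda>y. y i) j y (\<Sum>k<d. Dh i k x * Dg k j x)" using y(2) by (simp add: Dg_def Dh_def y_def[symmetric])
  from DERIV_unique[OF this has_pd_coordinate] show ?thesis by auto
qed

lemma jacobian_mat_h: "jacobian_mat d h x = Matrix.mat d d (\<lambda>(i, j). Dh i j x)"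
  by (simp add: jacobian_mat_def Dh_def)

lemma jacobian_mat_g: "jacobian_mat d g (h x) = Matrix.mat d d (\<lambda>(i, j). Dg i j x)"
  by (simp add: jacobian_mat_def Dg_def)

lemma minv_jacobian:
  assumes x: "x \<in> Rd d"
  shows "minv (jacobian_mat d h x) = Matrix.mat d d (\<lambda>(i, j). Dg i j x)"
  unfolding jacobian_mat_h
proof (rule minv_eqI[of _ d])
  show "Matrix.mat d d (\<lambda>(i, j). Dh i j x) * Matrix.mat d d (\<lambda>(i, j). Dg i j x) = 1\<^sub>m d"
    "Matrix.mat d d (\<lambda>(i, j). Dg i j x) * Matrix.mat d d (\<lambda>(i, j). Dh i j x) = 1\<^sub>m d"
    unfolding mat_mult_functions by (rule mat_eq_one; simp add: Dg_Dh Dh_Dg x)+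
qed simp_all

lemma jac_mult: "x \<in> Rd d \<Longrightarrow> Determinant.det (Matrix.mat d d (\<lambda>(i, j). Dg i j x)) * jac x = 1"
  unfolding jac_def jacobian_mat_h
  by (subst det_mult[symmetric, of _ d], simp_all add: mat_mult_functions, subst mat_eq_one, simp_all add: Dg_Dh)

lemma jac_pos:
  assumes x: "x \<in> Rd d" shows "jac x > 0"
proof (rule zero_less_mult_pos)
  show "0 < Determinant.det (Matrix.mat d d (\<lambda>(i, j). Dg i j x)) * jac x" by (simp only: jac_mult[OF x] zero_less_one)
  show "0 < Determinant.det (Matrix.mat d d (\<lambda>(i, j). Dg i j x))"
    using orientation[OF h_Rd[OF x]] by (simp only: jacobian_mat_g)
qed

lemma C_jac: "C_class d 2 jac"
proof -
  have "jac = (\<lambda>x. \<Sum>p | p permutes {0..<d}. signof p * (\<Prod>i = 0..<d. Dh i (p i) x))"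
    unfolding jac_def[abs_def] jacobian_mat_h Determinant.det_def
    by (auto intro!: ext sum.cong prod.cong simp: permutes_in_image)
  moreover have "C_class d 2 (\<lambda>x. \<Sum>p | p permutes {0..<d}. signof p * (\<Prod>i = 0..<d. Dh i (p i) x))"
  proof (intro C_class_sum C_class_mult C_class_const C_class_prod C_Dh)
    fix p i assume "p \<in> {p. p permutes {0..<d}}" "i \<in> {0..<d}"
    then show "i < d" "p i < d" using permutes_in_image[of p "{0..<d}" i] by auto
  qed
  ultimately show ?thesis by simp
qed

text \<open>Jacobi's formula, reduced to the identity matrix by multiplying the moving matrix
  \<open>Dh\<close> by \<open>Dg\<close> at the fixed point x, whose determinant is 1 /
  \<open>jac x\<close>.\<close>

lemma has_pd_jac:
  assumes x: "x \<in> Rd d" and j: "j < d"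
  shows "has_pd jac j x (jac x * (\<Sum>a<d. \<Sum>b<d. Dg a b x * partial_deriv j (Dh b a) x))"
proof -
  let ?M = "Matrix.mat d d (\<lambda>(i, j). Dg i j x)"
  let ?B = "\<lambda>a c s. \<Sum>b<d. Dg a b x * Dh b c (x(j := s))"
  have eq: "jac (x(j := s)) = jac x * Determinant.det (Matrix.mat d d (\<lambda>(a, c). ?B a c s))" for s
  proof -
    have "Determinant.det (Matrix.mat d d (\<lambda>(a, c). ?B a c s)) = Determinant.det ?M * jac (x(j := s))"
      unfolding jac_def jacobian_mat_h by (subst det_mult[symmetric, of _ d]) (auto simp: mat_mult_functions)
    then show ?thesis using jac_mult[OF x] by (simp add: mult.assoc[symmetric] mult.commute[of "jac x"])
  qed
  have C: "C_class d (Suc 1) (Dh a b)" if "a < d" "b < d" for a b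
    using C_Dh[OF that] by (simp add: numeral_2_eq_2 del: C_class.simps)
  have "((\<lambda>s. jac x * Determinant.det (Matrix.mat d d (\<lambda>(a, c). ?B a c s))) has_field_derivative
      jac x * (\<Sum>a<d. \<Sum>b<d. Dg a b x * partial_deriv j (Dh b a) x)) (at (x j))"
    by (intro DERIV_cmult has_derivative_det_at_one DERIV_sum C_class_SucD(2)[OF C] j x) (auto simp: Dg_Dh x)
  then show ?thesis by (simp only: eq)
qed

text \<open>Differentiate the identity \<open>Dg Dh = 1\<close> and multiply by \<open>Dg\<close>
  from the right.\<close>

lemma partial_deriv_Dg:
  assumes x: "x \<in> Rd d" and ij: "i < d" "j < d" "k < d"
  shows "partial_deriv j (Dg k i) x = - (\<Sum>b<d. \<Sum>c<d. Dg k b x * partial_deriv j (Dh b c) x * Dg c i x)"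
proof -
  have Ch: "C_class d (Suc 1) (Dh a b)" if "a < d" "b < d" for a b
    using C_Dh[OF that] by (simp add: numeral_2_eq_2 del: C_class.simps)
  have Cg: "C_class d (Suc 1) (Dg a b)" if "a < d" "b < d" for a b
    using C_Dg[OF that] by (simp add: numeral_2_eq_2 del: C_class.simps)
  have zero: "(\<Sum>b<d. partial_deriv j (Dg k b) x * Dh b c x + partial_deriv j (Dh b c) x * Dg k b x) = 0" if c: "c < d" for c
  proof -
    have "has_pd (\<lambda>x. \<Sum>b<d. Dg k b x * Dh b c x) j x
      (\<Sum>b<d. partial_deriv j (Dg k b) x * Dh b c (x(j := x j)) + partial_deriv j (Dh b c) x * Dg k b (x(j := x j)))"
      by (intro DERIV_sum DERIV_mult C_class_SucD(2)[OF Cg] C_class_SucD(2)[OF Ch] ij c x) auto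
    moreover have "(\<lambda>s. \<Sum>b<d. Dg k b (x(j := s)) * Dh b c (x(j := s))) = (\<lambda>s. if k = c then 1 else 0)"
      using ij c x by (simp only: Dg_Dh Rd_update)
    ultimately have "((\<lambda>s. if k = c then 1 else 0 :: real) has_field_derivative
       (\<Sum>b<d. partial_deriv j (Dg k b) x * Dh b c x + partial_deriv j (Dh b c) x * Dg k b x)) (at (x j))" by simp
    from DERIV_unique[OF this DERIV_const] show ?thesis .
  qed
  have "0 = (\<Sum>c<d. (\<Sum>b<d. partial_deriv j (Dg k b) x * Dh b c x + partial_deriv j (Dh b c) x * Dg k b x) * Dg c i x)"
    by (simp add: zero)
  also have "\<dots> = (\<Sum>c<d. \<Sum>b<d. partial_deriv j (Dg k b) x * (Dh b c x * Dg c i x))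
      + (\<Sum>c<d. \<Sum>b<d. Dg k b x * partial_deriv j (Dh b c) x * Dg c i x)"
    by (simp add: sum_distrib_right sum_distrib_left sum.distrib[symmetric] algebra_simps)
  also have "(\<Sum>c<d. \<Sum>b<d. partial_deriv j (Dg k b) x * (Dh b c x * Dg c i x))
      = (\<Sum>b<d. partial_deriv j (Dg k b) x * (\<Sum>c<d. Dh b c x * Dg c i x))"
    by (subst sum.swap) (simp add: sum_distrib_left)
  also have "\<dots> = (\<Sum>b<d. if b = i then partial_deriv j (Dg k b) x else 0)"
    using ij x by (intro sum.cong) (auto simp: Dh_Dg)
  also have "\<dots> = partial_deriv j (Dg k i) x" using ij by simp
  finally show ?thesis by (subst sum.swap) simp
qed

text \<open>The columns of the cofactor field \<eta> H^(-1) are divergence free. Jacobi's formula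
  and the derivative of the inverse produce two triple sums; they agree because the second
  derivatives of \<open>h\<close> commute.\<close>

lemma piola:
  assumes x: "x \<in> Rd d" and i: "i < d"
  shows "(\<Sum>j<d. partial_deriv j (\<lambda>x. jac x * Dg j i x) x) = 0"
proof -
  have Cg: "C_class d (Suc 1) (Dg a b)" if "a < d" "b < d" for a b
    using C_Dg[OF that] by (simp add: numeral_2_eq_2 del: C_class.simps)
  have sym: "partial_deriv j (Dh b a) x = partial_deriv a (Dh b j) x" if "a < d" "b < d" "j < d" for a b j
    unfolding Dh_def[abs_def] by (rule partial_deriv_commute[OF C_h2]) (use that x in auto)
  have "partial_deriv j (\<lambda>x. jac x * Dg j i x) x
     = jac x * (\<Sum>a<d. \<Sum>b<d. Dg a b x * partial_deriv j (Dh b a) x) * Dg j i x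
      - jac x * (\<Sum>b<d. \<Sum>c<d. Dg j b x * partial_deriv j (Dh b c) x * Dg c i x)" if j: "j < d" for j
  proof -
    have "has_pd (\<lambda>x. jac x * Dg j i x) j x
       (jac x * (\<Sum>a<d. \<Sum>b<d. Dg a b x * partial_deriv j (Dh b a) x) * Dg j i (x(j := x j))
       + partial_deriv j (Dg j i) x * jac (x(j := x j)))"
      by (intro DERIV_mult has_pd_jac C_class_SucD(2)[OF Cg] x i j)
    from partial_deriv_eqI[OF this] show ?thesis
      by (simp add: partial_deriv_Dg[OF x i j j])
  qed
  then have "(\<Sum>j<d. partial_deriv j (\<lambda>x. jac x * Dg j i x) x)
    = jac x * ((\<Sum>j<d. \<Sum>a<d. \<Sum>b<d. Dg a b x * partial_deriv j (Dh b a) x * Dg j i x)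
      - (\<Sum>j<d. \<Sum>b<d. \<Sum>c<d. Dg j b x * partial_deriv j (Dh b c) x * Dg c i x))"
    by (simp add: sum_subtractf sum_distrib_left sum_distrib_right right_diff_distrib mult.assoc)
  also have "(\<Sum>j<d. \<Sum>b<d. \<Sum>c<d. Dg j b x * partial_deriv j (Dh b c) x * Dg c i x)
    = (\<Sum>j<d. \<Sum>c<d. \<Sum>b<d. Dg j b x * partial_deriv j (Dh b c) x * Dg c i x)"
    by (intro sum.cong[OF refl] sum.swap)
  also have "\<dots> = (\<Sum>c<d. \<Sum>j<d. \<Sum>b<d. Dg j b x * partial_deriv j (Dh b c) x * Dg c i x)"
    by (rule sum.swap)
  also have "\<dots> = (\<Sum>c<d. \<Sum>j<d. \<Sum>b<d. Dg j b x * partial_deriv c (Dh b j) x * Dg c i x)"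
    by (intro sum.cong[OF refl]) (simp add: sym)
  finally show ?thesis by simp
qed

text \<open>Product functions make the chain rule one-dimensional and still suffice to determine a measure.\<close>

lemma has_pd_product_h:
  assumes \<theta>: "\<And>k y. k < d \<Longrightarrow> (\<theta> k has_field_derivative \<theta>' k y) (at y)"
    and x: "x \<in> Rd d" and j: "j < d"
  shows "has_pd (\<lambda>x. \<Prod>k<d. \<theta> k (h x k)) j x
    (\<Sum>l<d. (\<theta>' l (h x l) * (\<Prod>k\<in>{..<d} - {l}. \<theta> k (h x k))) * Dh l j x)"
proof -
  have "has_pd (\<lambda>x. \<Prod>k<d. \<theta> k (h x k)) j x
    (\<Sum>l<d. (\<theta>' l (h (x(j := x j)) l) * Dh l j x) * (\<Prod>k\<in>{..<d} - {l}. \<theta> k (h (x(j := x j)) k)))"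
    by (intro has_field_derivative_prod DERIV_chain2[OF \<theta>] has_pd_h j x) auto
  then show ?thesis by (simp add: mult_ac)
qed

text \<open>Since the column field itself is divergence free, only the product is differentiated;
  along column i of H^(-1) the chain rule through \<open>h\<close> leaves the derivative in y_i
  alone.\<close>

lemma piola_product:
  assumes \<theta>: "\<And>k y. k < d \<Longrightarrow> (\<theta> k has_field_derivative \<theta>' k y) (at y)"
    and x: "x \<in> Rd d" and i: "i < d"
  shows "(\<Sum>j<d. partial_deriv j (\<lambda>x. jac x * Dg j i x * (\<Prod>k<d. \<theta> k (h x k))) x)
    = jac x * (\<theta>' i (h x i) * (\<Prod>k\<in>{..<d} - {i}. \<theta> k (h x k)))"
proof -
  let ?F = "\<lambda>x. \<Prod>k<d. \<theta> k (h x k)"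
  let ?D = "\<lambda>l. \<theta>' l (h x l) * (\<Prod>k\<in>{..<d} - {l}. \<theta> k (h x k))"
  have C: "C_class d (Suc 1) (\<lambda>x. jac x * Dg j i x)" if "j < d" for j
    using C_class_mult[OF C_jac C_Dg[OF that i]] by (simp add: numeral_2_eq_2 del: C_class.simps)
  have "partial_deriv j (\<lambda>x. jac x * Dg j i x * ?F x) x
    = partial_deriv j (\<lambda>x. jac x * Dg j i x) x * ?F x + (\<Sum>l<d. ?D l * Dh l j x) * (jac x * Dg j i x)" if j: "j < d" for j
  proof -
    have "has_pd (\<lambda>x. jac x * Dg j i x * ?F x) j x
      (partial_deriv j (\<lambda>x. jac x * Dg j i x) x * ?F (x(j := x j)) + (\<Sum>l<d. ?D l * Dh l j x) * (jac (x(j := x j)) * Dg j i (x(j := x j))))"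
      by (intro DERIV_mult C_class_SucD(2)[OF C] has_pd_product_h \<theta> j x)
    from partial_deriv_eqI[OF this] show ?thesis by simp
  qed
  then have "(\<Sum>j<d. partial_deriv j (\<lambda>x. jac x * Dg j i x * ?F x) x)
    = (\<Sum>j<d. partial_deriv j (\<lambda>x. jac x * Dg j i x) x) * ?F x + (\<Sum>j<d. \<Sum>l<d. jac x * ?D l * (Dh l j x * Dg j i x))"
    by (simp add: sum.distrib sum_distrib_left sum_distrib_right mult_ac)
  also have "(\<Sum>j<d. \<Sum>l<d. jac x * ?D l * (Dh l j x * Dg j i x)) = (\<Sum>l<d. jac x * ?D l * (\<Sum>j<d. Dh l j x * Dg j i x))"
    by (subst sum.swap) (simp add: sum_distrib_left)
  also have "\<dots> = (\<Sum>l<d. if l = i then jac x * ?D l else 0)"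
    using i x by (intro sum.cong) (auto simp: Dh_Dg)
  finally show ?thesis using piola[OF x i] i by simp
qed

end

section \<open>Transport of Lebesgue measure\<close>

text \<open>Composition with \<open>restrict\<close> extends \<open>f\<close> continuously to all
  sequences, where the product sigma-algebra is the Borel one.\<close>

lemma borel_measurable_continuous_Rd:
  fixes f :: "(nat \<Rightarrow> real) \<Rightarrow> real"
  assumes f: "continuous_on (Rd d) f"
  shows "f \<in> borel_measurable (lborel_Rd d)"
proof -
  have "continuous_on UNIV (\<lambda>z::nat \<Rightarrow> real. restrict z {..<d})"
  proof (rule continuous_on_coordinatewise_then_product)
    fix i show "continuous_on UNIV (\<lambda>z::nat \<Rightarrow> real. restrict z {..<d} i)"
      by (cases "i < d") simp_all
  qed
  then have "continuous_on UNIV (\<lambda>z. f (restrict z {..<d}))"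
    by (rule continuous_on_compose2[OF f]) (simp add: image_subset_iff restrict_PiE_iff)
  then have 1: "(\<lambda>z. f (restrict z {..<d})) \<in> borel_measurable borel"
    by (rule borel_measurable_continuous_onI)
  have "(\<lambda>x. x) \<in> measurable (lborel_Rd d) (\<Pi>\<^sub>M i\<in>UNIV. borel)"
  proof (rule measurable_PiM_single')
    fix i show "(\<lambda>x. x i) \<in> borel_measurable (lborel_Rd d)"
    proof (cases "i < d")
      case False
      then have "(\<lambda>x. x i) \<in> borel_measurable (lborel_Rd d) \<longleftrightarrow> (\<lambda>x. undefined :: real) \<in> borel_measurable (lborel_Rd d)"
        by (intro measurable_cong) (auto simp: space_PiM PiE_def extensional_def)
      then show ?thesis by simp
    qed (use measurable_component_singleton[of i "{..<d}" "\<lambda>_. lborel :: real measure"] in simp)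
  qed auto
  then have "(\<lambda>x. x) \<in> measurable (lborel_Rd d) (borel :: (nat \<Rightarrow> real) measure)"
    using measurable_cong_sets[OF refl sets_PiM_equal_borel] by blast
  from measurable_compose[OF this 1]
  have "(\<lambda>x. f (restrict x {..<d})) \<in> borel_measurable (lborel_Rd d)" .
  moreover have "(\<lambda>x. f (restrict x {..<d})) \<in> borel_measurable (lborel_Rd d) \<longleftrightarrow> f \<in> borel_measurable (lborel_Rd d)"
    by (intro measurable_cong) (simp add: space_PiM PiE_restrict)
  ultimately show ?thesis by simp
qed

section \<open>Cubes and functions of compact support\<close>

definition cube :: "nat \<Rightarrow> real \<Rightarrow> (nat \<Rightarrow> real) set" where
  "cube d R = (\<Pi>\<^sub>E i\<in>{..<d}. {-R..R})"

text \<open>Compact support is recorded by an explicit \<open>R\<close>, which products and partial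
  derivatives inherit unchanged; the cube then provides a common set of finite measure for dominated
  convergence.\<close>

definition vanishes_off :: "nat \<Rightarrow> real \<Rightarrow> ((nat \<Rightarrow> real) \<Rightarrow> real) \<Rightarrow> bool" where
  "vanishes_off d R f \<longleftrightarrow> (\<forall>x\<in>Rd d. x \<notin> cube d R \<longrightarrow> f x = 0)"

lemma cube_iff: "x \<in> cube d R \<longleftrightarrow> x \<in> Rd d \<and> (\<forall>i<d. \<bar>x i\<bar> \<le> R)"
  by (auto simp: cube_def PiE_iff abs_le_iff extensional_def) (force simp: minus_le_iff)+

lemma cube_subset: "cube d R \<subseteq> Rd d"
  by (auto simp: cube_iff)

lemma compact_cube: "compact (cube d R)"
proof -
  have "cube d R = (\<Pi>\<^sub>E i\<in>UNIV. if i < d then {-R..R} else {undefined})"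
    by (auto simp: cube_def PiE_def Pi_def extensional_def split: if_splits)
  moreover have "compactin (product_topology (\<lambda>i. euclidean) UNIV) (\<Pi>\<^sub>E i\<in>(UNIV :: nat set). if i < d then {-R..R} else {undefined})"
    by (subst compactin_PiE) auto
  ultimately show ?thesis by (simp add: euclidean_product_topology)
qed

lemma bounded_on_cube:
  assumes "continuous_on (Rd d) f"
  obtains B where "B \<ge> 0" "\<And>x. x \<in> cube d R \<Longrightarrow> \<bar>f x\<bar> \<le> (B::real)"
proof -
  have "compact (f ` cube d R)"
    by (rule compact_continuous_image[OF continuous_on_subset[OF assms cube_subset] compact_cube])
  then obtain B where B: "\<And>y. y \<in> f ` cube d R \<Longrightarrow> \<bar>y\<bar> \<le> B"
    using compact_imp_bounded by (metis bounded_real)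
  have "\<bar>f x\<bar> \<le> max 0 B" if "x \<in> cube d R" for x
    using B[of "f x"] that by auto
  then show ?thesis by (intro that[of "max 0 B"]) auto
qed

lemma cube_measurable: "cube d R \<in> sets (lborel_Rd d)"
  unfolding cube_def by (intro sets_PiM_I_finite) auto

lemma emeasure_cube: "emeasure (lborel_Rd d) (cube d R) < \<infinity>"
  unfolding cube_def
  by (subst lebesgue_product.emeasure_PiM) (simp_all add: power_less_top_ennreal emeasure_lborel_Icc_eq)

lemma integrable_vanishes_off:
  assumes f: "continuous_on (Rd d) f" and v: "vanishes_off d R f"
  shows "integrable (lborel_Rd d) f"
proof -
  obtain B where B: "\<And>x. x \<in> cube d R \<Longrightarrow> \<bar>f x\<bar> \<le> B" using bounded_on_cube[OF f] by blast
  show ?thesis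
  proof (rule Bochner_Integration.integrable_bound)
    show "integrable (lborel_Rd d) (\<lambda>x. B * indicator (cube d R) x)"
      using emeasure_cube cube_measurable by (intro integrable_mult_right integrable_real_indicator) auto
    show "f \<in> borel_measurable (lborel_Rd d)" by (rule borel_measurable_continuous_Rd[OF f])
    show "AE x in lborel_Rd d. norm (f x) \<le> norm (B * indicator (cube d R) x)"
    proof (rule AE_I2)
      fix x assume "x \<in> space (lborel_Rd d)"
      then have "x \<in> Rd d" by (simp add: space_PiM)
      then show "norm (f x) \<le> norm (B * indicator (cube d R) x)"
        using B[of x] v unfolding vanishes_off_def by (cases "x \<in> cube d R") auto
    qed
  qed
qed

lemma continuous_on_update_Rd:
  assumes f: "continuous_on (Rd d) f" and x: "x \<in> Rd d" "i < d"
  shows "continuous_on UNIV (\<lambda>s. f (x(i := s)))"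
proof (rule continuous_on_compose2[OF f])
  show "continuous_on UNIV (\<lambda>s. x(i := s))"
  proof (rule continuous_on_coordinatewise_then_product)
    fix k show "continuous_on UNIV (\<lambda>s. (x(i := s)) k)" by (cases "k = i") auto
  qed
  show "(\<lambda>s. x(i := s)) ` UNIV \<subseteq> Rd d" by (rule image_subsetI) (rule Rd_update[OF x])
qed

lemma vanishes_off_partial:
  assumes i: "i < d" and dF: "\<And>x. x \<in> Rd d \<Longrightarrow> has_pd F i x (D x)" and v: "vanishes_off d R F"
  shows "vanishes_off d R D"
  unfolding vanishes_off_def
proof (intro ballI impI)
  fix x assume x: "x \<in> Rd d" "x \<notin> cube d R"
  then obtain k where k: "k < d" "\<bar>x k\<bar> > R" by (auto simp: cube_iff)
  \<comment> \<open>If the offending coordinate k is not i, the whole line through x in direction i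
    stays off the cube; otherwise an open piece of it around \<open>x i\<close> does.\<close>
  define S where "S = (if k = i then {s. \<bar>s\<bar> > R} else UNIV)"
  have "open S" unfolding S_def by (auto intro!: open_Collect_less continuous_intros)
  moreover have "x i \<in> S" using k by (auto simp: S_def)
  moreover have "F (x(i := s)) = 0" if "s \<in> S" for s
  proof -
    have "\<bar>(x(i := s)) k\<bar> > R" using that k by (auto simp: S_def split: if_splits)
    then have "x(i := s) \<notin> cube d R" using k(1) by (metis cube_iff not_le)
    then show ?thesis using v Rd_update[OF x(1) i] unfolding vanishes_off_def by blast
  qed
  ultimately have "((\<lambda>s. 0) has_field_derivative D x) (at (x i))"
    using has_field_derivative_transform_within_open[OF dF[OF x(1)], of S "\<lambda>s. 0"] by blast
  from DERIV_unique[OF this DERIV_const] show "D x = 0" .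
qed

lemma integral_partial_derivative:
  assumes i: "i < d" and dF: "\<And>x. x \<in> Rd d \<Longrightarrow> has_pd F i x (D x)" and D: "continuous_on (Rd d) D"
    and v: "vanishes_off d R F"
  shows "integrable (lborel_Rd d) D" "(LINT x|lborel_Rd d. D x) = 0"
proof -
  show int: "integrable (lborel_Rd d) D"
    by (rule integrable_vanishes_off[OF D vanishes_off_partial[OF i dF v]])
  define I where "I = {..<d} - {i}"
  have I: "finite I" "i \<notin> I" "insert i I = {..<d}" using i by (auto simp: I_def)
  have "(LINT x|lborel_Rd d. D x) = (LINT x|(\<Pi>\<^sub>M i\<in>I. lborel). (LINT y|lborel. D (x(i := y))))"
    using lebesgue_product.product_integral_insert[OF I(1,2), of D] int I(3) by simp
  also have "\<dots> = (LINT x|(\<Pi>\<^sub>M i\<in>I. lborel :: real measure). 0)"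
  proof (rule Bochner_Integration.integral_cong[OF refl])
    fix x assume "x \<in> space (\<Pi>\<^sub>M i\<in>I. lborel :: real measure)"
    then have x0: "x(i := 0) \<in> Rd d" using i by (auto simp: I_def space_PiM PiE_def extensional_def)
    have upd: "x(i := y) \<in> Rd d" for y using Rd_update[OF x0 i, of y] by simp
    have der: "((\<lambda>s. F (x(i := s))) has_field_derivative D (x(i := y))) (at y)" for y
      using dF[OF upd[of y]] by simp
    have cont: "continuous_on UNIV (\<lambda>s. D (x(i := s)))" using continuous_on_update_Rd[OF D x0 i] by simp
    have out: "F (x(i := s)) = 0" "D (x(i := s)) = 0" if "\<bar>s\<bar> > R" for s
    proof -
      have "x(i := s) \<notin> cube d R" using that i by (metis cube_iff fun_upd_same not_le)
      then show "F (x(i := s)) = 0" "D (x(i := s)) = 0"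
        using v vanishes_off_partial[OF i dF v] upd[of s] unfolding vanishes_off_def by blast+
    qed
    \<comment> \<open>\<open>R\<close> may be negative; with this \<open>Q\<close> the interval is
      never reversed and \<open>F\<close> vanishes at both of its ends.\<close>
    define Q where "Q = \<bar>R\<bar> + 1"
    have "(LINT y|lborel. D (x(i := y))) = (LINT y|lborel. indicator {-Q..Q} y *\<^sub>R D (x(i := y)))"
    proof (rule Bochner_Integration.integral_cong[OF refl])
      fix y show "D (x(i := y)) = indicator {-Q..Q} y *\<^sub>R D (x(i := y))"
      proof (cases "y \<in> {-Q..Q}")
        case False
        then have "\<bar>y\<bar> > R" unfolding Q_def atLeastAtMost_iff by arith
        then show ?thesis using out(2) by simp
      qed simp
    qed
    also have "\<dots> = F (x(i := Q)) - F (x(i := -Q))"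
      by (rule integral_FTC_atLeastAtMost, simp add: Q_def,
          rule has_field_derivative_at_within[OF der, unfolded has_real_derivative_iff_has_vector_derivative],
          rule continuous_on_subset[OF cont], simp)
    also have "\<dots> = 0" using out(1)[of Q] out(1)[of "-Q"] by (auto simp: Q_def)
    finally show "(LINT y|lborel. D (x(i := y))) = 0" .
  qed
  finally show "(LINT x|lborel_Rd d. D x) = 0" by simp
qed

section \<open>Continuously differentiable bumps on the line\<close>

definition bump_fun :: "(real \<Rightarrow> real) \<Rightarrow> bool" where
  "bump_fun \<phi> \<longleftrightarrow> (\<exists>\<phi>'. continuous_on UNIV \<phi>' \<and> (\<forall>y. (\<phi> has_field_derivative \<phi>' y) (at y))) \<and> (\<exists>R. \<forall>y. \<bar>y\<bar> > R \<longrightarrow> \<phi> y = 0)"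

lemma bump_fun_continuous: "bump_fun \<phi> \<Longrightarrow> continuous_on UNIV \<phi>"
  unfolding bump_fun_def by (meson DERIV_continuous_on has_field_derivative_at_within)

lemma bump_fun_common_bound:
  assumes "finite K" "\<And>k. k \<in> K \<Longrightarrow> bump_fun (\<phi> k)"
  obtains R where "\<And>k y. k \<in> K \<Longrightarrow> \<bar>y\<bar> > R \<Longrightarrow> \<phi> k y = 0"
proof -
  obtain R where R: "\<And>k y. k \<in> K \<Longrightarrow> \<bar>y\<bar> > R k \<Longrightarrow> \<phi> k y = 0"
    using assms(2) unfolding bump_fun_def by metis
  have "R k \<le> Max (insert 0 (R ` K))" if "k \<in> K" for k using assms(1) that by (intro Max_ge) auto
  then show ?thesis using R that by (metis order_le_less_trans)
qed

lemma bump_fun_integrable: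
  assumes "bump_fun \<phi>" shows "integrable lborel \<phi>"
proof -
  obtain R where R: "\<And>y. \<bar>y\<bar> > R \<Longrightarrow> \<phi> y = 0" using assms unfolding bump_fun_def by blast
  have "integrable lborel (\<lambda>y. indicator {-R..R} y *\<^sub>R \<phi> y)"
    using borel_integrable_atLeastAtMost'[OF continuous_on_subset[OF bump_fun_continuous[OF assms]]]
    by (auto simp: set_integrable_def)
  moreover have "(\<lambda>y. indicator {-R..R} y *\<^sub>R \<phi> y) = \<phi>"
  proof
    fix y show "indicator {-R..R} y *\<^sub>R \<phi> y = \<phi> y"
    proof (cases "y \<in> {-R..R}")
      case False
      then have "\<bar>y\<bar> > R" unfolding atLeastAtMost_iff by arith
      then show ?thesis using R by simp
    qed simp
  qed
  ultimately show ?thesis by simp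
qed

lemma bump_fun_lincomb:
  assumes "bump_fun \<phi>" "bump_fun \<psi>" shows "bump_fun (\<lambda>y. \<phi> y - c * \<psi> y)"
proof -
  obtain \<phi>' R where 1: "continuous_on UNIV \<phi>'" "\<And>y. (\<phi> has_field_derivative \<phi>' y) (at y)" "\<And>y. \<bar>y\<bar> > R \<Longrightarrow> \<phi> y = 0"
    using assms(1) unfolding bump_fun_def by blast
  obtain \<psi>' Q where 2: "continuous_on UNIV \<psi>'" "\<And>y. (\<psi> has_field_derivative \<psi>' y) (at y)" "\<And>y. \<bar>y\<bar> > Q \<Longrightarrow> \<psi> y = 0"
    using assms(2) unfolding bump_fun_def by blast
  have "((\<lambda>y. \<phi> y - c * \<psi> y) has_field_derivative \<phi>' y - c * \<psi>' y) (at y)" for y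
    by (intro DERIV_diff DERIV_cmult 1 2)
  moreover have "continuous_on UNIV (\<lambda>y. \<phi>' y - c * \<psi>' y)" by (intro continuous_intros 1 2)
  moreover have "\<phi> y - c * \<psi> y = 0" if "\<bar>y\<bar> > max R Q" for y using 1(3)[of y] 2(3)[of y] that by simp
  ultimately show ?thesis unfolding bump_fun_def by blast
qed

lemma bump_fun_antiderivative:
  assumes \<psi>: "bump_fun \<psi>" and zero: "(LINT y|lborel. \<psi> y) = 0"
  obtains \<Psi> where "bump_fun \<Psi>" "\<And>y. (\<Psi> has_field_derivative \<psi> y) (at y)"
proof -
  note c = bump_fun_continuous[OF \<psi>]
  obtain F where F: "\<And>y. (F has_field_derivative \<psi> y) (at y)" using has_antiderivative_UNIV[OF c] by blast
  obtain R where R: "\<And>y. \<bar>y\<bar> > R \<Longrightarrow> \<psi> y = 0" using \<psi> unfolding bump_fun_def by blast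
  define Q where "Q = \<bar>R\<bar> + 1"
  have FTC: "F b - F a = (LINT y|lborel. indicator {a..b} y *\<^sub>R \<psi> y)" if "a \<le> b" for a b
    by (rule integral_FTC_atLeastAtMost[symmetric, OF that])
       (auto simp flip: has_real_derivative_iff_has_vector_derivative
          intro!: has_field_derivative_at_within[OF F] continuous_on_subset[OF c])
  have big: "F b = F a" if "a \<le> -Q" "b \<ge> Q" for a b
  proof -
    have "F b - F a = (LINT y|lborel. indicator {a..b} y *\<^sub>R \<psi> y)" using that by (intro FTC) (auto simp: Q_def)
    also have "\<dots> = (LINT y|lborel. \<psi> y)"
    proof (rule Bochner_Integration.integral_cong[OF refl])
      fix y show "indicator {a..b} y *\<^sub>R \<psi> y = \<psi> y"
      proof (cases "y \<in> {a..b}")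
        case False
        then have "\<bar>y\<bar> > R" using that unfolding Q_def atLeastAtMost_iff by arith
        then show ?thesis using R by simp
      qed simp
    qed
    finally show ?thesis using zero by simp
  qed
  define \<Psi> where "\<Psi> y = F y - F Q" for y
  have d\<Psi>: "(\<Psi> has_field_derivative \<psi> y) (at y)" for y
    unfolding \<Psi>_def[abs_def] by (auto intro!: derivative_eq_intros F)
  moreover have "\<Psi> y = 0" if "\<bar>y\<bar> > Q" for y
    using big[of y Q] big[of "-Q" y] big[of "-Q" Q] that by (auto simp: \<Psi>_def abs_real_def Q_def split: if_splits)
  ultimately have "bump_fun \<Psi>" unfolding bump_fun_def using c by blast
  then show ?thesis using d\<Psi> that by blast
qed

text \<open>\<open>P\<^sup>2 / (P\<^sup>2 + 1/n)\<close> with \<open>P = max 0 ((y - a) (b - y))\<close> is continuously differentiable and increases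
  to the indicator of \<open>(a, b)\<close>.\<close>

definition interval_bump :: "real \<Rightarrow> real \<Rightarrow> nat \<Rightarrow> real \<Rightarrow> real" where
  "interval_bump a b n y = (max 0 ((y - a) * (b - y)))\<^sup>2 / ((max 0 ((y - a) * (b - y)))\<^sup>2 + inverse (real (Suc n)))"

lemma has_derivative_square_positive_part:
  "((\<lambda>s. (max 0 s)\<^sup>2) has_field_derivative 2 * max 0 s) (at (s::real))"
proof (cases s "0::real" rule: linorder_cases)
  case less
  have "((\<lambda>s. 0) has_field_derivative 2 * max 0 s) (at s)" using less by simp
  then show ?thesis
    by (rule has_field_derivative_transform_within_open[where S = "{..<0}"]) (use less in auto)
next
  case greater
  have "((\<lambda>s. s\<^sup>2) has_field_derivative 2 * max 0 s) (at s)" using greater by (auto intro!: derivative_eq_intros)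
  then show ?thesis
    by (rule has_field_derivative_transform_within_open[where S = "{0<..}"]) (use greater in auto)
next
  case equal
  have "((\<lambda>h. (max 0 h)\<^sup>2 / h) \<longlongrightarrow> 0) (at (0::real))"
  proof (rule Lim_null_comparison[of _ "\<lambda>h. \<bar>h\<bar>"])
    have "norm ((max 0 h)\<^sup>2 / h) \<le> \<bar>h\<bar>" for h :: real
      by (auto simp: max_def power2_eq_square)
    then show "\<forall>\<^sub>F h in at 0. norm ((max 0 h)\<^sup>2 / h) \<le> \<bar>h\<bar>" by (intro always_eventually) blast
    show "(abs \<longlongrightarrow> (0::real)) (at 0)" by (intro tendsto_rabs_zero tendsto_ident_at)
  qed
  then show ?thesis using equal by (simp add: DERIV_def)
qed

lemma bump_fun_interval_bump: "bump_fun (interval_bump a b n)"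
proof -
  define c where "c = inverse (real (Suc n))"
  have c: "c > 0" by (simp add: c_def)
  let ?q = "\<lambda>y. (y - a) * (b - y)"
  let ?P = "\<lambda>y. (max 0 (?q y))\<^sup>2"
  let ?P' = "\<lambda>y. 2 * max 0 (?q y) * (a + b - 2 * y)"
  have dP: "(?P has_field_derivative ?P' y) (at y)" for y
    by (rule DERIV_chain2[OF has_derivative_square_positive_part]) (auto intro!: derivative_eq_intros simp: algebra_simps)
  have pos: "?P y + c > 0" for y using c by (simp add: add_nonneg_pos)
  have "((\<lambda>y. ?P y / (?P y + c)) has_field_derivative (?P' y * (?P y + c) - ?P y * ?P' y) / ((?P y + c) * (?P y + c))) (at y)" for y
    using DERIV_divide[OF dP[of y] DERIV_add[OF dP[of y] DERIV_const[of c]]] pos[of y] by simp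
  moreover have "continuous_on UNIV (\<lambda>y. (?P' y * (?P y + c) - ?P y * ?P' y) / ((?P y + c) * (?P y + c)))"
    using pos by (intro continuous_intros) (auto simp: less_imp_neq[symmetric])
  moreover have "?P y / (?P y + c) = 0" if "\<bar>y\<bar> > max \<bar>a\<bar> \<bar>b\<bar>" for y
  proof -
    have "?q y \<le> 0" using that by (auto simp: mult_le_0_iff)
    then show ?thesis by simp
  qed
  ultimately show ?thesis
    unfolding bump_fun_def interval_bump_def[abs_def] c_def[symmetric] by blast
qed

lemma interval_bump_bounds: "0 \<le> interval_bump a b n y" "interval_bump a b n y \<le> 1"
  by (auto simp: interval_bump_def intro!: divide_nonneg_nonneg divide_le_eq_1_pos[THEN iffD2] add_nonneg_pos)

lemma interval_bump_mono: "interval_bump a b n y \<le> interval_bump a b (Suc n) y"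
proof -
  define P where "P = (max 0 ((y - a) * (b - y)))\<^sup>2"
  have "P \<ge> 0" by (simp add: P_def)
  moreover have "inverse (real (Suc (Suc n))) \<le> inverse (real (Suc n))" by simp
  moreover have "inverse (real (Suc (Suc n))) > 0" by simp
  ultimately have "P / (P + inverse (real (Suc n))) \<le> P / (P + inverse (real (Suc (Suc n))))"
    by (intro divide_left_mono mult_pos_pos) (auto intro: add_nonneg_pos simp del: of_nat_Suc)
  then show ?thesis by (simp add: interval_bump_def P_def)
qed

lemma interval_bump_tendsto: "(\<lambda>n. interval_bump a b n y) \<longlonglongrightarrow> indicator {a<..<b} y" if "a \<le> b"
proof -
  define P where "P = (max 0 ((y - a) * (b - y)))\<^sup>2"
  have lim: "(\<lambda>n. P / (P + inverse (real (Suc n)))) \<longlonglongrightarrow> P / (P + 0)" if "P \<noteq> 0"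
    using that by (intro tendsto_intros LIMSEQ_inverse_real_of_nat) auto
  show ?thesis
  proof (cases "a < y \<and> y < b")
    case True
    then have "P \<noteq> 0" by (simp add: P_def max_def mult_le_0_iff)
    then show ?thesis using lim True unfolding interval_bump_def P_def[symmetric] by simp
  next
    case False
    then consider "y \<le> a" | "b \<le> y" by linarith
    then have "(y - a) * (b - y) \<le> 0" using \<open>a \<le> b\<close> by cases (simp_all add: mult_le_0_iff)
    then have "P = 0" by (simp add: P_def)
    then show ?thesis using False by (simp add: interval_bump_def P_def[symmetric])
  qed
qed

section \<open>Integrals of bump products in the coordinates \<open>h\<close>\<close>

context oriented_diffeo
begin

lemma continuous_h: "i < d \<Longrightarrow> continuous_on (Rd d) (\<lambda>x. h x i)"
  by (rule C_class_continuous[OF C_h])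

lemma cube_preimage_h:
  obtains R' where "\<And>x. x \<in> Rd d \<Longrightarrow> h x \<in> cube d R \<Longrightarrow> x \<in> cube d R'"
proof -
  have "\<exists>B. \<forall>y\<in>cube d R. \<bar>g y i\<bar> \<le> B" if "i < d" for i
    by (rule bounded_on_cube[OF C_class_continuous[OF C_g[OF that]], of R]) blast
  then obtain B where B: "\<And>i y. i < d \<Longrightarrow> y \<in> cube d R \<Longrightarrow> \<bar>g y i\<bar> \<le> B i" by metis
  have "x \<in> cube d (Max (insert 0 (B ` {..<d})))" if x: "x \<in> Rd d" "h x \<in> cube d R" for x
  proof -
    have "\<bar>x i\<bar> \<le> Max (insert 0 (B ` {..<d}))" if "i < d" for i
    proof -
      have "\<bar>x i\<bar> \<le> B i" using B[OF that x(2)] x(1) by simp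
      also have "\<dots> \<le> Max (insert 0 (B ` {..<d}))" using that by (intro Max_ge) auto
      finally show ?thesis .
    qed
    then show ?thesis using x(1) by (auto simp: cube_iff)
  qed
  then show ?thesis using that by blast
qed

lemma C_bump_h:
  assumes "bump_fun \<phi>" "k < d" shows "C_class d (Suc 0) (\<lambda>x. \<phi> (h x k))"
proof -
  obtain \<phi>' where "continuous_on UNIV \<phi>'" "\<And>y. (\<phi> has_field_derivative \<phi>' y) (at y)"
    using assms(1) unfolding bump_fun_def by blast
  then show ?thesis
    using C_class_compose_real[of "Suc 0" "\<lambda>n. if n = 0 then \<phi> else \<phi>'" d "\<lambda>x. h x k"]
      C_class_mono[OF C_h[OF assms(2)], of "Suc 0"] by (simp del: C_class.simps)
qed

lemma vanishes_off_bump_product: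
  assumes "\<And>k. k < d \<Longrightarrow> bump_fun (\<theta> k)"
  obtains R where "vanishes_off d R (\<lambda>x. \<Prod>k<d. \<theta> k (h x k))"
proof -
  obtain Q where Q: "\<And>k y. k < d \<Longrightarrow> \<bar>y\<bar> > Q \<Longrightarrow> \<theta> k y = 0"
    using bump_fun_common_bound[of "{..<d}" \<theta>] assms by auto
  obtain R where R: "\<And>x. x \<in> Rd d \<Longrightarrow> h x \<in> cube d Q \<Longrightarrow> x \<in> cube d R" using cube_preimage_h by blast
  have "(\<Prod>k<d. \<theta> k (h x k)) = 0" if "x \<in> Rd d" "x \<notin> cube d R" for x
  proof -
    have "h x \<notin> cube d Q" using R that by blast
    then obtain k where "k < d" "\<bar>h x k\<bar> > Q" using h_Rd[OF \<open>x \<in> Rd d\<close>] unfolding cube_iff by (metis not_le)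
    then show ?thesis using Q by (intro prod_zero) auto
  qed
  then show ?thesis using that unfolding vanishes_off_def by blast
qed

lemma integrable_bump_product:
  assumes "\<And>k. k < d \<Longrightarrow> bump_fun (\<theta> k)"
  shows "integrable (lborel_Rd d) (\<lambda>x. jac x * (\<Prod>k<d. \<theta> k (h x k)))"
proof -
  obtain R where "vanishes_off d R (\<lambda>x. \<Prod>k<d. \<theta> k (h x k))" using vanishes_off_bump_product[OF assms] .
  then have "vanishes_off d R (\<lambda>x. jac x * (\<Prod>k<d. \<theta> k (h x k)))" by (simp add: vanishes_off_def)
  then show ?thesis
    by (rule integrable_vanishes_off[rotated])
      (auto intro!: continuous_on_mult C_class_continuous[OF C_jac] continuous_on_prod C_class_continuous[OF C_bump_h] assms)
qed

text \<open>When one factor of a bump product is a derivative, the integrand is, by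
  \<open>piola_product\<close>, a divergence of compactly supported fields, and the integral
  vanishes.\<close>

lemma integral_piola_bump:
  assumes \<theta>: "\<And>k. k < d \<Longrightarrow> bump_fun (\<theta> k)" and i: "i < d"
    and d\<theta>: "\<And>y. (\<theta> i has_field_derivative \<psi> y) (at y)"
  shows "(LINT x|lborel_Rd d. jac x * (\<psi> (h x i) * (\<Prod>k\<in>{..<d} - {i}. \<theta> k (h x k)))) = 0"
proof -
  obtain \<theta>' where \<theta>': "\<And>k y. k < d \<Longrightarrow> (\<theta> k has_field_derivative \<theta>' k y) (at y)"
    using \<theta> unfolding bump_fun_def by metis
  have eq: "\<theta>' i = \<psi>" using DERIV_unique[OF \<theta>'[OF i] d\<theta>] by blast
  let ?F = "\<lambda>x. \<Prod>k<d. \<theta> k (h x k)"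
  let ?Z = "\<lambda>j x. jac x * Dg j i x * ?F x"
  obtain R where R: "vanishes_off d R ?F" using vanishes_off_bump_product[OF \<theta>] .
  have C: "C_class d (Suc 0) (?Z j)" if "j < d" for j
    by (intro C_class_mult C_class_prod C_bump_h \<theta> C_class_mono[OF C_jac] C_class_mono[OF C_Dg] i that) auto
  have "vanishes_off d R (?Z j)" for j using R by (auto simp: vanishes_off_def)
  then have Z: "integrable (lborel_Rd d) (partial_deriv j (?Z j))" "(LINT x|lborel_Rd d. partial_deriv j (?Z j) x) = 0" if "j < d" for j
    using integral_partial_derivative[OF that C_class_SucD(2)[OF C[OF that] that] C_class_continuous[OF C_class_SucD(1)[OF C[OF that] that]]] by blast+
  have "(LINT x|lborel_Rd d. jac x * (\<psi> (h x i) * (\<Prod>k\<in>{..<d} - {i}. \<theta> k (h x k))))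
    = (LINT x|lborel_Rd d. (\<Sum>j<d. partial_deriv j (?Z j) x))"
    by (intro Bochner_Integration.integral_cong) (simp_all add: piola_product[OF \<theta>' _ i] eq space_PiM)
  also have "\<dots> = 0"
    by (subst Bochner_Integration.integral_sum) (simp_all add: Z)
  finally show ?thesis .
qed

text \<open>The difference of \<open>\<theta> i\<close> and its mean times \<open>\<rho>\<close> has
  mean 0, so it is the derivative of a bump and contributes nothing: the integral sees
  \<open>\<theta> i\<close> only through its mean.\<close>

lemma integral_replace_bump:
  assumes \<theta>: "\<And>k. k < d \<Longrightarrow> bump_fun (\<theta> k)" and i: "i < d" and \<rho>: "bump_fun \<rho>" "(LINT y|lborel. \<rho> y) = 1"
  shows "(LINT x|lborel_Rd d. jac x * (\<Prod>k<d. \<theta> k (h x k)))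
    = (LINT y|lborel. \<theta> i y) * (LINT x|lborel_Rd d. jac x * (\<Prod>k<d. (\<theta>(i := \<rho>)) k (h x k)))"
proof -
  define c where "c = (LINT y|lborel. \<theta> i y)"
  define \<psi> where "\<psi> y = \<theta> i y - c * \<rho> y" for y
  have b: "bump_fun \<psi>" unfolding \<psi>_def by (intro bump_fun_lincomb \<theta> i \<rho>)
  have "(LINT y|lborel. \<psi> y) = 0"
    unfolding \<psi>_def using bump_fun_integrable \<theta>[OF i] \<rho> by (simp add: c_def)
  then obtain \<Psi> where \<Psi>: "bump_fun \<Psi>" "\<And>y. (\<Psi> has_field_derivative \<psi> y) (at y)"
    using bump_fun_antiderivative[OF b] by blast
  have \<theta>\<rho>: "bump_fun ((\<theta>(i := \<rho>)) k)" "bump_fun ((\<theta>(i := \<Psi>)) k)" if "k < d" for k using \<theta>[OF that] \<rho> \<Psi> by auto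
  have factor: "(\<Prod>k<d. (\<theta>(i := \<phi>)) k (h x k)) = \<phi> (h x i) * (\<Prod>k\<in>{..<d} - {i}. \<theta> k (h x k))" for \<phi> x
  proof -
    have "(\<Prod>k\<in>{..<d} - {i}. (\<theta>(i := \<phi>)) k (h x k)) = (\<Prod>k\<in>{..<d} - {i}. \<theta> k (h x k))" by (rule prod.cong) auto
    then show ?thesis using i by (subst prod.remove[of _ i]) auto
  qed
  have "0 = (LINT x|lborel_Rd d. jac x * (\<psi> (h x i) * (\<Prod>k\<in>{..<d} - {i}. (\<theta>(i := \<Psi>)) k (h x k))))"
    by (rule integral_piola_bump[symmetric]) (use \<theta>\<rho> i \<Psi> in auto)
  also have "\<dots> = (LINT x|lborel_Rd d. jac x * (\<Prod>k<d. \<theta> k (h x k)) - c * (jac x * (\<Prod>k<d. (\<theta>(i := \<rho>)) k (h x k))))"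
  proof (rule Bochner_Integration.integral_cong[OF refl])
    fix x
    have "(\<Prod>k\<in>{..<d} - {i}. (\<theta>(i := \<Psi>)) k (h x k)) = (\<Prod>k\<in>{..<d} - {i}. \<theta> k (h x k))" by (rule prod.cong) auto
    then show "jac x * (\<psi> (h x i) * (\<Prod>k\<in>{..<d} - {i}. (\<theta>(i := \<Psi>)) k (h x k)))
      = jac x * (\<Prod>k<d. \<theta> k (h x k)) - c * (jac x * (\<Prod>k<d. (\<theta>(i := \<rho>)) k (h x k)))"
      using factor[of "\<theta> i" x] factor[of \<rho> x] by (simp add: \<psi>_def algebra_simps)
  qed
  also have "\<dots> = (LINT x|lborel_Rd d. jac x * (\<Prod>k<d. \<theta> k (h x k))) - c * (LINT x|lborel_Rd d. jac x * (\<Prod>k<d. (\<theta>(i := \<rho>)) k (h x k)))"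
    by (subst Bochner_Integration.integral_diff) (auto intro!: integrable_mult_right integrable_bump_product \<theta> \<theta>\<rho> simp del: fun_upd_apply)
  finally show ?thesis by (simp add: c_def)
qed

text \<open>The coordinates are replaced one after another. What remains is a constant independent
  of \<theta>, so bump products integrate as they would against a multiple of Lebesgue
  measure.\<close>

lemma integral_bump_product:
  assumes \<theta>: "\<And>k. k < d \<Longrightarrow> bump_fun (\<theta> k)" and \<rho>: "bump_fun \<rho>" "(LINT y|lborel. \<rho> y) = 1"
  shows "(LINT x|lborel_Rd d. jac x * (\<Prod>k<d. \<theta> k (h x k)))
    = (\<Prod>k<d. LINT y|lborel. \<theta> k y) * (LINT x|lborel_Rd d. jac x * (\<Prod>k<d. \<rho> (h x k)))"
proof -
  let ?I = "\<lambda>\<theta>. LINT x|lborel_Rd d. jac x * (\<Prod>k<d. \<theta> k (h x k))"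
  have main: "?I \<theta> = (\<Prod>k<n. LINT y|lborel. \<theta> k y) * ?I (\<lambda>k. if k < n then \<rho> else \<theta> k)" if "n \<le> d" for n
    using that
  proof (induction n)
    case (Suc n)
    let ?\<theta> = "\<lambda>k. if k < n then \<rho> else \<theta> k"
    have "?I ?\<theta> = (LINT y|lborel. ?\<theta> n y) * ?I (?\<theta>(n := \<rho>))"
      by (rule integral_replace_bump) (use Suc.prems \<theta> \<rho> in auto)
    moreover have "?\<theta>(n := \<rho>) = (\<lambda>k. if k < Suc n then \<rho> else \<theta> k)" by (auto simp: less_Suc_eq)
    ultimately show ?case using Suc by (simp add: mult_ac)
  qed simp
  have all: "(\<Prod>k<d. (if k < d then \<rho> else \<theta> k) (h x k)) = (\<Prod>k<d. \<rho> (h x k))" for x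
    by (rule prod.cong) auto
  from main[OF order_refl] show ?thesis by (simp only: all)
qed

end

section \<open>Measures determined by open boxes\<close>

lemma sets_lborel_Rd:
  "sets (lborel_Rd d) = sigma_sets (Rd d)
     {(\<Pi>\<^sub>E i\<in>{..<d}. A i) | A. \<forall>i\<in>{..<d}. A i \<in> range (\<lambda>(a, b). {a<..<b})}"
proof -
  let ?G = "range (\<lambda>(a, b). {a<..<b::real})"
  let ?S = "range (\<lambda>n::nat. {- real n<..<real n})"
  have S: "?S \<subseteq> ?G" "countable ?S" "UNIV = \<Union> ?S"
  proof -
    show "?S \<subseteq> ?G" by auto
    show "countable ?S" by simp
    have "x \<in> \<Union> ?S" for x :: real
    proof -
      obtain n where "\<bar>x\<bar> < real n" using reals_Archimedean2 by blast
      then have "x \<in> {- real n<..<real n}" by (auto simp: abs_less_iff)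
      then show ?thesis by blast
    qed
    then show "UNIV = \<Union> ?S" by auto
  qed
  have "sets (lborel_Rd d) = sets (\<Pi>\<^sub>M i\<in>{..<d}. sigma UNIV ?G)"
    using borel_eq_box[where 'a = real] by (intro sets_PiM_cong) (simp_all add: box_real[abs_def])
  also have "\<dots> = sets (sigma (Rd d) {{f\<in>Rd d. \<forall>i\<in>j. f i \<in> A i} | A j. j \<in> {{..<d}} \<and> A \<in> Pi j (\<lambda>_. ?G)})"
    by (rule sets_PiM_sigma) (use S in \<open>auto intro!: exI[of _ ?S]\<close>)
  also have "{{f\<in>Rd d. \<forall>i\<in>j. f i \<in> A i} | A j. j \<in> {{..<d}} \<and> A \<in> Pi j (\<lambda>_. ?G)}
    = {(\<Pi>\<^sub>E i\<in>{..<d}. A i) | A. \<forall>i\<in>{..<d}. A i \<in> ?G}"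
  proof -
    have "{f\<in>Rd d. \<forall>i\<in>{..<d}. f i \<in> A i} = (\<Pi>\<^sub>E i\<in>{..<d}. A i)" for A
      unfolding PiE_def Pi_def by blast
    then show ?thesis unfolding Pi_def by (simp add: Ball_def)
  qed
  finally show ?thesis by (subst (asm) sets_measure_of) (auto simp only: PiE_mono subset_UNIV Pow_iff)
qed

lemma measure_eqI_Rd:
  fixes M N :: "(nat \<Rightarrow> real) measure"
  assumes sets: "sets M = sets (lborel_Rd d)" "sets N = sets (lborel_Rd d)"
    and eq: "\<And>a b. (\<And>i. i < d \<Longrightarrow> a i \<le> b i) \<Longrightarrow>
       emeasure M (\<Pi>\<^sub>E i\<in>{..<d}. {a i<..<b i}) = emeasure N (\<Pi>\<^sub>E i\<in>{..<d}. {a i<..<b i})"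
    and fin: "\<And>n::nat. emeasure M (\<Pi>\<^sub>E i\<in>{..<d}. {- real n<..<real n}) \<noteq> \<infinity>"
  shows "M = N"
proof -
  let ?G = "range (\<lambda>(a, b). {a<..<b::real})"
  let ?E = "{(\<Pi>\<^sub>E i\<in>{..<d}. A i) | A. \<forall>i\<in>{..<d}. A i \<in> ?G}"
  let ?A = "\<lambda>n::nat. (\<Pi>\<^sub>E i\<in>{..<d}. {- real n<..<real n})"
  have G: "\<exists>a b. S = {a<..<b}" if "S \<in> ?G" for S using that by auto
  have G': "{a<..<b} \<in> ?G" for a b by (rule range_eqI[of _ _ "(a, b)"]) simp
  show ?thesis
  proof (rule measure_eqI_generator_eq[where E = ?E and \<Omega> = "Rd d" and A = ?A])
    show "Int_stable ?E"
    proof (rule Int_stableI)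
      fix X Y assume "X \<in> ?E" "Y \<in> ?E"
      then obtain A B where AB: "X = (\<Pi>\<^sub>E i\<in>{..<d}. A i)" "Y = (\<Pi>\<^sub>E i\<in>{..<d}. B i)"
        "\<forall>i\<in>{..<d}. A i \<in> ?G" "\<forall>i\<in>{..<d}. B i \<in> ?G" by blast
      have "X \<inter> Y = (\<Pi>\<^sub>E i\<in>{..<d}. A i \<inter> B i)" by (auto simp: AB(1,2) PiE_Int)
      moreover have "A i \<inter> B i \<in> ?G" if i: "i \<in> {..<d}" for i
      proof -
        obtain a b c e where "A i = {a<..<b}" "B i = {c<..<e}"
          using G[OF AB(3)[rule_format, OF i]] G[OF AB(4)[rule_format, OF i]] by blast
        then have "A i \<inter> B i = {max a c<..<min b e}" by auto
        then show ?thesis by (simp only: G')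
      qed
      ultimately show "X \<inter> Y \<in> ?E" by blast
    qed
    show "?E \<subseteq> Pow (Rd d)" by (auto simp only: PiE_mono subset_UNIV Pow_iff)
    show "sets M = sigma_sets (Rd d) ?E" "sets N = sigma_sets (Rd d) ?E" using sets sets_lborel_Rd by auto
    show "range ?A \<subseteq> ?E" using G' by blast
    show "(\<Union>n. ?A n) = Rd d"
    proof (intro subset_antisym UN_least PiE_mono subset_UNIV subsetI)
      fix x assume x: "x \<in> Rd d"
      obtain n where n: "Max (insert 0 ((\<lambda>i. \<bar>x i\<bar>) ` {..<d})) < real n" using reals_Archimedean2 by blast
      have "x i \<in> {- real n<..<real n}" if "i < d" for i
      proof -
        have "\<bar>x i\<bar> \<le> Max (insert 0 ((\<lambda>i. \<bar>x i\<bar>) ` {..<d}))" using that by (intro Max_ge) auto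
        with n have "\<bar>x i\<bar> < real n" by linarith
        then show ?thesis unfolding greaterThanLessThan_iff by arith
      qed
      then have "x \<in> ?A n" using x unfolding PiE_iff by blast
      then show "x \<in> (\<Union>n. ?A n)" by blast
    qed
    show "emeasure M (?A n) \<noteq> \<infinity>" for n by (rule fin)
    fix X assume "X \<in> ?E"
    then obtain A where A: "X = (\<Pi>\<^sub>E i\<in>{..<d}. A i)" "\<forall>i\<in>{..<d}. A i \<in> ?G" by blast
    have "\<forall>i. \<exists>a b. i < d \<longrightarrow> A i = {a<..<b} \<and> a \<le> b"
    proof
      fix i show "\<exists>a b. i < d \<longrightarrow> A i = {a<..<b} \<and> a \<le> b"
      proof (cases "i < d")
        case True
        then obtain a b where "A i = {a<..<b}" using G[OF bspec[OF A(2), of i]] unfolding lessThan_iff by blast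
        \<comment> \<open>Empty sides are rewritten to satisfy a \<le> b, because for b < a the
          product (y - a) (b - y) is positive between b and a and \<open>interval_bump a b\<close>
          does not tend to the indicator.\<close>
        moreover have "{a<..<b} = {a<..<max a b}" by (cases "a \<le> b") (simp_all add: max_def)
        ultimately have "A i = {a<..<max a b} \<and> a \<le> max a b" by simp
        then show ?thesis by blast
      qed simp
    qed
    then obtain a b where "\<And>i. i < d \<Longrightarrow> A i = {a i<..<b i} \<and> a i \<le> b i" by metis
    moreover from this have "X = (\<Pi>\<^sub>E i\<in>{..<d}. {a i<..<b i})" unfolding A(1) by (intro PiE_cong) auto
    ultimately show "emeasure M X = emeasure N X" using eq by auto
  qed
qed

lemma normalized_bump: obtains \<rho> where "bump_fun \<rho>" "(LINT y|lborel. \<rho> y) = 1" "\<And>y. \<rho> y \<ge> 0"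
proof -
  let ?\<phi> = "interval_bump 0 1 0"
  have b: "bump_fun ?\<phi>" by (rule bump_fun_interval_bump)
  define c where "c = (LINT y|lborel. ?\<phi> y)"
  have "c \<ge> 0" unfolding c_def by (intro Bochner_Integration.integral_nonneg interval_bump_bounds)
  moreover have "c \<noteq> 0"
  proof
    assume "c = 0"
    then have "AE y in lborel. ?\<phi> y = 0"
      using integral_nonneg_eq_0_iff_AE[OF bump_fun_integrable[OF b]] interval_bump_bounds(1) by (auto simp: c_def)
    then have "AE y in lborel. y \<notin> {0<..<1::real}"
    proof (rule AE_mp, intro AE_I2 impI)
      fix y :: real assume 0: "?\<phi> y = 0"
      show "y \<notin> {0<..<1}"
      proof
        assume "y \<in> {0<..<1}"
        then have "(max 0 ((y - 0) * (1 - y)))\<^sup>2 > 0" by simp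
        with 0 show False unfolding interval_bump_def
          by (metis add_pos_pos divide_eq_0_iff inverse_positive_iff_positive less_irrefl of_nat_0_less_iff zero_less_Suc)
      qed
    qed
    then have "emeasure lborel {0<..<1::real} = 0" by (subst (asm) AE_iff_null_sets[symmetric]) auto
    then show False by simp
  qed
  ultimately have c: "c > 0" by simp
  show ?thesis
  proof (rule that[of "\<lambda>y. 0 - (- (1 / c)) * ?\<phi> y"])
    have "bump_fun (\<lambda>y. ?\<phi> y - 1 * ?\<phi> y)" by (intro bump_fun_lincomb b)
    then show "bump_fun (\<lambda>y. 0 - (- (1 / c)) * ?\<phi> y)"
      using bump_fun_lincomb[OF _ b, of "\<lambda>y. 0" "- (1/c)"] by simp
    show "(LINT y|lborel. 0 - (- (1 / c)) * ?\<phi> y) = 1" using c by (simp add: c_def)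
    show "0 - (- (1 / c)) * ?\<phi> y \<ge> 0" for y using c interval_bump_bounds(1)[of 0 1 0 y] by simp
  qed
qed

section \<open>The image under \<open>h\<close> of the measure with density
  \<open>jac\<close>\<close>

context oriented_diffeo
begin

lemma measurable_h: "h \<in> measurable (lborel_Rd d) (lborel_Rd d)"
proof (rule measurable_PiM_single')
  fix i assume "i \<in> {..<d}"
  then show "(\<lambda>x. h x i) \<in> measurable (lborel_Rd d) lborel"
    using borel_measurable_continuous_Rd[OF continuous_h] by simp
qed (use h_Rd in \<open>simp add: space_PiM image_subset_iff Pi_iff\<close>)

lemma measurable_jac: "jac \<in> borel_measurable (lborel_Rd d)"
  by (rule borel_measurable_continuous_Rd[OF C_class_continuous[OF C_jac]])

text \<open>The constant is \<open>1\<close>, but both sides of the Carleman inequality are multiplied by it.\<close>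

theorem distr_jac_density:
  obtains c where "c \<ge> 0"
    "distr (density (lborel_Rd d) (\<lambda>x. ennreal (jac x))) (lborel_Rd d) h = density (lborel_Rd d) (\<lambda>x. ennreal c)"
proof -
  obtain \<rho> where \<rho>: "bump_fun \<rho>" "(LINT y|lborel. \<rho> y) = 1" "\<And>y. \<rho> y \<ge> 0" using normalized_bump by blast
  \<comment> \<open>The value of the functional on factors of mean 1, hence the constant of
    proportionality.\<close>
  define c where "c = (LINT x|lborel_Rd d. jac x * (\<Prod>k<d. \<rho> (h x k)))"
  have c0: "c \<ge> 0" unfolding c_def
    using jac_pos by (intro Bochner_Integration.integral_nonneg mult_nonneg_nonneg prod_nonneg \<rho>) (auto simp: space_PiM less_imp_le)
  note [measurable] = measurable_h measurable_jac
  let ?\<nu> = "distr (density (lborel_Rd d) (\<lambda>x. ennreal (jac x))) (lborel_Rd d) h"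
  let ?\<kappa> = "density (lborel_Rd d) (\<lambda>x. ennreal c)"
  \<comment> \<open>On products of nonnegative bumps the two measures agree:
    \<open>integral_bump_product\<close> evaluates the left side, Fubini the right side.\<close>
  have prods: "(\<integral>\<^sup>+y. ennreal (\<Prod>k<d. \<theta> k (y k)) \<partial>?\<nu>) = (\<integral>\<^sup>+y. ennreal (\<Prod>k<d. \<theta> k (y k)) \<partial>?\<kappa>)"
    if \<theta>: "\<And>k. bump_fun (\<theta> k)" "\<And>k y. \<theta> k y \<ge> 0" for \<theta>
  proof -
    have [measurable]: "\<theta> k \<in> borel_measurable borel" for k
      by (rule borel_measurable_continuous_onI[OF bump_fun_continuous[OF \<theta>(1)]])
    have nn: "(\<Prod>k<d. \<theta> k (y k)) \<ge> 0" for y by (intro prod_nonneg) (auto intro: \<theta>)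
    have fm: "(\<lambda>y. ennreal (\<Prod>k<d. \<theta> k (y k))) \<in> borel_measurable (lborel_Rd d)" by measurable
    have "(\<integral>\<^sup>+y. ennreal (\<Prod>k<d. \<theta> k (y k)) \<partial>?\<nu>)
      = (\<integral>\<^sup>+x. ennreal (jac x) * ennreal (\<Prod>k<d. \<theta> k (h x k)) \<partial>lborel_Rd d)"
      using measurable_compose[OF measurable_h fm]
      by (subst nn_integral_distr) (simp_all add: fm nn_integral_density measurable_h measurable_jac measurable_ennreal)
    also have "\<dots> = (\<integral>\<^sup>+x. ennreal (jac x * (\<Prod>k<d. \<theta> k (h x k))) \<partial>lborel_Rd d)"
      by (intro nn_integral_cong) (use jac_pos in \<open>auto simp: space_PiM ennreal_mult'' nn\<close>)
    also have "\<dots> = ennreal (LINT x|lborel_Rd d. jac x * (\<Prod>k<d. \<theta> k (h x k)))"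
      by (intro nn_integral_eq_integral integrable_bump_product \<theta> AE_I2)
        (use jac_pos in \<open>auto simp: space_PiM less_imp_le intro!: mult_nonneg_nonneg nn\<close>)
    also have "(LINT x|lborel_Rd d. jac x * (\<Prod>k<d. \<theta> k (h x k))) = (\<Prod>k<d. LINT y|lborel. \<theta> k y) * c"
      unfolding c_def by (rule integral_bump_product[OF \<theta>(1) \<rho>(1,2)])
    also have "ennreal \<dots> = ennreal c * ennreal (LINT y|lborel_Rd d. (\<Prod>k<d. \<theta> k (y k)))"
      by (subst lebesgue_product.product_integral_prod)
        (auto intro!: bump_fun_integrable \<theta> simp: ennreal_mult' c0 mult.commute)
    also have "\<dots> = ennreal c * (\<integral>\<^sup>+y. ennreal (\<Prod>k<d. \<theta> k (y k)) \<partial>lborel_Rd d)"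
      by (subst nn_integral_eq_integral) (auto intro!: lebesgue_product.product_integrable_prod bump_fun_integrable \<theta> nn)
    also have "\<dots> = (\<integral>\<^sup>+y. ennreal c * ennreal (\<Prod>k<d. \<theta> k (y k)) \<partial>lborel_Rd d)"
      by (rule nn_integral_cmult[symmetric]) measurable
    also have "\<dots> = (\<integral>\<^sup>+y. ennreal (\<Prod>k<d. \<theta> k (y k)) \<partial>?\<kappa>)"
      by (rule nn_integral_density[symmetric]) measurable
    finally show ?thesis .
  qed
  have boxes: "emeasure ?\<nu> (\<Pi>\<^sub>E i\<in>{..<d}. {a i<..<b i}) = emeasure ?\<kappa> (\<Pi>\<^sub>E i\<in>{..<d}. {a i<..<b i})"
    if ab: "\<And>i. i < d \<Longrightarrow> a i \<le> b i" for a b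
  proof -
    let ?b = "\<lambda>n y. \<Prod>k<d. interval_bump (a k) (b k) n (y k)"
    let ?X = "\<Pi>\<^sub>E i\<in>{..<d}. {a i<..<b i}"
    have [measurable]: "interval_bump u v n \<in> borel_measurable borel" for u v n
      by (rule borel_measurable_continuous_onI[OF bump_fun_continuous[OF bump_fun_interval_bump]])
    have X: "?X \<in> sets (lborel_Rd d)" by (intro sets_PiM_I_finite) auto
    \<comment> \<open>Monotone convergence: the bump products increase to the indicator of the open
      box, under either measure.\<close>
    have lim: "(\<lambda>n. \<integral>\<^sup>+y. ennreal (?b n y) \<partial>M) \<longlonglongrightarrow> emeasure M ?X" if M[measurable_cong]: "sets M = sets (lborel_Rd d)" for M
    proof -
      have sp: "space M = Rd d" using sets_eq_imp_space_eq[OF M] by (simp add: space_PiM)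
      have "(\<lambda>n. \<integral>\<^sup>+y. ennreal (?b n y) \<partial>M) \<longlonglongrightarrow> (\<integral>\<^sup>+y. ennreal (\<Prod>k<d. indicator {a k<..<b k} (y k)) \<partial>M)"
      proof (rule nn_integral_LIMSEQ)
        show "incseq (\<lambda>n y. ennreal (?b n y))"
          by (intro incseq_SucI le_funI ennreal_leI prod_mono) (auto intro: interval_bump_bounds interval_bump_mono)
        show "(\<lambda>y. ennreal (?b n y)) \<in> borel_measurable M" for n by measurable
        show "(\<lambda>n. ennreal (?b n y)) \<longlonglongrightarrow> ennreal (\<Prod>k<d. indicator {a k<..<b k} (y k))" for y
          by (intro tendsto_ennrealI tendsto_prod interval_bump_tendsto ab) auto
      qed
      also have "(\<integral>\<^sup>+y. ennreal (\<Prod>k<d. indicator {a k<..<b k} (y k)) \<partial>M) = (\<integral>\<^sup>+y. indicator ?X y \<partial>M)"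
      proof (rule nn_integral_cong)
        fix y assume "y \<in> space M"
        then have y: "y \<in> Rd d" by (simp add: sp)
        show "ennreal (\<Prod>k<d. indicator {a k<..<b k} (y k)) = indicator ?X y"
        proof (cases "y \<in> ?X")
          case True
          then have "(\<Prod>k<d. indicator {a k<..<b k} (y k)) = (1::real)" by (intro prod.neutral) (auto simp: PiE_iff)
          then show ?thesis using True by simp
        next
          case False
          then obtain k where k: "k < d" "y k \<notin> {a k<..<b k}" using y by (auto simp: PiE_iff)
          then have "(\<Prod>k<d. indicator {a k<..<b k} (y k)) = (0::real)"
            by (intro prod_zero bexI[of _ k]) (simp_all only: indicator_simps finite_lessThan lessThan_iff not_False_eq_True)
          then show ?thesis using False by (simp only: indicator_simps ennreal_0 not_False_eq_True)
        qed
      qed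
      finally have "(\<lambda>n. \<integral>\<^sup>+y. ennreal (?b n y) \<partial>M) \<longlonglongrightarrow> (\<integral>\<^sup>+y. indicator ?X y \<partial>M)" .
      then show ?thesis using X M by simp
    qed
    have "(\<integral>\<^sup>+y. ennreal (?b n y) \<partial>?\<nu>) = (\<integral>\<^sup>+y. ennreal (?b n y) \<partial>?\<kappa>)" for n
      by (rule prods) (auto intro: bump_fun_interval_bump interval_bump_bounds)
    then have "(\<lambda>n. \<integral>\<^sup>+y. ennreal (?b n y) \<partial>?\<kappa>) \<longlonglongrightarrow> emeasure ?\<nu> ?X" using lim[of ?\<nu>] by simp
    moreover have "(\<lambda>n. \<integral>\<^sup>+y. ennreal (?b n y) \<partial>?\<kappa>) \<longlonglongrightarrow> emeasure ?\<kappa> ?X" by (rule lim) simp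
    ultimately show ?thesis by (rule LIMSEQ_unique)
  qed
  have "?\<nu> = ?\<kappa>"
  proof (rule measure_eqI_Rd[OF _ _ boxes])
    fix n :: nat
    have "emeasure ?\<nu> (\<Pi>\<^sub>E i\<in>{..<d}. {- real n<..<real n}) = emeasure ?\<kappa> (\<Pi>\<^sub>E i\<in>{..<d}. {- real n<..<real n})"
      by (rule boxes) auto
    also have "\<dots> = ennreal c * emeasure (lborel_Rd d) (\<Pi>\<^sub>E i\<in>{..<d}. {- real n<..<real n})"
      by (rule emeasure_density_const) (auto intro!: sets_PiM_I_finite)
    also have "\<dots> < \<infinity>"
      by (subst lebesgue_product.emeasure_PiM) (auto simp: ennreal_mult_less_top power_less_top_ennreal)
    finally show "emeasure ?\<nu> (\<Pi>\<^sub>E i\<in>{..<d}. {- real n<..<real n}) \<noteq> \<infinity>" by simp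
  qed auto
  then show ?thesis using that c0 by blast
qed

end

section \<open>Weighted Hardy inequality and differentiation under the integral\<close>

text \<open>With \<open>m = p + 1\<close>, integrate \<open>t\<^sup>p (t f' + m f / 2)\<^sup>2 \<ge> 0\<close>, whose cross term is a total derivative.\<close>

lemma weighted_hardy:
  fixes f f' :: "real \<Rightarrow> real"
  assumes df: "\<And>t. t > 0 \<Longrightarrow> (f has_field_derivative f' t) (at t)" and cf': "continuous_on {0<..} f'"
    and supp: "0 < t0" "t0 \<le> t1" "\<And>t. t > 0 \<Longrightarrow> t \<notin> {t0..t1} \<Longrightarrow> f t = 0"
    and e: "\<epsilon> > 0" "\<epsilon> \<le> \<bar>p + 1\<bar>"
  shows "(\<integral>\<^sup>+t. ennreal (t powr p * (f t)\<^sup>2) * indicator {t0..t1} t \<partial>lborel)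
    \<le> ennreal (4 / \<epsilon>\<^sup>2) * (\<integral>\<^sup>+t. ennreal (t powr (p + 2) * (f' t)\<^sup>2) * indicator {t0..t1} t \<partial>lborel)"
proof -
  define m where "m = p + 1"
  have m: "\<epsilon>\<^sup>2 \<le> m\<^sup>2" using power_mono[OF e(2), of 2] e by (simp add: m_def)
  have cf: "continuous_on {0<..} f"
    by (rule DERIV_continuous_on) (use df has_field_derivative_at_within in blast)
  \<comment> \<open>Each endpoint is a limit of positive times outside the interval, where
    \<open>f\<close> vanishes, so by continuity the integrated total derivative has no boundary
    terms.\<close>
  have edge: "f t0 = 0" "f t1 = 0"
  proof -
    have van: "f s = 0" if s: "s > 0" "\<And>\<delta>. \<delta> > 0 \<Longrightarrow> \<exists>t>0. \<bar>t - s\<bar> < \<delta> \<and> t \<notin> {t0..t1}" for s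
    proof (rule ccontr)
      assume "f s \<noteq> 0"
      have "isCont f s" using df[OF s(1)] by (rule DERIV_isCont)
      then obtain \<delta> where \<delta>: "\<delta> > 0" "\<And>t. \<bar>t - s\<bar> < \<delta> \<Longrightarrow> \<bar>f t - f s\<bar> < \<bar>f s\<bar>"
        using \<open>f s \<noteq> 0\<close> unfolding continuous_at_eps_delta dist_real_def by (metis zero_less_abs_iff)
      obtain t where "t > 0" "\<bar>t - s\<bar> < \<delta>" "t \<notin> {t0..t1}" using s(2)[OF \<delta>(1)] by blast
      then show False using \<delta>(2)[of t] supp(3)[of t] by simp
    qed
    show "f t0 = 0"
    proof (rule van)
      show "\<exists>t>0. \<bar>t - t0\<bar> < \<delta> \<and> t \<notin> {t0..t1}" if "\<delta> > 0" for \<delta>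
        using that supp(1) by (intro exI[of _ "t0 - min \<delta> t0 / 2"]) (auto simp: min_def field_simps)
    qed (use supp in simp)
    show "f t1 = 0"
    proof (rule van)
      show "\<exists>t>0. \<bar>t - t1\<bar> < \<delta> \<and> t \<notin> {t0..t1}" if "\<delta> > 0" for \<delta>
        using that supp by (intro exI[of _ "t1 + \<delta> / 2"]) auto
    qed (use supp in simp)
  qed
  have sub: "{t0..t1} \<subseteq> {0<..}" using supp by auto
  have cpow: "continuous_on {t0..t1} (\<lambda>t. t powr q)" for q using supp by (intro continuous_intros) auto
  note cf1 = continuous_on_subset[OF cf sub] and cf2 = continuous_on_subset[OF cf' sub]
  let ?A = "\<lambda>t. t powr p * (f t)\<^sup>2" and ?B = "\<lambda>t. t powr (p + 2) * (f' t)\<^sup>2"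
  let ?F' = "\<lambda>t. m * t powr p * (f t)\<^sup>2 + 2 * (t powr m * f t * f' t)"
  have cA: "continuous_on {t0..t1} ?A" and cB: "continuous_on {t0..t1} ?B" and cF: "continuous_on {t0..t1} ?F'"
    by (intro continuous_intros cpow cf1 cf2; use supp in auto)+
  have iA: "integrable lborel (\<lambda>t. indicator {t0..t1} t *\<^sub>R ?A t)" and iB: "integrable lborel (\<lambda>t. indicator {t0..t1} t *\<^sub>R ?B t)"
    and iF: "integrable lborel (\<lambda>t. indicator {t0..t1} t *\<^sub>R ?F' t)"
    using borel_integrable_atLeastAtMost'[OF cA] borel_integrable_atLeastAtMost'[OF cB] borel_integrable_atLeastAtMost'[OF cF]
    by (simp_all add: set_integrable_def)
  have "(LINT t|lborel. indicator {t0..t1} t *\<^sub>R ?F' t) = t1 powr m * (f t1)\<^sup>2 - t0 powr m * (f t0)\<^sup>2"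
  proof (rule integral_FTC_atLeastAtMost[OF supp(2) _ cF])
    fix t assume t: "t0 \<le> t" "t \<le> t1"
    then have "t > 0" using supp by simp
    have "((\<lambda>t. t powr m * (f t)\<^sup>2) has_field_derivative ?F' t) (at t)"
      using \<open>t > 0\<close> by (auto intro!: derivative_eq_intros df simp: m_def)
    then show "((\<lambda>t. t powr m * (f t)\<^sup>2) has_vector_derivative ?F' t) (at t within {t0..t1})"
      by (simp add: has_real_derivative_iff_has_vector_derivative has_vector_derivative_at_within)
  qed
  then have F0: "(LINT t|lborel. indicator {t0..t1} t *\<^sub>R ?F' t) = 0" by (simp add: edge)
  have "0 \<le> (LINT t|lborel. indicator {t0..t1} t *\<^sub>R ?B t - (m\<^sup>2 / 4) * (indicator {t0..t1} t *\<^sub>R ?A t) + (m / 2) * (indicator {t0..t1} t *\<^sub>R ?F' t))"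
  proof (intro Bochner_Integration.integral_nonneg)
    fix t :: real
    show "0 \<le> indicator {t0..t1} t *\<^sub>R ?B t - (m\<^sup>2 / 4) * (indicator {t0..t1} t *\<^sub>R ?A t) + (m / 2) * (indicator {t0..t1} t *\<^sub>R ?F' t)"
    proof (cases "t \<in> {t0..t1}")
      case True
      then have "t > 0" using supp by simp
      have pw: "t powr (p + 2) = t powr p * t\<^sup>2" "t powr m = t powr p * t"
        using \<open>t > 0\<close> by (simp_all add: powr_add m_def)
      have "0 \<le> t powr p * (t * f' t + (m / 2) * f t)\<^sup>2" by simp
      \<comment> \<open>Expanding the square gives \<open>?A\<close> the coefficient m^2 / 4 with a
        plus sign. Writing the cross term through the total derivative \<open>?F'\<close> takes away
        m^2 / 2 and so reverses the sign.\<close>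
      also have "\<dots> = ?B t - (m\<^sup>2 / 4) * ?A t + (m / 2) * ?F' t"
        unfolding pw by (simp add: power2_eq_square algebra_simps)
      finally show ?thesis using True by simp
    qed simp
  qed
  also have "\<dots> = (LINT t|lborel. indicator {t0..t1} t *\<^sub>R ?B t) - (m\<^sup>2 / 4) * (LINT t|lborel. indicator {t0..t1} t *\<^sub>R ?A t)"
  proof -
    have lin: "(LINT t|lborel. b t - k * a t + l * c t) = (LINT t|lborel. b t) - k * (LINT t|lborel. a t)"
      if "integrable lborel a" "integrable lborel b" "integrable lborel c" "(LINT t|lborel. c t) = 0"
      for a b c :: "real \<Rightarrow> real" and k l
      using that by simp
    show ?thesis by (rule lin[OF iA iB iF F0])
  qed
  finally have 1: "(m\<^sup>2 / 4) * (LINT t|lborel. indicator {t0..t1} t *\<^sub>R ?A t) \<le> (LINT t|lborel. indicator {t0..t1} t *\<^sub>R ?B t)" by simp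
  have A0: "0 \<le> (LINT t|lborel. indicator {t0..t1} t *\<^sub>R ?A t)" by (intro Bochner_Integration.integral_nonneg) simp
  have "(\<epsilon>\<^sup>2 / 4) * (LINT t|lborel. indicator {t0..t1} t *\<^sub>R ?A t) \<le> (m\<^sup>2 / 4) * (LINT t|lborel. indicator {t0..t1} t *\<^sub>R ?A t)"
    using m A0 by (intro mult_right_mono) auto
  with 1 have 2: "(LINT t|lborel. indicator {t0..t1} t *\<^sub>R ?A t) \<le> (4 / \<epsilon>\<^sup>2) * (LINT t|lborel. indicator {t0..t1} t *\<^sub>R ?B t)"
    using e(1) by (simp add: field_simps)
  have nn: "(\<integral>\<^sup>+t. ennreal (C t) * indicator {t0..t1} t \<partial>lborel) = ennreal (LINT t|lborel. indicator {t0..t1} t *\<^sub>R C t)"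
    if "integrable lborel (\<lambda>t. indicator {t0..t1} t *\<^sub>R C t)" "\<And>t. C t \<ge> 0" for C :: "real \<Rightarrow> real"
    using that by (subst nn_integral_eq_integral[symmetric]) (auto intro!: nn_integral_cong simp: indicator_def)
  have nA: "\<And>t. ?A t \<ge> 0" and nB: "\<And>t. ?B t \<ge> 0" by simp_all
  show ?thesis
    unfolding nn[OF iA nA] nn[OF iB nB] using ennreal_leI[OF 2]
    by (subst ennreal_mult'[symmetric]) simp_all
qed

section \<open>Integrals over space with a time parameter\<close>

lemma bounded_on_cube_interval:
  fixes f :: "(nat \<Rightarrow> real) \<Rightarrow> real \<Rightarrow> real"
  assumes f: "continuous_on (Rd d \<times> {0<..}) (\<lambda>(x, t). f x t)" and ab: "0 < a"
  obtains B where "B \<ge> 0" "\<And>x t. x \<in> cube d R \<Longrightarrow> t \<in> {a..b} \<Longrightarrow> \<bar>f x t\<bar> \<le> B"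
proof -
  let ?K = "cube d R \<times> {a..b}"
  have sub: "?K \<subseteq> Rd d \<times> {0<..}" using ab cube_subset by fastforce
  have "compact ((\<lambda>(x, t). f x t) ` ?K)"
    by (intro compact_continuous_image continuous_on_subset[OF f sub] compact_Times compact_cube compact_Icc)
  then obtain B where B: "\<And>y. y \<in> (\<lambda>(x, t). f x t) ` ?K \<Longrightarrow> \<bar>y\<bar> \<le> B"
    using compact_imp_bounded by (metis bounded_real)
  have "\<bar>f x t\<bar> \<le> max 0 B" if "x \<in> cube d R" "t \<in> {a..b}" for x t
    using B[of "f x t"] that by force
  then show ?thesis by (intro that[of "max 0 B"]) auto
qed

lemma dominated_on_cube:
  fixes F :: "nat \<Rightarrow> (nat \<Rightarrow> real) \<Rightarrow> real"
  assumes F: "\<And>n. continuous_on (Rd d) (F n)" "\<And>n. vanishes_off d R (F n)" and G: "continuous_on (Rd d) G"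
    and bd: "\<And>n x. x \<in> cube d R \<Longrightarrow> \<bar>F n x\<bar> \<le> B" and lim: "\<And>x. x \<in> Rd d \<Longrightarrow> (\<lambda>n. F n x) \<longlonglongrightarrow> G x"
  shows "(\<lambda>n. LINT x|lborel_Rd d. F n x) \<longlonglongrightarrow> (LINT x|lborel_Rd d. G x)"
proof (rule integral_dominated_convergence)
  show "integrable (lborel_Rd d) (\<lambda>x. B * indicator (cube d R) x)"
    using emeasure_cube cube_measurable by (intro integrable_mult_right integrable_real_indicator) auto
  show "G \<in> borel_measurable (lborel_Rd d)" "F n \<in> borel_measurable (lborel_Rd d)" for n
    by (intro borel_measurable_continuous_Rd G F)+
  show "AE x in lborel_Rd d. (\<lambda>n. F n x) \<longlonglongrightarrow> G x"
    by (rule AE_I2) (simp add: space_PiM lim)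
  show "AE x in lborel_Rd d. norm (F n x) \<le> B * indicator (cube d R) x" for n
  proof (rule AE_I2)
    fix x assume "x \<in> space (lborel_Rd d)"
    then have "x \<in> Rd d" by (simp add: space_PiM)
    then show "norm (F n x) \<le> B * indicator (cube d R) x"
      using bd[of x n] F(2)[of n] unfolding vanishes_off_def by (cases "x \<in> cube d R") auto
  qed
qed

lemma continuous_on_slice:
  assumes "continuous_on (A \<times> T) (\<lambda>(x, t). f x t)" "t \<in> T"
  shows "continuous_on A (\<lambda>x. f x t)"
proof -
  have "continuous_on A (\<lambda>x. (\<lambda>(x, t). f x t) (x, t))"
    by (rule continuous_on_compose2[OF assms(1)]) (use assms(2) in \<open>auto intro!: continuous_intros\<close>)
  then show ?thesis by simp
qed

lemma continuous_on_slice_time: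
  assumes "continuous_on (A \<times> T) (\<lambda>(x, t). f x t)" "x \<in> A"
  shows "continuous_on T (\<lambda>t. f x t)"
proof -
  have "continuous_on T (\<lambda>t. (\<lambda>(x, t). f x t) (x, t))"
    by (rule continuous_on_compose2[OF assms(1)]) (use assms(2) in \<open>auto intro!: continuous_intros\<close>)
  then show ?thesis by simp
qed

text \<open>Only sequences within a fixed distance of t need to be tested, so one dominating
  constant serves all their terms.\<close>

lemma tendsto_at_from_close_sequences:
  fixes F :: "real \<Rightarrow> real"
  assumes e: "e > 0" and seq: "\<And>X. (\<And>n. \<bar>X n - t\<bar> \<le> e) \<Longrightarrow> (\<And>n. X n \<noteq> t) \<Longrightarrow> X \<longlonglongrightarrow> t \<Longrightarrow> (\<lambda>n. F (X n)) \<longlonglongrightarrow> L"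
  shows "(F \<longlongrightarrow> L) (at t)"
  unfolding tendsto_at_iff_sequentially
proof (intro allI impI)
  fix X :: "nat \<Rightarrow> real" assume X: "\<forall>i. X i \<in> UNIV - {t}" "X \<longlonglongrightarrow> t"
  obtain N where N: "\<And>n. n \<ge> N \<Longrightarrow> \<bar>X n - t\<bar> < e" using LIMSEQ_D[OF X(2) e] by auto
  have "(\<lambda>n. F (X (n + N))) \<longlonglongrightarrow> L"
    by (rule seq) (use X N in \<open>auto intro: less_imp_le LIMSEQ_ignore_initial_segment\<close>)
  then show "(F \<circ> X) \<longlonglongrightarrow> L" unfolding comp_def by (rule LIMSEQ_offset)
qed

lemma near_half:
  fixes s t :: real
  assumes "t > 0" "\<bar>s - t\<bar> \<le> t / 2"
  shows "s > 0" "s \<in> {t/2..2*t}"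
  using assms unfolding atLeastAtMost_iff by arith+

lemma continuous_integral_Rd:
  fixes f' :: "(nat \<Rightarrow> real) \<Rightarrow> real \<Rightarrow> real"
  assumes van: "\<And>t. t > 0 \<Longrightarrow> vanishes_off d R (\<lambda>x. f' x t)"
    and f': "continuous_on (Rd d \<times> {0<..}) (\<lambda>(x, t). f' x t)"
  shows "continuous_on {0<..} (\<lambda>t. LINT x|lborel_Rd d. f' x t)"
proof (subst continuous_on_eq_continuous_at, simp, intro ballI)
  fix t :: real assume "t \<in> {0<..}"
  then have t: "t > 0" by simp
  show "isCont (\<lambda>t. LINT x|lborel_Rd d. f' x t) t"
    unfolding isCont_def
  proof (rule tendsto_at_from_close_sequences[of "t/2"])
    fix X :: "nat \<Rightarrow> real" assume X: "\<And>n. \<bar>X n - t\<bar> \<le> t / 2" "\<And>n. X n \<noteq> t" "X \<longlonglongrightarrow> t"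
    obtain B where B: "B \<ge> 0" "\<And>x s. x \<in> cube d R \<Longrightarrow> s \<in> {t/2..2*t} \<Longrightarrow> \<bar>f' x s\<bar> \<le> B"
      using bounded_on_cube_interval[OF f', of "t/2" R "2*t"] t by auto
    show "(\<lambda>n. LINT x|lborel_Rd d. f' x (X n)) \<longlonglongrightarrow> (LINT x|lborel_Rd d. f' x t)"
    proof (rule dominated_on_cube[where R = R and B = B])
      fix n
      have Xn: "X n > 0" using near_half(1)[OF t X(1)] .
      show "continuous_on (Rd d) (\<lambda>x. f' x (X n))" by (rule continuous_on_slice[OF f']) (use Xn in simp)
      show "vanishes_off d R (\<lambda>x. f' x (X n))" by (rule van[OF Xn])
      show "\<bar>f' x (X n)\<bar> \<le> B" if "x \<in> cube d R" for x by (rule B(2)[OF that near_half(2)[OF t X(1)]])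
    next
      show "continuous_on (Rd d) (\<lambda>x. f' x t)" by (rule continuous_on_slice[OF f']) (use t in simp)
      fix x assume x: "x \<in> Rd d"
      have "continuous_on {0<..} (\<lambda>t. f' x t)" by (rule continuous_on_slice_time[OF f' x])
      then have "isCont (\<lambda>t. f' x t) t" using t by (simp add: continuous_on_eq_continuous_at)
      then show "(\<lambda>n. f' x (X n)) \<longlonglongrightarrow> f' x t" using X(3) by (rule isCont_tendsto_compose)
    qed
  qed (use t in simp)
qed

text \<open>By the mean value theorem, all difference quotients near t are bounded by a bound of
  \<open>f'\<close> on the cube times {t/2..2*t}, and the cube has finite measure.\<close>

theorem derivative_integral_Rd:
  assumes f: "\<And>t. t > 0 \<Longrightarrow> continuous_on (Rd d) (\<lambda>x. f x t)" "\<And>t. t > 0 \<Longrightarrow> vanishes_off d R (\<lambda>x. f x t)"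
    and df: "\<And>x t. x \<in> Rd d \<Longrightarrow> t > 0 \<Longrightarrow> ((\<lambda>t. f x t) has_field_derivative f' x t) (at t)"
    and f': "continuous_on (Rd d \<times> {0<..}) (\<lambda>(x, t). f' x t)"
  shows "t > 0 \<Longrightarrow> ((\<lambda>t. LINT x|lborel_Rd d. f x t) has_field_derivative (LINT x|lborel_Rd d. f' x t)) (at t)"
    "continuous_on {0<..} (\<lambda>t. LINT x|lborel_Rd d. f' x t)"
proof -
  have van: "vanishes_off d R (\<lambda>x. f' x t)" if "t > 0" for t
    unfolding vanishes_off_def
  proof (intro ballI impI)
    fix x assume x: "x \<in> Rd d" "x \<notin> cube d R"
    have "((\<lambda>t. 0) has_field_derivative f' x t) (at t)"
      by (rule has_field_derivative_transform_within_open[OF df[OF x(1) that], of "{0<..}"])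
        (use x f(2) that in \<open>auto simp: vanishes_off_def\<close>)
    from DERIV_unique[OF this DERIV_const] show "f' x t = 0" .
  qed
  have int: "integrable (lborel_Rd d) (\<lambda>x. f x t)" if "t > 0" for t
    by (rule integrable_vanishes_off[OF f(1)[OF that] f(2)[OF that]])
  note near = near_half
  show "((\<lambda>t. LINT x|lborel_Rd d. f x t) has_field_derivative (LINT x|lborel_Rd d. f' x t)) (at t)" if t: "t > 0" for t
    unfolding has_field_derivative_iff
  proof (rule tendsto_at_from_close_sequences[of "t/2"])
    fix X :: "nat \<Rightarrow> real" assume X: "\<And>n. \<bar>X n - t\<bar> \<le> t / 2" "\<And>n. X n \<noteq> t" "X \<longlonglongrightarrow> t"
    obtain B where B: "B \<ge> 0" "\<And>x s. x \<in> cube d R \<Longrightarrow> s \<in> {t/2..2*t} \<Longrightarrow> \<bar>f' x s\<bar> \<le> B"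
      using bounded_on_cube_interval[OF f', of "t/2" R "2*t"] t by auto
    have "(\<lambda>n. LINT x|lborel_Rd d. (f x (X n) - f x t) / (X n - t)) \<longlonglongrightarrow> (LINT x|lborel_Rd d. f' x t)"
    proof (rule dominated_on_cube[where R = R and B = B])
      fix n
      have Xn: "X n > 0" using near(1)[OF t X(1)] .
      show "continuous_on (Rd d) (\<lambda>x. (f x (X n) - f x t) / (X n - t))"
        using X(2)[of n] by (intro continuous_intros f Xn t) auto
      show "vanishes_off d R (\<lambda>x. (f x (X n) - f x t) / (X n - t))"
        using f(2)[OF Xn] f(2)[OF t] by (auto simp: vanishes_off_def)
      fix x assume x: "x \<in> cube d R"
      then have xR: "x \<in> Rd d" using cube_subset by blast
      show "\<bar>(f x (X n) - f x t) / (X n - t)\<bar> \<le> B"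
      proof -
        have "norm (f x (X n) - f x t) \<le> B * norm (X n - t)"
        proof (rule field_differentiable_bound[where S = "{t/2..2*t}"])
          show "convex {t/2..2*t}" by simp
          show "X n \<in> {t/2..2*t}" by (rule near(2)[OF t X(1)])
          show "t \<in> {t/2..2*t}" using t by simp
          show "((\<lambda>t. f x t) has_field_derivative f' x s) (at s within {t/2..2*t})" if "s \<in> {t/2..2*t}" for s
          proof -
            have "s > 0" using that t by simp
            then show ?thesis by (rule has_field_derivative_at_within[OF df[OF xR]])
          qed
          show "norm (f' x s) \<le> B" if "s \<in> {t/2..2*t}" for s using B(2)[OF x that] by simp
        qed
        then show ?thesis using X(2)[of n] by (simp add: field_simps)
      qed
    next
      show "continuous_on (Rd d) (\<lambda>x. f' x t)" by (rule continuous_on_slice[OF f']) (use t in simp)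
      fix x assume x: "x \<in> Rd d"
      have "((\<lambda>s. (f x s - f x t) / (s - t)) \<longlongrightarrow> f' x t) (at t)"
        using df[OF x t] by (simp add: has_field_derivative_iff)
      then show "(\<lambda>n. (f x (X n) - f x t) / (X n - t)) \<longlonglongrightarrow> f' x t"
        unfolding tendsto_at_iff_sequentially comp_def using X by auto
    qed
    moreover have "(LINT x|lborel_Rd d. (f x (X n) - f x t) / (X n - t))
      = ((LINT x|lborel_Rd d. f x (X n)) - (LINT x|lborel_Rd d. f x t)) / (X n - t)" for n
      using int[OF near(1)[OF t X(1)]] int[OF t] by simp
    ultimately show "(\<lambda>n. ((LINT x|lborel_Rd d. f x (X n)) - (LINT x|lborel_Rd d. f x t)) / (X n - t)) \<longlonglongrightarrow> (LINT x|lborel_Rd d. f' x t)"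
      by (simp only:)
  qed (use t in simp)
  show "continuous_on {0<..} (\<lambda>t. LINT x|lborel_Rd d. f' x t)" by (rule continuous_integral_Rd[OF van f'])
qed

section \<open>Transported heat kernel modes\<close>

context oriented_diffeo
begin

text \<open>Written with exp and ln so that the smoothness lemmas for these apply, and so that it is
  positive at every x, also off \<open>Rd d\<close>.\<close>

definition sqrt_jac :: "(nat \<Rightarrow> real) \<Rightarrow> real" where
  "sqrt_jac x = exp (ln (jac x) / 2)"

text \<open>In y = h x one has \<eta>^(1/2) u dx = w dy with w = \<eta>^(-1/2) u, so pairing
  \<open>u\<close> with a mode pairs w with a derivative of the heat kernel. Its variance
  \<open>2 * t\<close> matches the weight exp(-|y|^2 / (4 t)).\<close>

definition mode :: "(nat \<Rightarrow> nat) \<Rightarrow> real \<Rightarrow> (nat \<Rightarrow> real) \<Rightarrow> real" where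
  "mode a t x = sqrt_jac x * (\<Prod>i<d. heat_kernel (a i) (2 * t) (h x i))"

lemma sqrt_jac_pos: "sqrt_jac x > 0"
  by (simp add: sqrt_jac_def)

lemma sqrt_jac_square: "x \<in> Rd d \<Longrightarrow> sqrt_jac x * sqrt_jac x = jac x"
  using jac_pos by (simp add: sqrt_jac_def exp_add[symmetric])

lemma C_ln_jac: "C_class d 2 (\<lambda>x. ln (jac x))"
  by (intro C_class_ln C_jac jac_pos)

lemma C_sqrt_jac: "C_class d 2 sqrt_jac"
proof -
  have "C_class d 2 (\<lambda>x. exp ((1/2) * ln (jac x)))"
    by (intro C_class_exp C_class_mult C_class_const C_ln_jac)
  then show ?thesis by (simp add: sqrt_jac_def[abs_def])
qed

text \<open>The weights \<open>m\<close> depend on neither t nor \<open>p\<close>; the power of t is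
  explicit. Hermite and heat kernel coefficients differ by \<open>scale\<close>, equal to (2 t)^(|a|
  + d/2); it enters squared, and the squared norm of the Hermite polynomial cancels one of the two
  factors.\<close>

lemma transported_parseval:
  obtains m where "\<And>a. m a \<ge> (0::real)"
    "\<And>p R t. continuous_on (Rd d) p \<Longrightarrow> vanishes_off d R p \<Longrightarrow> t > 0 \<Longrightarrow>
      (\<integral>\<^sup>+x. ennreal ((p x)\<^sup>2 * exp (- (\<Sum>i<d. (h x i)\<^sup>2) / (4 * t))) \<partial>lborel_Rd d)
      = (\<integral>\<^sup>+a. ennreal (m a * t powr ((\<Sum>i<d. real (a i)) + real d / 2) * (LINT x|lborel_Rd d. p x * mode a t x)\<^sup>2)
          \<partial>(\<Pi>\<^sub>M i\<in>{..<d}. count_space UNIV))"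
proof -
  obtain c where c0: "c \<ge> 0" and
    distr: "distr (density (lborel_Rd d) (\<lambda>x. ennreal (jac x))) (lborel_Rd d) h = density (lborel_Rd d) (\<lambda>x. ennreal c)"
    by (rule distr_jac_density)
  have jac_nn: "AE x in lborel_Rd d. 0 \<le> jac x"
    by (rule AE_I2) (simp add: space_PiM jac_pos less_imp_le)
  have nnint: "(\<integral>\<^sup>+x. ennreal (jac x) * F (h x) \<partial>lborel_Rd d) = ennreal c * (\<integral>\<^sup>+y. F y \<partial>lborel_Rd d)"
    if F: "F \<in> borel_measurable (lborel_Rd d)" for F
  proof -
    have "(\<integral>\<^sup>+x. ennreal (jac x) * F (h x) \<partial>lborel_Rd d)
      = (\<integral>\<^sup>+y. F y \<partial>distr (density (lborel_Rd d) (\<lambda>x. ennreal (jac x))) (lborel_Rd d) h)"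
      using measurable_compose[OF measurable_h F] measurable_compose[OF measurable_jac measurable_ennreal]
      by (subst nn_integral_distr) (simp_all add: F nn_integral_density measurable_h measurable_jac measurable_ennreal)
    also have "\<dots> = (\<integral>\<^sup>+y. ennreal c * F y \<partial>lborel_Rd d)"
      unfolding distr by (rule nn_integral_density) (simp_all add: F)
    also have "\<dots> = ennreal c * (\<integral>\<^sup>+y. F y \<partial>lborel_Rd d)" by (rule nn_integral_cmult[OF F])
    finally show ?thesis .
  qed
  have int: "(LINT x|lborel_Rd d. jac x * f (h x)) = c * (LINT y|lborel_Rd d. f y)"
    if f: "f \<in> borel_measurable (lborel_Rd d)" for f :: "(nat \<Rightarrow> real) \<Rightarrow> real"
  proof -
    have "(LINT x|lborel_Rd d. jac x * f (h x))
      = (LINT y|distr (density (lborel_Rd d) (\<lambda>x. ennreal (jac x))) (lborel_Rd d) h. f y)"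
      using measurable_compose[OF measurable_h f]
      by (subst integral_distr) (simp_all add: f integral_density jac_nn measurable_h measurable_jac)
    also have "\<dots> = (LINT y|lborel_Rd d. c *\<^sub>R f y)"
      unfolding distr by (rule integral_density) (simp_all add: f c0)
    finally show ?thesis by simp
  qed
  \<comment> \<open>If c = 0, then 1 / c = 0 makes all weights vanish, in agreement with the left
    side, which carries a factor c.\<close>
  define m where "m a = (1 / c) * (2 powr ((\<Sum>i<d. real (a i)) + real d / 2) / (\<Prod>i<d. fact (a i) * sqrt (2 * pi)))" for a
  show ?thesis
  proof (rule that[of m])
    show "m a \<ge> 0" for a unfolding m_def using c0
      by (intro mult_nonneg_nonneg divide_nonneg_nonneg prod_nonneg) auto
    fix p R and t :: real
    assume p: "continuous_on (Rd d) p" "vanishes_off d R p" and t: "t > 0"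
    define \<sigma> where "\<sigma> = 2 * t"
    have \<sigma>: "\<sigma> > 0" using t by (simp add: \<sigma>_def)
    define w where "w y = p (g y) / sqrt_jac (g y)" for y
    have cg: "continuous_on (Rd d) (\<lambda>y. f (g y))" if "continuous_on (Rd d) f" for f :: "(nat \<Rightarrow> real) \<Rightarrow> real"
    proof -
      have "C_class d 0 (\<lambda>y. f (g y))"
        by (rule C_class_compose_Rd[of d 0 f d g]) (simp_all add: that C_class_continuous[OF C_g])
      then show ?thesis by simp
    qed
    have sj0: "sqrt_jac x \<noteq> 0" for x using sqrt_jac_pos[of x] by simp
    have cw: "continuous_on (Rd d) w"
      unfolding w_def
      by (intro continuous_on_divide cg p C_class_continuous[OF C_sqrt_jac]) (simp add: sj0)
    have quot: "continuous_on (Rd d) (\<lambda>x. p x / sqrt_jac x)"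
      by (intro continuous_on_divide p C_class_continuous[OF C_sqrt_jac]) (simp add: sj0)
    have sw: "sep_cont {..<d} w"
      unfolding sep_cont_def
    proof (intro conjI ballI)
      show "w \<in> borel_measurable (lborel_Rd d)" by (rule borel_measurable_continuous_Rd[OF cw])
      obtain B where B: "B \<ge> 0" "\<And>x. x \<in> cube d R \<Longrightarrow> \<bar>p x / sqrt_jac x\<bar> \<le> B" using bounded_on_cube[OF quot] by blast
      have "\<bar>w y\<bar> \<le> B" if "y \<in> Rd d" for y
        using B p(2) g_Rd[OF that] unfolding vanishes_off_def w_def by (cases "g y \<in> cube d R") auto
      then show "\<exists>B. \<forall>x\<in>Rd d. \<bar>w x\<bar> \<le> B" by blast
      show "continuous_on UNIV (\<lambda>s. w (x(i := s)))" if "x \<in> Rd d" "i \<in> {..<d}" for x i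
        using continuous_on_update_Rd[OF cw that(1)] that(2) by simp
    qed
    have [measurable]: "w \<in> borel_measurable (lborel_Rd d)" using sw by (simp add: sep_cont_def)
    have gm[measurable]: "gwt \<sigma> \<in> borel_measurable borel"
      by (rule borel_measurable_continuous_onI[OF continuous_gwt[OF \<sigma>]])
    have hm[measurable]: "hermite \<sigma> k \<in> borel_measurable borel" for k
      by (rule borel_measurable_continuous_onI[OF exp_growth_contD[OF exp_growth_hermite]])
    have wh: "w (h x) = p x / sqrt_jac x" if "x \<in> Rd d" for x using that by (simp add: w_def)
    have gauss: "(\<Prod>i<d. gwt \<sigma> (h x i)) = exp (- (\<Sum>i<d. (h x i)\<^sup>2) / (4 * t))" for x
      by (simp add: gwt_def \<sigma>_def exp_sum[symmetric] sum_divide_distrib sum_negf)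
    define I where "I a = (LINT y|lborel_Rd d. w y * (\<Prod>i<d. hermite \<sigma> (a i) (y i) * gwt \<sigma> (y i)))" for a
    define b where "b a = (LINT x|lborel_Rd d. p x * mode a t x)" for a
    define scale where "scale a = (\<Prod>i<d. \<sigma> ^ a i * sqrt \<sigma>)" for a :: "nat \<Rightarrow> nat"
    have cI: "c * I a = scale a * b a" for a
    proof -
      have "c * I a = (LINT x|lborel_Rd d. jac x * (w (h x) * (\<Prod>i<d. hermite \<sigma> (a i) (h x i) * gwt \<sigma> (h x i))))"
        unfolding I_def by (rule int[symmetric]) measurable
      also have "\<dots> = (LINT x|lborel_Rd d. scale a * (p x * mode a t x))"
      proof (rule Bochner_Integration.integral_cong[OF refl])
        fix x assume "x \<in> space (lborel_Rd d)"
        then have x: "x \<in> Rd d" by (simp add: space_PiM)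
        have "(\<Prod>i<d. hermite \<sigma> (a i) (h x i) * gwt \<sigma> (h x i)) = (\<Prod>i<d. (\<sigma> ^ a i * sqrt \<sigma>) * heat_kernel (a i) \<sigma> (h x i))"
          using \<sigma> by (intro prod.cong) (simp_all add: heat_kernel_eq)
        also have "\<dots> = scale a * (\<Prod>i<d. heat_kernel (a i) \<sigma> (h x i))" by (simp add: scale_def prod.distrib)
        finally have 1: "(\<Prod>i<d. hermite \<sigma> (a i) (h x i) * gwt \<sigma> (h x i)) = scale a * (\<Prod>i<d. heat_kernel (a i) \<sigma> (h x i))" .
        have "jac x * (p x / sqrt_jac x) = p x * sqrt_jac x"
          using sqrt_jac_square[OF x] sqrt_jac_pos[of x] by (simp add: field_simps)
        then have "(jac x * (p x / sqrt_jac x)) * y = (p x * sqrt_jac x) * y" for y by simp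
        then show "jac x * (w (h x) * (\<Prod>i<d. hermite \<sigma> (a i) (h x i) * gwt \<sigma> (h x i))) = scale a * (p x * mode a t x)"
          unfolding wh[OF x] 1 mode_def \<sigma>_def[symmetric] by (simp only: mult.assoc mult.left_commute)
      qed
      finally show ?thesis by (simp add: b_def)
    qed
    have coeff: "c * ((I a)\<^sup>2 / (\<Prod>i<d. hermite_norm \<sigma> (a i))) = m a * t powr ((\<Sum>i<d. real (a i)) + real d / 2) * (b a)\<^sup>2" for a
    proof (cases "c = 0")
      case False
      have np: "(\<Prod>i<d. hermite_norm \<sigma> (a i)) > 0" using hermite_norm_pos[OF \<sigma>] by (intro prod_pos) auto
      have "(scale a)\<^sup>2 = (\<Prod>i<d. hermite_norm \<sigma> (a i) * ((\<sigma> ^ a i * sqrt \<sigma>) / (fact (a i) * sqrt (2 * pi))))"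
        unfolding scale_def prod_power_distrib
        using \<sigma> by (intro prod.cong) (simp_all add: hermite_norm_def[OF \<sigma>] power2_eq_square real_sqrt_mult)
      also have "\<dots> = (\<Prod>i<d. hermite_norm \<sigma> (a i)) * (scale a / (\<Prod>i<d. fact (a i) * sqrt (2 * pi)))"
        by (simp only: prod.distrib prod_dividef scale_def)
      finally have scale2: "(scale a)\<^sup>2 / (\<Prod>i<d. hermite_norm \<sigma> (a i)) = scale a / (\<Prod>i<d. fact (a i) * sqrt (2 * pi))"
        using np by (metis nonzero_mult_div_cancel_left less_irrefl)
      have "scale a = (\<Prod>i<d. \<sigma> powr (real (a i) + 1 / 2))"
        unfolding scale_def using \<sigma> by (intro prod.cong) (simp_all add: powr_add powr_realpow powr_half_sqrt)
      also have "\<dots> = \<sigma> powr (\<Sum>i<d. real (a i) + 1 / 2)" using \<sigma> by (simp add: powr_sum)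
      also have "(\<Sum>i<d. real (a i) + 1 / 2) = (\<Sum>i<d. real (a i)) + real d / 2" by (simp add: sum.distrib)
      finally have scalep: "scale a = 2 powr ((\<Sum>i<d. real (a i)) + real d / 2) * t powr ((\<Sum>i<d. real (a i)) + real d / 2)"
        using t by (simp add: \<sigma>_def powr_mult)
      have Ia: "I a = scale a * b a / c" using cI[of a] False by (simp add: field_simps)
      have "c * ((I a)\<^sup>2 / (\<Prod>i<d. hermite_norm \<sigma> (a i))) = (1 / c) * ((scale a)\<^sup>2 / (\<Prod>i<d. hermite_norm \<sigma> (a i))) * (b a)\<^sup>2"
        unfolding Ia using False by (simp add: power2_eq_square)
      also have "\<dots> = m a * t powr ((\<Sum>i<d. real (a i)) + real d / 2) * (b a)\<^sup>2"
        unfolding scale2 unfolding scalep m_def by simp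
      finally show ?thesis .
    qed (simp add: m_def)
    have "(\<integral>\<^sup>+x. ennreal ((p x)\<^sup>2 * exp (- (\<Sum>i<d. (h x i)\<^sup>2) / (4 * t))) \<partial>lborel_Rd d)
      = (\<integral>\<^sup>+x. ennreal (jac x) * ennreal ((w (h x))\<^sup>2 * (\<Prod>i<d. gwt \<sigma> (h x i))) \<partial>lborel_Rd d)"
    proof (rule nn_integral_cong)
      fix x assume "x \<in> space (lborel_Rd d)"
      then have x: "x \<in> Rd d" by (simp add: space_PiM)
      have "jac x * (p x / sqrt_jac x)\<^sup>2 = (p x)\<^sup>2"
        unfolding sqrt_jac_square[OF x, symmetric] using sj0[of x] by (simp add: power2_eq_square)
      then have "(p x)\<^sup>2 * exp (- (\<Sum>i<d. (h x i)\<^sup>2) / (4 * t)) = jac x * ((w (h x))\<^sup>2 * (\<Prod>i<d. gwt \<sigma> (h x i)))"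
        unfolding wh[OF x] gauss by simp
      then show "ennreal ((p x)\<^sup>2 * exp (- (\<Sum>i<d. (h x i)\<^sup>2) / (4 * t))) = ennreal (jac x) * ennreal ((w (h x))\<^sup>2 * (\<Prod>i<d. gwt \<sigma> (h x i)))"
        using jac_pos[OF x] by (simp only: ennreal_mult'[OF less_imp_le])
    qed
    also have "\<dots> = ennreal c * (\<integral>\<^sup>+y. ennreal ((w y)\<^sup>2 * (\<Prod>i<d. gwt \<sigma> (y i))) \<partial>lborel_Rd d)"
      by (rule nnint) measurable
    also have "\<dots> = ennreal c * (\<integral>\<^sup>+a. ennreal ((I a)\<^sup>2 / (\<Prod>i<d. hermite_norm \<sigma> (a i))) \<partial>(\<Pi>\<^sub>M i\<in>{..<d}. count_space UNIV))"
      unfolding I_def by (subst hermite_parseval_PiM[OF _ \<sigma> sw]) simp_all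
    also have "\<dots> = (\<integral>\<^sup>+a. ennreal c * ennreal ((I a)\<^sup>2 / (\<Prod>i<d. hermite_norm \<sigma> (a i))) \<partial>(\<Pi>\<^sub>M i\<in>{..<d}. count_space UNIV))"
      by (intro nn_integral_cmult[symmetric]) (simp add: count_space_PiM_finite)
    also have "\<dots> = (\<integral>\<^sup>+a. ennreal (m a * t powr ((\<Sum>i<d. real (a i)) + real d / 2) * (b a)\<^sup>2) \<partial>(\<Pi>\<^sub>M i\<in>{..<d}. count_space UNIV))"
      by (rule nn_integral_cong) (simp only: ennreal_mult'[OF c0, symmetric] coeff)
    finally show "(\<integral>\<^sup>+x. ennreal ((p x)\<^sup>2 * exp (- (\<Sum>i<d. (h x i)\<^sup>2) / (4 * t))) \<partial>lborel_Rd d)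
      = (\<integral>\<^sup>+a. ennreal (m a * t powr ((\<Sum>i<d. real (a i)) + real d / 2) * (LINT x|lborel_Rd d. p x * mode a t x)\<^sup>2)
          \<partial>(\<Pi>\<^sub>M i\<in>{..<d}. count_space UNIV))" unfolding b_def .
  qed
qed

end

section \<open>Action of the elliptic operator on the modes\<close>

context oriented_diffeo
begin

definition Amat :: "nat \<Rightarrow> nat \<Rightarrow> (nat \<Rightarrow> real) \<Rightarrow> real" where
  "Amat i j x = (\<Sum>l<d. Dg i l x * Dg j l x)"

definition flux :: "((nat \<Rightarrow> real) \<Rightarrow> real) \<Rightarrow> nat \<Rightarrow> (nat \<Rightarrow> real) \<Rightarrow> real" where
  "flux f i x = (\<Sum>j<d. Amat i j x * partial_deriv j f x)"

definition elliptic :: "((nat \<Rightarrow> real) \<Rightarrow> real) \<Rightarrow> (nat \<Rightarrow> real) \<Rightarrow> real" where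
  "elliptic f x = (\<Sum>i<d. partial_deriv i (flux f i) x)"

definition ln_jac :: "(nat \<Rightarrow> real) \<Rightarrow> real" where
  "ln_jac x = ln (jac x)"

definition drift :: "nat \<Rightarrow> (nat \<Rightarrow> real) \<Rightarrow> real" where
  "drift m x = (\<Sum>j<d. Dg j m x * partial_deriv j ln_jac x)"

text \<open>The function whose norm enters \<open>T0\<close>: \<open>drift\<close> has the
  components of (H^(-1))^T applied to the gradient of ln \<eta>, and \<open>elliptic ln_jac\<close>
  is the divergence of A applied to it; see \<open>potential_eq\<close>.\<close>

definition potential :: "(nat \<Rightarrow> real) \<Rightarrow> real" where
  "potential x = 2 * elliptic ln_jac x + (\<Sum>m<d. (drift m x)\<^sup>2)"

definition kernel_h :: "(nat \<Rightarrow> nat) \<Rightarrow> real \<Rightarrow> (nat \<Rightarrow> real) \<Rightarrow> real" where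
  "kernel_h a t x = (\<Prod>i<d. heat_kernel (a i) (2 * t) (h x i))"

lemma mode_eq: "mode a t = (\<lambda>x. sqrt_jac x * kernel_h a t x)"
  by (simp add: mode_def[abs_def] kernel_h_def)

lemma C1D: "C_class d 2 f \<Longrightarrow> C_class d (Suc 0) f"
  by (rule C_class_mono[of d 2]) auto

lemma C2D: "C_class d 2 f \<Longrightarrow> j < d \<Longrightarrow> C_class d (Suc 0) (partial_deriv j f)"
  by (rule C_class_SucD(1)) (simp_all add: numeral_2_eq_2 del: C_class.simps)

lemma has_pd_C2: "C_class d 2 f \<Longrightarrow> j < d \<Longrightarrow> x \<in> Rd d \<Longrightarrow> has_pd f j x (partial_deriv j f x)"
  by (rule C_class_SucD(2)[OF C1D])

lemma C_flux: "C_class d 2 f \<Longrightarrow> i < d \<Longrightarrow> C_class d (Suc 0) (flux f i)"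
  unfolding flux_def[abs_def] Amat_def
  by (intro C_class_sum C_class_mult C1D[OF C_Dg] C2D) auto

lemma continuous_elliptic:
  assumes "C_class d 2 f" shows "continuous_on (Rd d) (elliptic f)"
  unfolding elliptic_def[abs_def]
  by (intro continuous_on_sum C_class_continuous[OF C_class_SucD(1)[OF C_flux[OF assms]]]) auto

lemma C_ln_jac': "C_class d 2 ln_jac"
  using C_ln_jac by (simp add: ln_jac_def[abs_def])

lemma continuous_potential: "continuous_on (Rd d) potential"
  unfolding potential_def[abs_def] drift_def
  by (intro continuous_intros continuous_elliptic C_ln_jac' C_class_continuous[OF C_Dg]
      C_class_continuous[OF C2D[OF C_ln_jac']]) auto

lemma flux_eq: "flux f i x = (\<Sum>m<d. Dg i m x * (\<Sum>j<d. Dg j m x * partial_deriv j f x))"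
  unfolding flux_def Amat_def sum_distrib_left sum_distrib_right
  by (subst sum.swap) (simp add: mult_ac)

lemma flux_symmetric:
  "(\<Sum>i<d. partial_deriv i f x * flux w i x) = (\<Sum>i<d. partial_deriv i w x * flux f i x)"
proof -
  have sym: "Amat i j x = Amat j i x" for i j unfolding Amat_def by (simp add: mult.commute)
  have "(\<Sum>i<d. partial_deriv i f x * flux w i x) = (\<Sum>j<d. \<Sum>i<d. partial_deriv i f x * (Amat i j x * partial_deriv j w x))"
    unfolding flux_def sum_distrib_left by (rule sum.swap)
  also have "\<dots> = (\<Sum>j<d. \<Sum>i<d. partial_deriv j w x * (Amat j i x * partial_deriv i f x))"
    by (intro sum.cong refl) (simp add: sym mult_ac)
  finally show ?thesis unfolding flux_def sum_distrib_left .
qed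

lemma C_kernel_h: "t > 0 \<Longrightarrow> C_class d 2 (kernel_h a t)"
  unfolding kernel_h_def[abs_def]
proof (intro C_class_prod)
  fix i assume t: "t > 0" and i: "i \<in> {..<d}"
  \<comment> \<open>The alternating sign turns the kernels of rising order into a tower of
    successive derivatives.\<close>
  have der: "((\<lambda>y. (-1) ^ n * heat_kernel (a i + n) (2 * t) y) has_field_derivative (-1) ^ Suc n * heat_kernel (a i + Suc n) (2 * t) y) (at y)" for n y
    using DERIV_cmult[OF has_derivative_heat_kernel_space[of "2 * t" "a i + n" y], of "(-1) ^ n"] t by simp
  have "C_class d 2 (\<lambda>x. (-1) ^ 0 * heat_kernel (a i + 0) (2 * t) (h x i))"
  proof (rule C_class_compose_real[where \<phi> = "\<lambda>n y. (-1) ^ n * heat_kernel (a i + n) (2 * t) y"])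
    show "continuous_on UNIV (\<lambda>y. (-1) ^ 2 * heat_kernel (a i + 2) (2 * t) y)"
      using der by (meson DERIV_continuous_on has_field_derivative_at_within)
    show "C_class d 2 (\<lambda>x. h x i)" using C_h2 i by simp
  qed (rule der)
  then show "C_class d 2 (\<lambda>x. heat_kernel (a i) (2 * t) (h x i))" by simp
qed

lemma C_mode: "t > 0 \<Longrightarrow> C_class d 2 (mode a t)"
  unfolding mode_eq by (intro C_class_mult C_sqrt_jac C_kernel_h)

lemma kernel_h_Suc:
  assumes "l < d"
  shows "- heat_kernel (Suc (a l)) (2 * t) (h x l) * (\<Prod>k\<in>{..<d} - {l}. heat_kernel (a k) (2 * t) (h x k))
    = - kernel_h (a(l := Suc (a l))) t x"
proof -
  have "kernel_h (a(l := Suc (a l))) t x = heat_kernel (Suc (a l)) (2 * t) (h x l)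
      * (\<Prod>k\<in>{..<d} - {l}. heat_kernel ((a(l := Suc (a l))) k) (2 * t) (h x k))"
    unfolding kernel_h_def using assms by (subst prod.remove[of _ l]) auto
  also have "(\<Prod>k\<in>{..<d} - {l}. heat_kernel ((a(l := Suc (a l))) k) (2 * t) (h x k))
    = (\<Prod>k\<in>{..<d} - {l}. heat_kernel (a k) (2 * t) (h x k))" by (rule prod.cong) auto
  finally show ?thesis by (simp only: mult_minus_left)
qed

lemma partial_deriv_kernel_h:
  assumes "t > 0" "j < d" "x \<in> Rd d"
  shows "partial_deriv j (kernel_h a t) x = (\<Sum>l<d. - kernel_h (a(l := Suc (a l))) t x * Dh l j x)"
proof -
  have "has_pd (kernel_h a t) j x (\<Sum>l<d. (- heat_kernel (Suc (a l)) (2 * t) (h x l)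
      * (\<Prod>k\<in>{..<d} - {l}. heat_kernel (a k) (2 * t) (h x k))) * Dh l j x)"
    unfolding kernel_h_def using assms
    by (intro has_pd_product_h[where \<theta> = "\<lambda>k. heat_kernel (a k) (2 * t)"] has_derivative_heat_kernel_space) auto
  from partial_deriv_eqI[OF this] have "partial_deriv j (kernel_h a t) x = (\<Sum>l<d. (- heat_kernel (Suc (a l)) (2 * t) (h x l)
      * (\<Prod>k\<in>{..<d} - {l}. heat_kernel (a k) (2 * t) (h x k))) * Dh l j x)" .
  also have "\<dots> = (\<Sum>l<d. - kernel_h (a(l := Suc (a l))) t x * Dh l j x)"
    by (rule sum.cong[OF refl]) (simp only: kernel_h_Suc lessThan_iff)
  finally show ?thesis .
qed

text \<open>Differentiation along column m of H^(-1) is differentiation in y_m, which raises the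
  m-th index and changes the sign.\<close>

lemma Dg_partial_kernel_h:
  assumes "t > 0" "m < d" and x: "x \<in> Rd d"
  shows "(\<Sum>j<d. Dg j m x * partial_deriv j (kernel_h a t) x) = - kernel_h (a(m := Suc (a m))) t x"
proof -
  have "(\<Sum>j<d. Dg j m x * partial_deriv j (kernel_h a t) x)
    = (\<Sum>j<d. \<Sum>l<d. - kernel_h (a(l := Suc (a l))) t x * (Dh l j x * Dg j m x))"
    using assms by (intro sum.cong) (simp_all add: partial_deriv_kernel_h sum_distrib_left mult_ac)
  also have "\<dots> = (\<Sum>l<d. - kernel_h (a(l := Suc (a l))) t x * (\<Sum>j<d. Dh l j x * Dg j m x))"
    by (subst sum.swap) (simp add: sum_distrib_left)
  also have "\<dots> = (\<Sum>l<d. if l = m then - kernel_h (a(l := Suc (a l))) t x else 0)"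
    using assms by (intro sum.cong) (auto simp: Dh_Dg)
  finally show ?thesis using assms by simp
qed

lemma piola_kernel_h:
  assumes "t > 0" "m < d" and x: "x \<in> Rd d"
  shows "(\<Sum>j<d. partial_deriv j (\<lambda>x. jac x * Dg j m x * kernel_h a t x) x) = - jac x * kernel_h (a(m := Suc (a m))) t x"
proof -
  have "(\<Sum>j<d. partial_deriv j (\<lambda>x. jac x * Dg j m x * kernel_h a t x) x)
    = jac x * (- heat_kernel (Suc (a m)) (2 * t) (h x m) * (\<Prod>k\<in>{..<d} - {m}. heat_kernel (a k) (2 * t) (h x k)))"
    unfolding kernel_h_def using assms
    by (intro piola_product[where \<theta> = "\<lambda>k. heat_kernel (a k) (2 * t)"] has_derivative_heat_kernel_space) auto
  then show ?thesis unfolding kernel_h_Suc[OF assms(2)] by simp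
qed

lemma partial_deriv_exp_ln_jac:
  assumes "j < d" "x \<in> Rd d"
  shows "has_pd (\<lambda>x. exp (c * ln_jac x)) j x (exp (c * ln_jac x) * (c * partial_deriv j ln_jac x))"
proof -
  have "has_pd (\<lambda>x. exp (c * ln_jac x)) j x (exp (c * ln_jac (x(j := x j))) * (c * partial_deriv j ln_jac x))"
    by (intro DERIV_fun_exp DERIV_cmult has_pd_C2 C_ln_jac' assms)
  then show ?thesis by simp
qed

lemma sqrt_jac_eq: "sqrt_jac = (\<lambda>x. exp (1/2 * ln_jac x))"
  by (simp add: sqrt_jac_def[abs_def] ln_jac_def)

lemma partial_deriv_mode:
  assumes t: "t > 0" and j: "j < d" and x: "x \<in> Rd d"
  shows "partial_deriv j (mode a t) x
    = sqrt_jac x * (1/2 * partial_deriv j ln_jac x * kernel_h a t x + partial_deriv j (kernel_h a t) x)"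
proof -
  have "has_pd (\<lambda>x. sqrt_jac x * kernel_h a t x) j x
     (sqrt_jac x * (1/2 * partial_deriv j ln_jac x) * kernel_h a t (x(j := x j)) + partial_deriv j (kernel_h a t) x * sqrt_jac (x(j := x j)))"
    by (intro DERIV_mult has_pd_C2 C_kernel_h t j x) (unfold sqrt_jac_eq, rule partial_deriv_exp_ln_jac[OF j x])
  from partial_deriv_eqI[OF this] show ?thesis unfolding mode_eq by (simp add: algebra_simps)
qed

text \<open>Writing \<open>\<eta>\<^sup>1\<^sup>/\<^sup>2 k = mode\<close>, the field \<open>A \<nabla> mode\<close> is \<open>\<eta>\<^sup>-\<^sup>1\<^sup>/\<^sup>2\<close> times a Piola field plus
  \<open>mode / 2\<close> times \<open>A \<nabla> ln \<eta>\<close>; the first-order terms of its divergence cancel.\<close>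

lemma elliptic_mode:
  assumes t: "t > 0" and x: "x \<in> Rd d"
  shows "elliptic (mode a t) x = (\<Sum>m<d. mode (a(m := a m + 2)) t x) + potential x / 4 * mode a t x"
proof -
  define up where "up m = a(m := Suc (a m))" for m
  \<comment> \<open>\<open>r\<close> is \<eta>^(-1/2): the fields \<open>W\<close> carry the full
    factor \<eta> that the Piola identity requires, and \<open>r\<close> brings it back to the
    factor \<eta>^(1/2) of a mode.\<close>
  define r where "r x = exp (-1/2 * ln_jac x)" for x
  define W where "W i m x = jac x * Dg i m x * kernel_h (up m) t x" for i m x
  have rj: "r y * jac y = sqrt_jac y" if "y \<in> Rd d" for y
  proof -
    have "jac y = exp (ln_jac y)" using jac_pos[OF that] by (simp add: ln_jac_def)
    then show ?thesis by (simp add: r_def sqrt_jac_eq exp_add[symmetric])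
  qed
  have flux: "flux (mode a t) i y = - (r y * (\<Sum>m<d. W i m y)) + 1/2 * (mode a t y * flux ln_jac i y)"
    if i: "i < d" and y: "y \<in> Rd d" for i y
  proof -
    have "flux (mode a t) i y = (\<Sum>m<d. Dg i m y * (sqrt_jac y * (1/2 * kernel_h a t y * drift m y - kernel_h (up m) t y)))"
      unfolding flux_eq
    proof (intro sum.cong[OF refl] arg_cong[where f = "\<lambda>z. _ * z"])
      fix m assume "m \<in> {..<d}"
      then have m: "m < d" by simp
      have "(\<Sum>j<d. Dg j m y * partial_deriv j (mode a t) y)
        = (\<Sum>j<d. sqrt_jac y * (1/2 * kernel_h a t y * (Dg j m y * partial_deriv j ln_jac y) + Dg j m y * partial_deriv j (kernel_h a t) y))"
        using t y by (intro sum.cong) (simp_all add: partial_deriv_mode algebra_simps)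
      also have "\<dots> = sqrt_jac y * (1/2 * kernel_h a t y * drift m y + (\<Sum>j<d. Dg j m y * partial_deriv j (kernel_h a t) y))"
        unfolding drift_def sum_distrib_left[symmetric] sum.distrib ..
      also have "\<dots> = sqrt_jac y * (1/2 * kernel_h a t y * drift m y - kernel_h (up m) t y)"
        unfolding Dg_partial_kernel_h[OF t m y] up_def by simp
      finally show "(\<Sum>j<d. Dg j m y * partial_deriv j (mode a t) y)
        = sqrt_jac y * (1/2 * kernel_h a t y * drift m y - kernel_h (up m) t y)" .
    qed
    also have "\<dots> = (\<Sum>m<d. 1/2 * (mode a t y * (Dg i m y * drift m y)) - r y * W i m y)"
      by (intro sum.cong refl) (simp add: W_def rj[OF y, symmetric] mode_eq algebra_simps)
    also have "\<dots> = 1/2 * (mode a t y * flux ln_jac i y) - r y * (\<Sum>m<d. W i m y)"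
      unfolding sum_subtractf sum_distrib_left[symmetric] flux_eq drift_def ..
    finally show ?thesis by simp
  qed
  have C_W: "C_class d 2 (W i m)" if "i < d" "m < d" for i m
    unfolding W_def[abs_def] by (intro C_class_mult C_jac C_Dg C_kernel_h t that)
  have pd_flux: "partial_deriv i (flux (mode a t) i) x
    = - (r x * (-1/2 * partial_deriv i ln_jac x) * (\<Sum>m<d. W i m x) + (\<Sum>m<d. partial_deriv i (W i m) x) * r x)
      + 1/2 * (partial_deriv i (mode a t) x * flux ln_jac i x + partial_deriv i (flux ln_jac i) x * mode a t x)" if i: "i < d" for i
  proof -
    have dr: "has_pd r i x (r x * (-1/2 * partial_deriv i ln_jac x))"
      unfolding r_def by (rule partial_deriv_exp_ln_jac[OF i x])
    have "has_pd (\<lambda>y. - (r y * (\<Sum>m<d. W i m y)) + 1/2 * (mode a t y * flux ln_jac i y)) i x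
      (- (r x * (-1/2 * partial_deriv i ln_jac x) * (\<Sum>m<d. W i m (x(i := x i))) + (\<Sum>m<d. partial_deriv i (W i m) x) * r (x(i := x i)))
      + 1/2 * (partial_deriv i (mode a t) x * flux ln_jac i (x(i := x i)) + partial_deriv i (flux ln_jac i) x * mode a t (x(i := x i))))"
      by (intro DERIV_add DERIV_minus DERIV_cmult DERIV_mult DERIV_sum dr C_class_SucD(2)[OF C_flux[OF C_ln_jac']]
          has_pd_C2[OF C_W] has_pd_C2[OF C_mode[OF t]] i x) simp_all
    then have "partial_deriv i (\<lambda>y. - (r y * (\<Sum>m<d. W i m y)) + 1/2 * (mode a t y * flux ln_jac i y)) x
      = - (r x * (-1/2 * partial_deriv i ln_jac x) * (\<Sum>m<d. W i m x) + (\<Sum>m<d. partial_deriv i (W i m) x) * r x)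
      + 1/2 * (partial_deriv i (mode a t) x * flux ln_jac i x + partial_deriv i (flux ln_jac i) x * mode a t x)"
      by (simp only: partial_deriv_eqI fun_upd_triv)
    then show ?thesis using partial_deriv_cong[OF flux[OF i] x i] by simp
  qed
  have s1: "(\<Sum>i<d. r x * (-1/2 * partial_deriv i ln_jac x) * (\<Sum>m<d. W i m x))
     = -1/2 * sqrt_jac x * (\<Sum>m<d. drift m x * kernel_h (up m) t x)"
  proof -
    have "(\<Sum>i<d. r x * (-1/2 * partial_deriv i ln_jac x) * (\<Sum>m<d. W i m x))
      = (\<Sum>i<d. \<Sum>m<d. -1/2 * (r x * jac x) * (Dg i m x * partial_deriv i ln_jac x * kernel_h (up m) t x))"
      unfolding W_def sum_distrib_left by (simp add: mult_ac)
    also have "\<dots> = (\<Sum>m<d. \<Sum>i<d. -1/2 * (r x * jac x) * (Dg i m x * partial_deriv i ln_jac x * kernel_h (up m) t x))"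
      by (rule sum.swap)
    finally show ?thesis unfolding drift_def sum_distrib_left sum_distrib_right rj[OF x] by simp
  qed
  have s2: "(\<Sum>i<d. \<Sum>m<d. partial_deriv i (W i m) x) = - jac x * (\<Sum>m<d. kernel_h (a(m := a m + 2)) t x)"
  proof -
    have "(\<Sum>i<d. \<Sum>m<d. partial_deriv i (W i m) x) = (\<Sum>m<d. \<Sum>i<d. partial_deriv i (W i m) x)" by (rule sum.swap)
    also have "\<dots> = (\<Sum>m<d. - jac x * kernel_h (a(m := a m + 2)) t x)"
      unfolding W_def[abs_def] using t x by (intro sum.cong) (simp_all add: piola_kernel_h up_def)
    finally show ?thesis by (simp add: sum_distrib_left)
  qed
  have s3: "(\<Sum>i<d. partial_deriv i (mode a t) x * flux ln_jac i x)
     = 1/2 * mode a t x * (\<Sum>m<d. (drift m x)\<^sup>2) - sqrt_jac x * (\<Sum>m<d. drift m x * kernel_h (up m) t x)"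
  proof -
    have mx: "mode a t x = sqrt_jac x * kernel_h a t x" by (simp add: mode_eq)
    have "(\<Sum>i<d. partial_deriv i (mode a t) x * flux ln_jac i x)
      = (\<Sum>i<d. \<Sum>m<d. 1/2 * mode a t x * (drift m x * (Dg i m x * partial_deriv i ln_jac x))
        + sqrt_jac x * (drift m x * (Dg i m x * partial_deriv i (kernel_h a t) x)))"
      unfolding flux_eq drift_def[symmetric] sum_distrib_left
      using t x by (intro sum.cong refl) (simp add: partial_deriv_mode mx algebra_simps)
    also have "\<dots> = (\<Sum>m<d. \<Sum>i<d. 1/2 * mode a t x * (drift m x * (Dg i m x * partial_deriv i ln_jac x))
        + sqrt_jac x * (drift m x * (Dg i m x * partial_deriv i (kernel_h a t) x)))"
      by (rule sum.swap)
    also have "\<dots> = (\<Sum>m<d. 1/2 * mode a t x * (drift m x * drift m x) + sqrt_jac x * (drift m x * - kernel_h (up m) t x))"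
      unfolding sum.distrib sum_distrib_left[symmetric] drift_def[symmetric]
      using t x by (simp add: Dg_partial_kernel_h up_def)
    finally show ?thesis
      by (simp add: sum.distrib sum_distrib_left power2_eq_square sum_subtractf)
  qed
  have "elliptic (mode a t) x
    = - (\<Sum>i<d. r x * (-1/2 * partial_deriv i ln_jac x) * (\<Sum>m<d. W i m x))
      - r x * (\<Sum>i<d. \<Sum>m<d. partial_deriv i (W i m) x)
      + 1/2 * (\<Sum>i<d. partial_deriv i (mode a t) x * flux ln_jac i x)
      + 1/2 * mode a t x * elliptic ln_jac x"
    unfolding elliptic_def
    by (simp add: pd_flux sum.distrib sum_subtractf sum_negf sum_distrib_left sum_divide_distrib algebra_simps)
  \<comment> \<open>The first-order terms in \<open>drift\<close> and the raised kernels cancel: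
    minus \<open>s1\<close> contributes plus one half of them, half of \<open>s3\<close> minus one
    half. What is left of order zero is a quarter of the squared drift and half of
    \<open>elliptic ln_jac\<close>, which is \<open>potential / 4\<close>.\<close>
  also have "\<dots> = r x * jac x * (\<Sum>m<d. kernel_h (a(m := a m + 2)) t x) + 1/4 * mode a t x * (\<Sum>m<d. (drift m x)\<^sup>2) + 1/2 * mode a t x * elliptic ln_jac x"
    unfolding s1 s2 s3 by (simp add: algebra_simps)
  also have "\<dots> = (\<Sum>m<d. mode (a(m := a m + 2)) t x) + potential x / 4 * mode a t x"
    unfolding rj[OF x] potential_def mode_eq sum_distrib_left[symmetric] by (simp add: algebra_simps)
  finally show ?thesis .
qed

text \<open>Green's identity: the divergence of w A grad u - u A grad w is integrated. Compact
  support of \<open>u\<close> is enough to kill it, which matters because the modes are not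
  compactly supported.\<close>

lemma integral_elliptic_symmetric:
  assumes u: "C_class d 2 u" "vanishes_off d R u" and w: "C_class d 2 w"
  shows "(LINT x|lborel_Rd d. elliptic u x * w x) = (LINT x|lborel_Rd d. u x * elliptic w x)"
    "integrable (lborel_Rd d) (\<lambda>x. elliptic u x * w x)" "vanishes_off d R (elliptic u)"
proof -
  let ?Z = "\<lambda>i x. w x * flux u i x - u x * flux w i x"
  have C: "C_class d (Suc 0) (?Z i)" if "i < d" for i
    by (intro C_class_diff C_class_mult C1D C_flux u w that)
  have v1: "vanishes_off d R (partial_deriv i u)" if "i < d" for i
    using vanishes_off_partial[OF that has_pd_C2[OF u(1) that] u(2)] .
  have v2: "vanishes_off d R (flux u i)" for i
    using v1 by (auto simp: vanishes_off_def flux_def)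
  have vZ: "vanishes_off d R (?Z i)" for i using v2[of i] u(2) by (auto simp: vanishes_off_def)
  have v3: "vanishes_off d R (partial_deriv i (flux u i))" if "i < d" for i
    using vanishes_off_partial[OF that C_class_SucD(2)[OF C_flux[OF u(1) that] that] v2] .
  show v4: "vanishes_off d R (elliptic u)"
    using v3 by (auto simp: vanishes_off_def elliptic_def)
  have Z: "integrable (lborel_Rd d) (partial_deriv i (?Z i))" "(LINT x|lborel_Rd d. partial_deriv i (?Z i) x) = 0" if "i < d" for i
    using integral_partial_derivative[OF that C_class_SucD(2)[OF C[OF that] that] C_class_continuous[OF C_class_SucD(1)[OF C[OF that] that]] vZ] by blast+
  have int1: "integrable (lborel_Rd d) (\<lambda>x. elliptic u x * w x)"
    by (rule integrable_vanishes_off[of d _ R]) (use v4 in \<open>auto intro!: continuous_on_mult continuous_elliptic u C_class_continuous[OF w] simp: vanishes_off_def\<close>)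
  have int2: "integrable (lborel_Rd d) (\<lambda>x. u x * elliptic w x)"
    by (rule integrable_vanishes_off[of d _ R]) (use u in \<open>auto intro!: continuous_on_mult continuous_elliptic w C_class_continuous[OF u(1)] simp: vanishes_off_def\<close>)
  show "integrable (lborel_Rd d) (\<lambda>x. elliptic u x * w x)" by (rule int1)
  have pt: "(\<Sum>i<d. partial_deriv i (?Z i) x) = elliptic u x * w x - u x * elliptic w x" if x: "x \<in> Rd d" for x
  proof -
    have "partial_deriv i (?Z i) x = (partial_deriv i w x * flux u i x + partial_deriv i (flux u i) x * w x)
       - (partial_deriv i u x * flux w i x + partial_deriv i (flux w i) x * u x)" if i: "i < d" for i
    proof -
      have "has_pd (?Z i) i x ((partial_deriv i w x * flux u i (x(i := x i)) + partial_deriv i (flux u i) x * w (x(i := x i)))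
       - (partial_deriv i u x * flux w i (x(i := x i)) + partial_deriv i (flux w i) x * u (x(i := x i))))"
        by (intro DERIV_diff DERIV_mult has_pd_C2 C_class_SucD(2)[OF C_flux] u w i x)
      from partial_deriv_eqI[OF this] show ?thesis by simp
    qed
    then have "(\<Sum>i<d. partial_deriv i (?Z i) x) = (\<Sum>i<d. (partial_deriv i w x * flux u i x + partial_deriv i (flux u i) x * w x)
       - (partial_deriv i u x * flux w i x + partial_deriv i (flux w i) x * u x))"
      by (intro sum.cong) auto
    also have "\<dots> = (\<Sum>i<d. partial_deriv i w x * flux u i x) - (\<Sum>i<d. partial_deriv i u x * flux w i x)
       + (elliptic u x * w x - u x * elliptic w x)"
      by (simp add: elliptic_def sum.distrib sum_subtractf sum_distrib_left sum_distrib_right mult.commute)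
    finally show ?thesis by (simp add: flux_symmetric[of w])
  qed
  have "0 = (LINT x|lborel_Rd d. (\<Sum>i<d. partial_deriv i (?Z i) x))"
    by (subst Bochner_Integration.integral_sum) (simp_all add: Z)
  also have "\<dots> = (LINT x|lborel_Rd d. elliptic u x * w x - u x * elliptic w x)"
    by (intro Bochner_Integration.integral_cong) (simp_all add: pt space_PiM)
  also have "\<dots> = (LINT x|lborel_Rd d. elliptic u x * w x) - (LINT x|lborel_Rd d. u x * elliptic w x)"
    by (rule Bochner_Integration.integral_diff[OF int1 int2])
  finally show "(LINT x|lborel_Rd d. elliptic u x * w x) = (LINT x|lborel_Rd d. u x * elliptic w x)" by simp
qed

text \<open>The order-zero term that \<open>elliptic_mode\<close> produces is exactly the potential
  term subtracted on the left. By \<open>has_derivative_mode_time\<close> the right side is the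
  pairing of \<open>u\<close> with the time derivative of the mode.\<close>

lemma integral_mode_elliptic:
  assumes u: "C_class d 2 u" "vanishes_off d R u" and t: "t > 0"
  shows "(LINT x|lborel_Rd d. (elliptic u x - potential x / 4 * u x) * mode a t x)
    = (LINT x|lborel_Rd d. u x * (\<Sum>m<d. mode (a(m := a m + 2)) t x))"
proof -
  have int: "integrable (lborel_Rd d) (\<lambda>x. potential x / 4 * u x * mode a t x)"
    by (rule integrable_vanishes_off[of d _ R])
      (use u in \<open>auto intro!: continuous_intros continuous_potential C_class_continuous[OF u(1)] C_class_continuous[OF C_mode] t simp: vanishes_off_def\<close>)
  have int': "integrable (lborel_Rd d) (\<lambda>x. u x * elliptic (mode a t) x)"
    by (rule integrable_vanishes_off[of d _ R]) (use u in \<open>auto intro!: continuous_on_mult continuous_elliptic C_mode t C_class_continuous[OF u(1)] simp: vanishes_off_def\<close>)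
  have "(LINT x|lborel_Rd d. (elliptic u x - potential x / 4 * u x) * mode a t x)
    = (LINT x|lborel_Rd d. elliptic u x * mode a t x - potential x / 4 * u x * mode a t x)"
    by (simp only: left_diff_distrib)
  also have "\<dots> = (LINT x|lborel_Rd d. elliptic u x * mode a t x) - (LINT x|lborel_Rd d. potential x / 4 * u x * mode a t x)"
    by (rule Bochner_Integration.integral_diff[OF integral_elliptic_symmetric(2)[OF u C_mode[OF t]] int])
  also have "(LINT x|lborel_Rd d. elliptic u x * mode a t x) = (LINT x|lborel_Rd d. u x * elliptic (mode a t) x)"
    by (rule integral_elliptic_symmetric(1)[OF u C_mode[OF t]])
  also have "(LINT x|lborel_Rd d. u x * elliptic (mode a t) x) - (LINT x|lborel_Rd d. potential x / 4 * u x * mode a t x)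
    = (LINT x|lborel_Rd d. u x * elliptic (mode a t) x - potential x / 4 * u x * mode a t x)"
    by (rule Bochner_Integration.integral_diff[OF int' int, symmetric])
  also have "\<dots> = (LINT x|lborel_Rd d. u x * (\<Sum>m<d. mode (a(m := a m + 2)) t x))"
    by (intro Bochner_Integration.integral_cong refl) (simp add: elliptic_mode[OF t] space_PiM algebra_simps)
  finally show ?thesis .
qed

end

section \<open>The Carleman estimate\<close>

lemma borel_measurable_nn_integral_count_space:
  assumes "countable I" "\<And>i. i \<in> I \<Longrightarrow> f i \<in> borel_measurable M"
  shows "(\<lambda>x. \<integral>\<^sup>+i. f i x \<partial>count_space I) \<in> borel_measurable M"
proof -
  interpret sigma_finite_measure "count_space I"
    by (rule sigma_finite_measure_count_space_countable[OF assms(1)])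
  have "(\<lambda>z. f (fst z) (snd z)) \<in> borel_measurable (count_space I \<Otimes>\<^sub>M M)"
    by (rule measurable_pair_measure_countable1[OF assms(1)]) (simp add: assms(2))
  from measurable_compose[OF measurable_pair_swap' this]
  have "(\<lambda>(x, i). f i x) \<in> borel_measurable (M \<Otimes>\<^sub>M count_space I)"
    by (simp add: case_prod_beta)
  then show ?thesis by (rule borel_measurable_nn_integral)
qed

section \<open>Time and space slices of functions on space-time\<close>

lemma restrict_update_Rd:
  assumes "x \<in> Rd d" shows "restrict (x(d := t)) {..<d} = x"
  using assms by (auto simp: fun_eq_iff PiE_def extensional_def restrict_def)

lemma update_Rd_Suc: "x \<in> Rd d \<Longrightarrow> x(d := t) \<in> Rd (Suc d)"
  by (auto simp: PiE_def extensional_def)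

lemma C_class_slice:
  assumes "C_class (Suc d) k U" shows "C_class d k (\<lambda>x. U (x(d := t)))"
  using assms
proof (induction k arbitrary: U)
  case 0
  have "continuous_on (Rd d) (\<lambda>x. U (x(d := t)))"
  proof (rule continuous_on_compose2[of "Rd (Suc d)" U])
    show "continuous_on (Rd (Suc d)) U" using 0 by simp
    show "continuous_on (Rd d) (\<lambda>x. x(d := t))"
    proof (rule continuous_on_coordinatewise_then_product)
      fix i show "continuous_on (Rd d) (\<lambda>x. (x(d := t)) i)"
        by (cases "i = d") (auto intro: continuous_on_subset[OF continuous_on_product_coordinates])
    qed
    show "(\<lambda>x. x(d := t)) ` Rd d \<subseteq> Rd (Suc d)" by (rule image_subsetI) (rule update_Rd_Suc)
  qed
  then show ?case unfolding C_class.simps(1) .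
next
  case (Suc k)
  show ?case
  proof (rule C_class_SucI[where f' = "\<lambda>i x. partial_deriv i U (x(d := t))"])
    show "continuous_on (Rd d) (\<lambda>x. U (x(d := t)))"
      by (rule C_class_continuous[OF Suc.IH[OF C_class_mono_Suc[OF Suc.prems]]])
    fix i assume i: "i < d"
    then have i': "i < Suc d" by simp
    show "C_class d k (\<lambda>x. partial_deriv i U (x(d := t)))"
      by (rule Suc.IH[OF C_class_SucD(1)[OF Suc.prems i']])
    fix x assume x: "x \<in> Rd d"
    have "(x(d := t)) i = x i" "(x(d := t))(i := s) = (x(i := s))(d := t)" for s using i by (auto simp: fun_eq_iff)
    then show "has_pd (\<lambda>x. U (x(d := t))) i x (partial_deriv i U (x(d := t)))"
      using C_class_SucD(2)[OF Suc.prems i' update_Rd_Suc[OF x, of t]] by (simp only:)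
  qed
qed

lemma C_class_space_slice:
  assumes "C_class (Suc d) k (\<lambda>z. u (restrict z {..<d}) (z d))"
  shows "C_class d k (\<lambda>x. u x t)"
proof -
  have "C_class d k (\<lambda>x. u (restrict (x(d := t)) {..<d}) ((x(d := t)) d))" by (rule C_class_slice[OF assms])
  then show ?thesis
    by (rule C_class_cong[THEN iffD1, rotated]) (simp only: restrict_update_Rd fun_upd_same)
qed

lemma has_derivative_time_slice:
  assumes U: "C_class (Suc d) (Suc k) (\<lambda>z. u (restrict z {..<d}) (z d))" and x: "x \<in> Rd d"
  shows "((\<lambda>s. u x s) has_field_derivative partial_deriv d (\<lambda>z. u (restrict z {..<d}) (z d)) (x(d := t))) (at t)"
proof -
  have "has_pd (\<lambda>z. u (restrict z {..<d}) (z d)) d (x(d := t)) (partial_deriv d (\<lambda>z. u (restrict z {..<d}) (z d)) (x(d := t)))"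
    by (rule C_class_SucD(2)[OF U]) (simp, rule update_Rd_Suc[OF x])
  then show ?thesis by (simp only: fun_upd_upd fun_upd_same restrict_update_Rd[OF x])
qed

lemma continuous_on_Rd_time:
  assumes "continuous_on (Rd (Suc d)) U"
  shows "continuous_on (Rd d \<times> S) (\<lambda>(x, t). U (x(d := t)))"
proof -
  have "continuous_on (Rd d \<times> S) (\<lambda>z. U ((fst z)(d := snd z)))"
  proof (rule continuous_on_compose2[OF assms])
    show "continuous_on (Rd d \<times> S) (\<lambda>z. (fst z)(d := snd z))"
    proof (rule continuous_on_coordinatewise_then_product)
      fix i show "continuous_on (Rd d \<times> S) (\<lambda>z. ((fst z)(d := snd z)) i)"
      proof (cases "i = d")
        case False
        have "continuous_on (Rd d \<times> S) (\<lambda>z. (\<lambda>x. x i) (fst z))"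
          by (rule continuous_on_compose2[OF continuous_on_product_coordinates]) (auto intro: continuous_intros)
        then show ?thesis using False by simp
      qed (auto intro: continuous_intros)
    qed
    show "(\<lambda>z. (fst z)(d := snd z)) ` (Rd d \<times> S) \<subseteq> Rd (Suc d)"
      by (rule image_subsetI) (auto simp only: mem_Times_iff update_Rd_Suc)
  qed
  then show ?thesis by (simp add: case_prod_beta)
qed

lemma continuous_on_fst_Rd:
  assumes "continuous_on (Rd d) f" shows "continuous_on (Rd d \<times> S) (\<lambda>z. f (fst z))"
  by (rule continuous_on_compose2[OF assms]) (auto intro: continuous_intros)

lemma ennreal_lincomb:
  "0 \<le> c \<Longrightarrow> 0 \<le> x \<Longrightarrow> 0 \<le> y \<Longrightarrow> ennreal (2 * x + c * y) = 2 * ennreal x + ennreal c * ennreal y"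
  by (simp add: ennreal_plus ennreal_mult')

lemma ennreal_absorb_half:
  fixes x a :: ennreal
  assumes "x \<le> a + ennreal (1/2) * x" "x < \<infinity>"
  shows "x \<le> 2 * a"
proof (cases a)
  case (real r)
  obtain s where s: "s \<ge> 0" "x = ennreal s" using assms(2) by (cases x) auto
  have "ennreal r + ennreal (1/2) * ennreal s = ennreal (r + 1/2 * s)"
    using real s by (subst ennreal_mult'[symmetric], simp, subst ennreal_plus) simp_all
  then have "ennreal s \<le> ennreal (r + 1/2 * s)" using assms(1) unfolding real(2) s(2) by (simp only:)
  then have "s \<le> r + 1/2 * s" using real s by (subst (asm) ennreal_le_iff) auto
  then have "s \<le> 2 * r" by simp
  then show ?thesis using real s by (simp add: ennreal_mult'[symmetric] ennreal_leI flip: ennreal_numeral)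
qed (simp add: ennreal_mult_top)

section \<open>Modes in time and the weighted estimates\<close>

context oriented_diffeo
begin

lemma continuous_mode: "continuous_on (Rd d \<times> {0<..}) (\<lambda>(x, t). mode a t x)"
proof -
  have time: "continuous_on (Rd d \<times> {0<..}) (\<lambda>z. 2 * snd z :: real)"
    by (intro continuous_on_mult continuous_on_const continuous_on_snd continuous_on_id)
  have pos: "2 * snd z > 0" if "z \<in> Rd d \<times> {0<..}" for z :: "(nat \<Rightarrow> real) \<times> real"
    using that by (simp only: mem_Times_iff greaterThan_iff) simp
  have "continuous_on (Rd d \<times> {0<..}) (\<lambda>z. heat_kernel (a i) (2 * snd z) (h (fst z) i))" if "i \<in> {..<d}" for i
    by (rule continuous_on_heat_kernel[OF time pos continuous_on_fst_Rd[OF continuous_h]]) (use that in simp_all)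
  then have "continuous_on (Rd d \<times> {0<..}) (\<lambda>z. sqrt_jac (fst z) * (\<Prod>i<d. heat_kernel (a i) (2 * snd z) (h (fst z) i)))"
    by (intro continuous_on_mult continuous_on_prod continuous_on_fst_Rd[OF C_class_continuous[OF C_sqrt_jac]])
  then show ?thesis by (simp add: mode_def case_prod_beta)
qed

text \<open>With variance \<open>2 * t\<close> the inner derivative 2 cancels the factor 1/2 of the
  heat equation, so the time derivative is the sum of the modes raised by two in one index.\<close>

lemma has_derivative_mode_time:
  assumes t: "t > 0"
  shows "((\<lambda>t. mode a t x) has_field_derivative (\<Sum>m<d. mode (a(m := a m + 2)) t x)) (at t)"
proof -
  have 1: "((\<lambda>t. heat_kernel k (2 * t) y) has_field_derivative heat_kernel (Suc (Suc k)) (2 * t) y) (at t)" for k y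
  proof -
    have "((\<lambda>t. heat_kernel k (2 * t) y) has_field_derivative heat_kernel (Suc (Suc k)) (2 * t) y / 2 * 2) (at t)"
      by (rule DERIV_chain2[OF has_derivative_heat_kernel_time]) (use t in \<open>auto intro!: derivative_eq_intros\<close>)
    then show ?thesis by (simp del: heat_kernel.simps)
  qed
  have "((\<lambda>t. mode a t x) has_field_derivative sqrt_jac x * (\<Sum>m<d. heat_kernel (Suc (Suc (a m))) (2 * t) (h x m)
      * (\<Prod>i\<in>{..<d} - {m}. heat_kernel (a i) (2 * t) (h x i)))) (at t)"
    unfolding mode_def by (intro DERIV_cmult has_field_derivative_prod 1)
  moreover have "sqrt_jac x * (\<Sum>m<d. heat_kernel (Suc (Suc (a m))) (2 * t) (h x m)
      * (\<Prod>i\<in>{..<d} - {m}. heat_kernel (a i) (2 * t) (h x i))) = (\<Sum>m<d. mode (a(m := a m + 2)) t x)"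
    unfolding sum_distrib_left
  proof (rule sum.cong[OF refl])
    fix m assume m: "m \<in> {..<d}"
    have "(\<Prod>i\<in>{..<d} - {m}. heat_kernel ((a(m := a m + 2)) i) (2 * t) (h x i)) = (\<Prod>i\<in>{..<d} - {m}. heat_kernel (a i) (2 * t) (h x i))"
      by (rule prod.cong) auto
    then show "sqrt_jac x * (heat_kernel (Suc (Suc (a m))) (2 * t) (h x m)
      * (\<Prod>i\<in>{..<d} - {m}. heat_kernel (a i) (2 * t) (h x i))) = mode (a(m := a m + 2)) t x"
      unfolding mode_def using m by (subst prod.remove[of _ m]) (simp_all del: heat_kernel.simps)
  qed
  ultimately show ?thesis by (simp only:)
qed

lemma weight_measurable: "(\<lambda>x. exp (- (\<Sum>i<d. (h x i)\<^sup>2) / (4 * t))) \<in> borel_measurable (lborel_Rd d)"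
proof -
  have "continuous_on (Rd d) (\<lambda>x. exp ((- 1 / (4 * t)) * (\<Sum>i<d. (h x i)\<^sup>2)))"
    by (intro continuous_on_exp continuous_on_mult continuous_on_const continuous_on_sum continuous_on_power continuous_h) simp
  from borel_measurable_continuous_Rd[OF this] show ?thesis by simp
qed

text \<open>The square of a weighted norm, with values in the extended nonnegative reals.\<close>

definition gauss_norm :: "((nat \<Rightarrow> real) \<Rightarrow> real) \<Rightarrow> real \<Rightarrow> ennreal" where
  "gauss_norm p t = (\<integral>\<^sup>+x. ennreal ((p x)\<^sup>2 * exp (- (\<Sum>i<d. (h x i)\<^sup>2) / (4 * t))) \<partial>lborel_Rd d)"

text \<open>Parseval at each time, multiplied by a power of t and integrated. The sum over
  multi-indices also yields measurability of \<open>gauss_norm (w t) t\<close> in t, since each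
  coefficient is continuous in t.\<close>

lemma weighted_parseval:
  assumes m: "\<And>a. m a \<ge> (0::real)"
    and ps: "\<forall>p R t. continuous_on (Rd d) p \<longrightarrow> vanishes_off d R p \<longrightarrow> t > 0 \<longrightarrow>
      gauss_norm p t = (\<integral>\<^sup>+a. ennreal (m a * t powr ((\<Sum>i<d. real (a i)) + real d / 2) * (LINT x|lborel_Rd d. p x * mode a t x)\<^sup>2)
          \<partial>(\<Pi>\<^sub>M i\<in>{..<d}. count_space UNIV))"
    and w: "\<And>t. t > 0 \<Longrightarrow> continuous_on (Rd d) (w t)" "\<And>t. t > 0 \<Longrightarrow> vanishes_off d R (w t)"
    and b: "\<And>a. continuous_on {0<..} (\<lambda>t. LINT x|lborel_Rd d. w t x * mode a t x)"
    and t0: "t0 > 0"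
  shows "(\<lambda>t. ennreal (t powr q) * gauss_norm (w t) t * indicator {t0..t1} t) \<in> borel_measurable lborel"
    "(\<integral>\<^sup>+t. ennreal (t powr q) * gauss_norm (w t) t * indicator {t0..t1} t \<partial>lborel)
     = (\<integral>\<^sup>+a. ennreal (m a) * (\<integral>\<^sup>+t. ennreal (t powr (q + (\<Sum>i<d. real (a i)) + real d / 2) * (LINT x|lborel_Rd d. w t x * mode a t x)\<^sup>2)
         * indicator {t0..t1} t \<partial>lborel) \<partial>count_space ({..<d} \<rightarrow>\<^sub>E UNIV))"
proof -
  let ?I = "{..<d} \<rightarrow>\<^sub>E (UNIV :: nat set)"
  have cI: "countable ?I" by (intro countable_PiE) auto
  have cs: "(\<Pi>\<^sub>M i\<in>{..<d}. count_space (UNIV :: nat set)) = count_space ?I"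
    by (intro count_space_PiM_finite) auto
  define B where "B a t = (LINT x|lborel_Rd d. w t x * mode a t x)" for a t
  define f where "f a t = ennreal (t powr (q + (\<Sum>i<d. real (a i)) + real d / 2) * (B a t)\<^sup>2) * indicator {t0..t1} t" for a t
  have fm: "f a \<in> borel_measurable lborel" for a
  proof -
    have "continuous_on {t0..t1} (\<lambda>t. t powr (q + (\<Sum>i<d. real (a i)) + real d / 2) * (B a t)\<^sup>2)"
      using t0 b[of a] unfolding B_def
      by (intro continuous_intros) (auto intro: continuous_on_subset)
    then have "(\<lambda>t. indicator {t0..t1} t *\<^sub>R (t powr (q + (\<Sum>i<d. real (a i)) + real d / 2) * (B a t)\<^sup>2)) \<in> borel_measurable borel"
      by (rule borel_measurable_continuous_on_indicator[rotated]) simp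
    then have meas: "(\<lambda>t. ennreal (indicator {t0..t1} t *\<^sub>R (t powr (q + (\<Sum>i<d. real (a i)) + real d / 2) * (B a t)\<^sup>2))) \<in> borel_measurable lborel"
      by simp
    have eqf: "(\<lambda>t. ennreal (indicator {t0..t1} t *\<^sub>R (t powr (q + (\<Sum>i<d. real (a i)) + real d / 2) * (B a t)\<^sup>2))) = f a"
      by (auto simp: f_def fun_eq_iff indicator_def)
    show ?thesis using meas unfolding eqf .
  qed
  have eq: "ennreal (t powr q) * gauss_norm (w t) t * indicator {t0..t1} t = (\<integral>\<^sup>+a. ennreal (m a) * f a t \<partial>count_space ?I)" for t
  proof (cases "t \<in> {t0..t1}")
    case True
    then have t: "t > 0" using t0 by simp
    have "ennreal (t powr q) * gauss_norm (w t) t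
      = (\<integral>\<^sup>+a. ennreal (t powr q) * ennreal (m a * t powr ((\<Sum>i<d. real (a i)) + real d / 2) * (B a t)\<^sup>2) \<partial>count_space ?I)"
      unfolding ps[rule_format, OF w[OF t] t] cs B_def by (rule nn_integral_cmult[symmetric]) simp
    also have "\<dots> = (\<integral>\<^sup>+a. ennreal (m a) * f a t \<partial>count_space ?I)"
    proof (rule nn_integral_cong)
      fix a :: "nat \<Rightarrow> nat"
      have "t powr q * (m a * t powr ((\<Sum>i<d. real (a i)) + real d / 2) * (B a t)\<^sup>2)
        = m a * (t powr (q + (\<Sum>i<d. real (a i)) + real d / 2) * (B a t)\<^sup>2)"
        by (simp add: powr_add)
      then show "ennreal (t powr q) * ennreal (m a * t powr ((\<Sum>i<d. real (a i)) + real d / 2) * (B a t)\<^sup>2) = ennreal (m a) * f a t"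
        using True m[of a] by (simp add: f_def ennreal_mult'[symmetric])
    qed
    finally show ?thesis using True by simp
  qed (simp add: f_def)
  show "(\<lambda>t. ennreal (t powr q) * gauss_norm (w t) t * indicator {t0..t1} t) \<in> borel_measurable lborel"
    unfolding eq using fm by (intro borel_measurable_nn_integral_count_space cI borel_measurable_times_ennreal) auto
  have "(\<integral>\<^sup>+t. ennreal (t powr q) * gauss_norm (w t) t * indicator {t0..t1} t \<partial>lborel)
    = (\<integral>\<^sup>+a. (\<integral>\<^sup>+t. ennreal (m a) * f a t \<partial>lborel) \<partial>count_space ?I)"
    unfolding eq using fm by (intro nn_integral_count_space_nn_integral cI borel_measurable_times_ennreal) auto
  also have "\<dots> = (\<integral>\<^sup>+a. ennreal (m a) * (\<integral>\<^sup>+t. f a t \<partial>lborel) \<partial>count_space ?I)"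
    using fm by (intro nn_integral_cong nn_integral_cmult) auto
  finally show "(\<integral>\<^sup>+t. ennreal (t powr q) * gauss_norm (w t) t * indicator {t0..t1} t \<partial>lborel)
     = (\<integral>\<^sup>+a. ennreal (m a) * (\<integral>\<^sup>+t. ennreal (t powr (q + (\<Sum>i<d. real (a i)) + real d / 2) * (LINT x|lborel_Rd d. w t x * mode a t x)\<^sup>2)
         * indicator {t0..t1} t \<partial>lborel) \<partial>count_space ?I)" unfolding f_def B_def .
qed

definition backward_heat :: "((nat \<Rightarrow> real) \<Rightarrow> real \<Rightarrow> real) \<Rightarrow> real \<Rightarrow> (nat \<Rightarrow> real) \<Rightarrow> real" where
  "backward_heat u t x = elliptic (\<lambda>z. u z t) x + deriv (\<lambda>s. u x s) t"

lemma continuous_backward_heat: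
  assumes U: "\<And>k. C_class (Suc d) k (\<lambda>z. u (restrict z {..<d}) (z d))"
  shows "continuous_on (Rd d) (backward_heat u t)"
proof -
  let ?U = "\<lambda>z. u (restrict z {..<d}) (z d)"
  have "C_class d 0 (\<lambda>x. partial_deriv d ?U (x(d := t)))"
    by (rule C_class_slice[OF C_class_SucD(1)[OF U]]) simp
  then have "continuous_on (Rd d) (\<lambda>x. elliptic (\<lambda>z. u z t) x + partial_deriv d ?U (x(d := t)))"
    unfolding C_class.simps(1) by (rule continuous_on_add[OF continuous_elliptic[OF C_class_space_slice[OF U]]])
  then show ?thesis
    by (rule continuous_on_eq) (simp only: backward_heat_def DERIV_imp_deriv[OF has_derivative_time_slice[OF U]])
qed

text \<open>The square of P - V u / 4 is at most 2 P^2 + V^2 u^2 / 8. Then V^2 \<le> \<epsilon>^2 /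
  t^2 trades the two extra powers of t for \<epsilon>^2, which lowers the weight of \<open>u\<close>
  from q + 2 to q.\<close>

lemma gauss_norm_split:
  assumes "continuous_on (Rd d) P" "continuous_on (Rd d) u" "t > 0"
    and small: "AE x in lborel_Rd d. \<bar>t * V x\<bar> \<le> \<epsilon>"
  shows "ennreal (t powr (q + 2)) * gauss_norm (\<lambda>x. P x - V x / 4 * u x) t
     \<le> 2 * (ennreal (t powr (q + 2)) * gauss_norm P t) + ennreal (\<epsilon>\<^sup>2 / 8) * (ennreal (t powr q) * gauss_norm u t)"
proof -
  let ?e = "\<lambda>x. exp (- (\<Sum>i<d. (h x i)\<^sup>2) / (4 * t))"
  note [measurable] = borel_measurable_continuous_Rd[OF assms(1)] borel_measurable_continuous_Rd[OF assms(2)] weight_measurable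
  have "gauss_norm (\<lambda>x. P x - V x / 4 * u x) t
    \<le> (\<integral>\<^sup>+x. 2 * ennreal ((P x)\<^sup>2 * ?e x) + ennreal (\<epsilon>\<^sup>2 / (8 * t\<^sup>2)) * ennreal ((u x)\<^sup>2 * ?e x) \<partial>lborel_Rd d)"
    unfolding gauss_norm_def
  proof (rule nn_integral_mono_AE)
    show "AE x in lborel_Rd d. ennreal ((P x - V x / 4 * u x)\<^sup>2 * ?e x)
      \<le> 2 * ennreal ((P x)\<^sup>2 * ?e x) + ennreal (\<epsilon>\<^sup>2 / (8 * t\<^sup>2)) * ennreal ((u x)\<^sup>2 * ?e x)"
      using small
    proof (rule AE_mp, intro AE_I2 impI)
      fix x assume "\<bar>t * V x\<bar> \<le> \<epsilon>"
      then have "(t * V x)\<^sup>2 \<le> \<epsilon>\<^sup>2" using power_mono[of "\<bar>t * V x\<bar>" \<epsilon> 2] by simp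
      then have V: "(V x)\<^sup>2 \<le> \<epsilon>\<^sup>2 / t\<^sup>2" using \<open>t > 0\<close> by (simp add: power_mult_distrib field_simps)
      have "(P x - V x / 4 * u x)\<^sup>2 + (P x + V x / 4 * u x)\<^sup>2 = 2 * (P x)\<^sup>2 + (V x)\<^sup>2 / 8 * (u x)\<^sup>2"
        by (simp add: power2_eq_square field_simps)
      then have "(P x - V x / 4 * u x)\<^sup>2 \<le> 2 * (P x)\<^sup>2 + (V x)\<^sup>2 / 8 * (u x)\<^sup>2"
        using zero_le_power2[of "P x + V x / 4 * u x"] by linarith
      also have "\<dots> \<le> 2 * (P x)\<^sup>2 + (\<epsilon>\<^sup>2 / t\<^sup>2) / 8 * (u x)\<^sup>2"
        using V by (intro add_left_mono mult_right_mono divide_right_mono) auto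
      finally have "(P x - V x / 4 * u x)\<^sup>2 * ?e x \<le> (2 * (P x)\<^sup>2 + (\<epsilon>\<^sup>2 / t\<^sup>2) / 8 * (u x)\<^sup>2) * ?e x"
        by (intro mult_right_mono) auto
      also have "\<dots> = 2 * ((P x)\<^sup>2 * ?e x) + (\<epsilon>\<^sup>2 / (8 * t\<^sup>2)) * ((u x)\<^sup>2 * ?e x)" by (simp add: algebra_simps)
      finally have "ennreal ((P x - V x / 4 * u x)\<^sup>2 * ?e x) \<le> ennreal (2 * ((P x)\<^sup>2 * ?e x) + (\<epsilon>\<^sup>2 / (8 * t\<^sup>2)) * ((u x)\<^sup>2 * ?e x))"
        by (rule ennreal_leI)
      also have "\<dots> = 2 * ennreal ((P x)\<^sup>2 * ?e x) + ennreal (\<epsilon>\<^sup>2 / (8 * t\<^sup>2)) * ennreal ((u x)\<^sup>2 * ?e x)"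
        by (rule ennreal_lincomb) simp_all
      finally show "ennreal ((P x - V x / 4 * u x)\<^sup>2 * ?e x)
        \<le> 2 * ennreal ((P x)\<^sup>2 * ?e x) + ennreal (\<epsilon>\<^sup>2 / (8 * t\<^sup>2)) * ennreal ((u x)\<^sup>2 * ?e x)" .
    qed
  qed
  also have "\<dots> = 2 * gauss_norm P t + ennreal (\<epsilon>\<^sup>2 / (8 * t\<^sup>2)) * gauss_norm u t"
  proof -
    have "(\<lambda>x. ennreal ((P x)\<^sup>2 * ?e x)) \<in> borel_measurable (lborel_Rd d)" "(\<lambda>x. ennreal ((u x)\<^sup>2 * ?e x)) \<in> borel_measurable (lborel_Rd d)"
      by measurable
    then show ?thesis unfolding gauss_norm_def by (simp add: nn_integral_add nn_integral_cmult)
  qed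
  finally have "ennreal (t powr (q + 2)) * gauss_norm (\<lambda>x. P x - V x / 4 * u x) t
    \<le> ennreal (t powr (q + 2)) * (2 * gauss_norm P t + ennreal (\<epsilon>\<^sup>2 / (8 * t\<^sup>2)) * gauss_norm u t)"
    by (rule mult_left_mono) simp
  also have "\<dots> = 2 * (ennreal (t powr (q + 2)) * gauss_norm P t) + (ennreal (t powr (q + 2)) * ennreal (\<epsilon>\<^sup>2 / (8 * t\<^sup>2))) * gauss_norm u t"
    by (simp add: distrib_left mult_ac)
  also have "ennreal (t powr (q + 2)) * ennreal (\<epsilon>\<^sup>2 / (8 * t\<^sup>2)) = ennreal (\<epsilon>\<^sup>2 / 8) * ennreal (t powr q)"
    using \<open>t > 0\<close> by (simp add: ennreal_mult'[symmetric] powr_add)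
  finally show ?thesis by (simp add: mult.assoc)
qed

text \<open>Hardy's inequality in each mode bounds the integral of \<open>l\<close> by 4 /
  \<epsilon>^2 times that of \<open>y\<close>, where \<open>y\<close> contains the heat operator
  minus the potential term; \<open>gauss_norm_split\<close> bounds \<open>y\<close> by 2
  \<open>r\<close> + (\<epsilon>^2 / 8) \<open>l\<close>. Hence l \<le> (8 / \<epsilon>^2) r + l / 2
  for the integrals, and the half is absorbed.\<close>

theorem carleman_supported:
  fixes u :: "(nat \<Rightarrow> real) \<Rightarrow> real \<Rightarrow> real"
  assumes U: "\<And>k. C_class (Suc d) k (\<lambda>z. u (restrict z {..<d}) (z d))"
    and R: "\<And>t. vanishes_off d R (\<lambda>x. u x t)"
    and t01: "0 < t0" "t0 \<le> t1" "\<And>x t. x \<in> Rd d \<Longrightarrow> t \<notin> {t0..t1} \<Longrightarrow> u x t = 0"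
    and \<epsilon>: "\<epsilon> > 0" "\<And>n::nat. \<epsilon> \<le> \<bar>2 * \<alpha> - real d / 2 - 1 - real n\<bar>"
    and small: "\<And>t. t \<in> {t0..t1} \<Longrightarrow> AE x in lborel_Rd d. \<bar>t * potential x\<bar> \<le> \<epsilon>"
  shows "(\<integral>\<^sup>+t. ennreal (t powr (- 2 * \<alpha>)) * gauss_norm (\<lambda>x. u x t) t * indicator {t0..t1} t \<partial>lborel)
    \<le> ennreal (16 / \<epsilon>\<^sup>2) * (\<integral>\<^sup>+t. ennreal (t powr (- 2 * \<alpha> + 2)) * gauss_norm (backward_heat u t) t * indicator {t0..t1} t \<partial>lborel)"
proof -
  define U where "U z = u (restrict z {..<d}) (z d)" for z
  have CU: "C_class (Suc d) k U" for k using assms(1)[of k] by (simp add: U_def[abs_def])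
  have Uu: "U (x(d := t)) = u x t" if "x \<in> Rd d" for x t
    using restrict_update_Rd[OF that] by (simp add: U_def)
  define ut where "ut x t = partial_deriv d U (x(d := t))" for x t
  define p where "p t x = backward_heat u t x - potential x / 4 * u x t" for t x
  note Cu = C_class_space_slice[OF assms(1)]
  have dut: "((\<lambda>s. u x s) has_field_derivative ut x t) (at t)" if x: "x \<in> Rd d" for x t
    unfolding ut_def U_def[abs_def] by (rule has_derivative_time_slice[OF assms(1) x])
  have bh: "backward_heat u t x = elliptic (\<lambda>z. u z t) x + ut x t" if "x \<in> Rd d" for x t
    using DERIV_imp_deriv[OF dut[OF that]] by (simp add: backward_heat_def)
  have cu: "continuous_on (Rd d \<times> {0<..}) (\<lambda>(x, t). u x t)"
  proof (rule continuous_on_eq[OF continuous_on_Rd_time[OF C_class_continuous[OF CU[of 0]]]])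
    fix z :: "(nat \<Rightarrow> real) \<times> real" assume "z \<in> Rd d \<times> {0<..}"
    then show "(case z of (x, t) \<Rightarrow> U (x(d := t))) = (case z of (x, t) \<Rightarrow> u x t)"
      by (auto simp only: mem_Times_iff case_prod_beta Uu)
  qed
  have cut: "continuous_on (Rd d \<times> {0<..}) (\<lambda>(x, t). ut x t)"
    unfolding ut_def by (rule continuous_on_Rd_time[OF C_class_continuous[OF C_class_SucD(1)[OF CU]]]) simp
  have vut: "vanishes_off d R (\<lambda>x. ut x t)" for t
    unfolding vanishes_off_def
  proof (intro ballI impI)
    fix x assume x: "x \<in> Rd d" "x \<notin> cube d R"
    have "(\<lambda>s. u x s) = (\<lambda>s. 0)" using R x by (auto simp: vanishes_off_def)
    then have "((\<lambda>s. 0) has_field_derivative ut x t) (at t)" using dut[OF x(1), of t] by simp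
    from DERIV_unique[OF this DERIV_const] show "ut x t = 0" .
  qed
  have cut_t: "continuous_on (Rd d) (\<lambda>x. ut x t)" if "t > 0" for t
    by (rule continuous_on_slice[OF cut]) (use that in simp)
  have cell: "continuous_on (Rd d) (elliptic (\<lambda>z. u z t))" for t by (rule continuous_elliptic[OF Cu])
  have vell: "vanishes_off d R (elliptic (\<lambda>z. u z t))" for t
    by (rule integral_elliptic_symmetric(3)[OF Cu R C_sqrt_jac])
  have cP: "continuous_on (Rd d) (backward_heat u t)" for t
    by (rule continuous_backward_heat[OF assms(1)])
  have vP: "vanishes_off d R (backward_heat u t)" for t
    using vell[of t] vut[of t] by (auto simp: vanishes_off_def bh)
  have cp: "continuous_on (Rd d) (p t)" if "t > 0" for t
    unfolding p_def[abs_def] by (intro continuous_intros cP continuous_potential C_class_continuous[OF Cu[of 0]]) auto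
  have vp: "vanishes_off d R (p t)" for t
    using vP[of t] R[of t] by (auto simp: vanishes_off_def p_def)
  define A where "A a t = (LINT x|lborel_Rd d. u x t * mode a t x)" for a t
  define A' where "A' a t = (LINT x|lborel_Rd d. ut x t * mode a t x + (\<Sum>m<d. mode (a(m := a m + 2)) t x) * u x t)" for a t
  have jm: "continuous_on (Rd d \<times> {0<..}) (\<lambda>(x, t). F x t * G x t)"
    if "continuous_on (Rd d \<times> {0<..}) (\<lambda>(x, t). F x t)" "continuous_on (Rd d \<times> {0<..}) (\<lambda>(x, t). G x t)" for F G :: "(nat \<Rightarrow> real) \<Rightarrow> real \<Rightarrow> real"
    using continuous_on_mult[OF that] by (simp add: case_prod_beta)
  have cA': "continuous_on (Rd d \<times> {0<..}) (\<lambda>(x, t). ut x t * mode a t x + (\<Sum>m<d. mode (a(m := a m + 2)) t x) * u x t)" for a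
  proof -
    have "continuous_on (Rd d \<times> {0<..}) (\<lambda>(x, t). \<Sum>m<d. mode (a(m := a m + 2)) t x)"
      using continuous_on_sum[of "{..<d}" "Rd d \<times> {0<..}" "\<lambda>m (x, t). mode (a(m := a m + 2)) t x"] continuous_mode
      by (simp add: case_prod_beta)
    from continuous_on_add[OF jm[OF cut continuous_mode] jm[OF this cu]] show ?thesis by (simp add: case_prod_beta)
  qed
  have cum: "continuous_on (Rd d) (\<lambda>x. u x t * mode a t x)" if "t > 0" for a t
    by (intro continuous_on_mult C_class_continuous[OF Cu[of 0]] C_class_continuous[OF C_mode[OF that]])
  have vum: "vanishes_off d R (\<lambda>x. u x t * mode a t x)" for a t using R[of t] by (auto simp: vanishes_off_def)
  have dform: "((\<lambda>t. u x t * mode a t x) has_field_derivative ut x t * mode a t x + (\<Sum>m<d. mode (a(m := a m + 2)) t x) * u x t) (at t)"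
    if "x \<in> Rd d" "t > 0" for a x t
    by (rule DERIV_mult[OF dut[OF that(1)] has_derivative_mode_time[OF that(2)]])
  have dA: "(A a has_field_derivative A' a t) (at t)" if "t > 0" for a t
    unfolding A_def[abs_def] A'_def by (rule derivative_integral_Rd(1)[OF cum vum dform cA' that])
  have cA'': "continuous_on {0<..} (A' a)" for a
    unfolding A'_def[abs_def] by (rule derivative_integral_Rd(2)[OF cum vum dform cA'])
  have cA: "continuous_on {0<..} (A a)" for a
    by (rule DERIV_continuous_on) (use dA has_field_derivative_at_within in blast)
  have i1: "integrable (lborel_Rd d) (\<lambda>x. ut x t * mode a t x)" if "t > 0" for a t
    by (rule integrable_vanishes_off[of d _ R])
      (use vut[of t] in \<open>auto intro!: continuous_on_mult cut_t C_class_continuous[OF C_mode] that simp: vanishes_off_def\<close>)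
  \<comment> \<open>The derivative of a coefficient of \<open>u\<close> is the same coefficient of
    \<open>p\<close>: the term with the differentiated mode is moved back onto \<open>u\<close> by
    \<open>integral_mode_elliptic\<close>.\<close>
  have A'p: "A' a t = (LINT x|lborel_Rd d. p t x * mode a t x)" if t: "t > 0" for a t
  proof -
    have i2: "integrable (lborel_Rd d) (\<lambda>x. (\<Sum>m<d. mode (a(m := a m + 2)) t x) * u x t)"
      by (rule integrable_vanishes_off[of d _ R])
        (use R[of t] in \<open>auto intro!: continuous_on_mult continuous_on_sum C_class_continuous[OF C_mode] t C_class_continuous[OF Cu[of 0]] simp: vanishes_off_def\<close>)
    have i3: "integrable (lborel_Rd d) (\<lambda>x. (elliptic (\<lambda>z. u z t) x - potential x / 4 * u x t) * mode a t x)"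
      by (rule integrable_vanishes_off[of d _ R])
        (use R[of t] vell[of t] in \<open>auto intro!: continuous_intros cell continuous_potential C_class_continuous[OF C_mode] t C_class_continuous[OF Cu[of 0]] simp: vanishes_off_def\<close>)
    have "A' a t = (LINT x|lborel_Rd d. ut x t * mode a t x) + (LINT x|lborel_Rd d. (\<Sum>m<d. mode (a(m := a m + 2)) t x) * u x t)"
      unfolding A'_def by (rule Bochner_Integration.integral_add[OF i1[OF t] i2])
    also have "(LINT x|lborel_Rd d. (\<Sum>m<d. mode (a(m := a m + 2)) t x) * u x t)
      = (LINT x|lborel_Rd d. (elliptic (\<lambda>z. u z t) x - potential x / 4 * u x t) * mode a t x)"
      using integral_mode_elliptic[OF Cu R t, of t a] by (simp only: mult.commute[of "u _ _"])
    also have "(LINT x|lborel_Rd d. ut x t * mode a t x) + \<dots>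
      = (LINT x|lborel_Rd d. ut x t * mode a t x + (elliptic (\<lambda>z. u z t) x - potential x / 4 * u x t) * mode a t x)"
      by (rule Bochner_Integration.integral_add[OF i1[OF t] i3, symmetric])
    also have "\<dots> = (LINT x|lborel_Rd d. p t x * mode a t x)"
      by (intro Bochner_Integration.integral_cong refl) (simp add: p_def bh space_PiM algebra_simps)
    finally show ?thesis .
  qed
  have cb_p: "continuous_on {0<..} (\<lambda>t. LINT x|lborel_Rd d. p t x * mode a t x)" for a
    by (rule continuous_on_eq[OF cA'']) (simp add: A'p)
  have cb_V: "continuous_on {0<..} (\<lambda>t. LINT x|lborel_Rd d. potential x / 4 * u x t * mode a t x)" for a
  proof (rule continuous_integral_Rd[of d R])
    show "vanishes_off d R (\<lambda>x. potential x / 4 * u x t * mode a t x)" if "t > 0" for t using R[of t] by (auto simp: vanishes_off_def)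
    have "continuous_on (Rd d \<times> {0<..}) (\<lambda>(x, t::real). potential x / 4)"
      using continuous_on_divide[OF continuous_on_fst_Rd[OF continuous_potential, of "{0<..}"] continuous_on_const[of _ 4]]
      by (simp add: case_prod_beta)
    then show "continuous_on (Rd d \<times> {0<..}) (\<lambda>(x, t). potential x / 4 * u x t * mode a t x)"
      by (intro jm cu continuous_mode)
  qed
  \<comment> \<open>Gives the measurability in t of the right side \<open>r\<close>. The coefficient
    is the sum of that of \<open>p\<close>, continuous as a derivative just computed, and that of
    the potential term.\<close>
  have cb_P: "continuous_on {0<..} (\<lambda>t. LINT x|lborel_Rd d. backward_heat u t x * mode a t x)" for a
  proof (rule continuous_on_eq[OF continuous_on_add[OF cb_p cb_V]])
    fix t :: real assume "t \<in> {0<..}"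
    then have t: "t > 0" by simp
    have "integrable (lborel_Rd d) (\<lambda>x. p t x * mode a t x)"
      by (rule integrable_vanishes_off[of d _ R])
        (use vp[of t] in \<open>auto intro!: continuous_on_mult cp C_class_continuous[OF C_mode] t simp: vanishes_off_def\<close>)
    moreover have "integrable (lborel_Rd d) (\<lambda>x. potential x / 4 * u x t * mode a t x)"
      by (rule integrable_vanishes_off[of d _ R])
        (use R[of t] in \<open>auto intro!: continuous_intros continuous_potential C_class_continuous[OF C_mode] t C_class_continuous[OF Cu[of 0]] simp: vanishes_off_def\<close>)
    ultimately have "(LINT x|lborel_Rd d. p t x * mode a t x) + (LINT x|lborel_Rd d. potential x / 4 * u x t * mode a t x)
      = (LINT x|lborel_Rd d. p t x * mode a t x + potential x / 4 * u x t * mode a t x)"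
      by (rule Bochner_Integration.integral_add[symmetric])
    also have "\<dots> = (LINT x|lborel_Rd d. backward_heat u t x * mode a t x)"
      by (simp add: p_def algebra_simps)
    finally show "(LINT x|lborel_Rd d. p t x * mode a t x) + (LINT x|lborel_Rd d. potential x / 4 * u x t * mode a t x)
      = (LINT x|lborel_Rd d. backward_heat u t x * mode a t x)" .
  qed
  obtain m where m: "\<And>a. m a \<ge> (0::real)" and
    ps: "\<forall>p R t. continuous_on (Rd d) p \<longrightarrow> vanishes_off d R p \<longrightarrow> t > 0 \<longrightarrow>
      gauss_norm p t = (\<integral>\<^sup>+a. ennreal (m a * t powr ((\<Sum>i<d. real (a i)) + real d / 2) * (LINT x|lborel_Rd d. p x * mode a t x)\<^sup>2)
          \<partial>(\<Pi>\<^sub>M i\<in>{..<d}. count_space UNIV))"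
    using transported_parseval[folded gauss_norm_def] by blast
  let ?I = "{..<d} \<rightarrow>\<^sub>E (UNIV :: nat set)"
  note wp = weighted_parseval[OF m ps]
  have cu0: "continuous_on (Rd d) (\<lambda>x. u x t)" for t by (rule C_class_continuous[OF Cu[of 0]])
  define l where "l t = ennreal (t powr (- 2 * \<alpha>)) * gauss_norm (\<lambda>x. u x t) t * indicator {t0..t1} t" for t
  define y where "y t = ennreal (t powr (- 2 * \<alpha> + 2)) * gauss_norm (p t) t * indicator {t0..t1} t" for t
  define r where "r t = ennreal (t powr (- 2 * \<alpha> + 2)) * gauss_norm (backward_heat u t) t * indicator {t0..t1} t" for t
  have lm: "l \<in> borel_measurable lborel"
    unfolding l_def[abs_def] by (rule wp(1)[OF cu0 R cA[unfolded A_def[abs_def]] t01(1)])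
  have rm: "r \<in> borel_measurable lborel"
    unfolding r_def[abs_def] by (rule wp(1)[OF cP vP cb_P t01(1)])
  have l_eq: "(\<integral>\<^sup>+t. l t \<partial>lborel) = (\<integral>\<^sup>+a. ennreal (m a) * (\<integral>\<^sup>+t. ennreal (t powr (- 2 * \<alpha> + (\<Sum>i<d. real (a i)) + real d / 2) * (A a t)\<^sup>2)
         * indicator {t0..t1} t \<partial>lborel) \<partial>count_space ?I)"
    unfolding l_def A_def by (rule wp(2)[OF cu0 R cA[unfolded A_def[abs_def]] t01(1)])
  have y_eq: "(\<integral>\<^sup>+t. y t \<partial>lborel) = (\<integral>\<^sup>+a. ennreal (m a) * (\<integral>\<^sup>+t. ennreal (t powr (- 2 * \<alpha> + 2 + (\<Sum>i<d. real (a i)) + real d / 2) * (LINT x|lborel_Rd d. p t x * mode a t x)\<^sup>2)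
         * indicator {t0..t1} t \<partial>lborel) \<partial>count_space ?I)"
    unfolding y_def by (rule wp(2)[OF cp vp cb_p t01(1)])
  have ly: "(\<integral>\<^sup>+t. l t \<partial>lborel) \<le> ennreal (4 / \<epsilon>\<^sup>2) * (\<integral>\<^sup>+t. y t \<partial>lborel)"
  proof -
    have "(\<integral>\<^sup>+t. l t \<partial>lborel) \<le> (\<integral>\<^sup>+a. ennreal (4 / \<epsilon>\<^sup>2) * (ennreal (m a) * (\<integral>\<^sup>+t. ennreal (t powr (- 2 * \<alpha> + 2 + (\<Sum>i<d. real (a i)) + real d / 2) * (LINT x|lborel_Rd d. p t x * mode a t x)\<^sup>2)
         * indicator {t0..t1} t \<partial>lborel)) \<partial>count_space ?I)"
      unfolding l_eq
    proof (rule nn_integral_mono)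
      fix a :: "nat \<Rightarrow> nat"
      define q where "q = - 2 * \<alpha> + (\<Sum>i<d. real (a i)) + real d / 2"
      \<comment> \<open>The natural number that matters is the total degree of the multi-index: q +
        1 = |a| - (2 \<alpha> - d/2 - 1).\<close>
      have "\<epsilon> \<le> \<bar>2 * \<alpha> - real d / 2 - 1 - real (\<Sum>i<d. a i)\<bar>" by (rule \<epsilon>(2))
      then have q: "\<epsilon> \<le> \<bar>q + 1\<bar>" by (simp add: q_def abs_minus_commute algebra_simps)
      have "A a t = 0" if "t > 0" "t \<notin> {t0..t1}" for t
      proof -
        have "A a t = (LINT x|lborel_Rd d. 0)"
          unfolding A_def by (intro Bochner_Integration.integral_cong refl) (simp add: t01(3) that(2)[simplified] space_PiM)
        then show ?thesis by simp
      qed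
      then have "(\<integral>\<^sup>+t. ennreal (t powr q * (A a t)\<^sup>2) * indicator {t0..t1} t \<partial>lborel)
        \<le> ennreal (4 / \<epsilon>\<^sup>2) * (\<integral>\<^sup>+t. ennreal (t powr (q + 2) * (A' a t)\<^sup>2) * indicator {t0..t1} t \<partial>lborel)"
        by (intro weighted_hardy[OF dA cA'' t01(1,2) _ \<epsilon>(1) q])
      also have "(\<integral>\<^sup>+t. ennreal (t powr (q + 2) * (A' a t)\<^sup>2) * indicator {t0..t1} t \<partial>lborel)
        = (\<integral>\<^sup>+t. ennreal (t powr (- 2 * \<alpha> + 2 + (\<Sum>i<d. real (a i)) + real d / 2) * (LINT x|lborel_Rd d. p t x * mode a t x)\<^sup>2) * indicator {t0..t1} t \<partial>lborel)"
      proof (rule nn_integral_cong)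
        fix t :: real
        have qe: "q + 2 = - 2 * \<alpha> + 2 + (\<Sum>i<d. real (a i)) + real d / 2" by (simp add: q_def)
        show "ennreal (t powr (q + 2) * (A' a t)\<^sup>2) * indicator {t0..t1} t
          = ennreal (t powr (- 2 * \<alpha> + 2 + (\<Sum>i<d. real (a i)) + real d / 2) * (LINT x|lborel_Rd d. p t x * mode a t x)\<^sup>2) * indicator {t0..t1} t"
        proof (cases "t \<in> {t0..t1}")
          case True
          then have "t > 0" using t01(1) by simp
          from A'p[OF this, of a] show ?thesis by (simp only: qe)
        qed simp
      qed
      finally show "ennreal (m a) * (\<integral>\<^sup>+t. ennreal (t powr (- 2 * \<alpha> + (\<Sum>i<d. real (a i)) + real d / 2) * (A a t)\<^sup>2) * indicator {t0..t1} t \<partial>lborel)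
        \<le> ennreal (4 / \<epsilon>\<^sup>2) * (ennreal (m a) * (\<integral>\<^sup>+t. ennreal (t powr (- 2 * \<alpha> + 2 + (\<Sum>i<d. real (a i)) + real d / 2) * (LINT x|lborel_Rd d. p t x * mode a t x)\<^sup>2)
         * indicator {t0..t1} t \<partial>lborel))"
        unfolding q_def mult.left_commute[of "ennreal (4 / \<epsilon>\<^sup>2)"] by (rule mult_left_mono) simp
    qed
    also have "\<dots> = ennreal (4 / \<epsilon>\<^sup>2) * (\<integral>\<^sup>+t. y t \<partial>lborel)"
      unfolding y_eq by (rule nn_integral_cmult) simp
    finally show ?thesis .
  qed
  have "(\<integral>\<^sup>+t. y t \<partial>lborel) \<le> (\<integral>\<^sup>+t. 2 * r t + ennreal (\<epsilon>\<^sup>2 / 8) * l t \<partial>lborel)"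
  proof (rule nn_integral_mono)
    fix t :: real
    show "y t \<le> 2 * r t + ennreal (\<epsilon>\<^sup>2 / 8) * l t"
    proof (cases "t \<in> {t0..t1}")
      case True
      then have "t > 0" using t01(1) by simp
      from gauss_norm_split[OF cP cu0[of t] this small[OF True], of "- 2 * \<alpha>"]
      show ?thesis using True unfolding y_def r_def l_def p_def[abs_def] by simp
    qed (simp add: y_def)
  qed
  also have "\<dots> = 2 * (\<integral>\<^sup>+t. r t \<partial>lborel) + ennreal (\<epsilon>\<^sup>2 / 8) * (\<integral>\<^sup>+t. l t \<partial>lborel)"
    using lm rm by (simp add: nn_integral_add nn_integral_cmult)
  finally have "(\<integral>\<^sup>+t. l t \<partial>lborel) \<le> ennreal (4 / \<epsilon>\<^sup>2) * (2 * (\<integral>\<^sup>+t. r t \<partial>lborel) + ennreal (\<epsilon>\<^sup>2 / 8) * (\<integral>\<^sup>+t. l t \<partial>lborel))"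
    using ly by (meson mult_left_mono order_trans zero_le)
  also have "\<dots> = (ennreal (4 / \<epsilon>\<^sup>2) * 2) * (\<integral>\<^sup>+t. r t \<partial>lborel) + (ennreal (4 / \<epsilon>\<^sup>2) * ennreal (\<epsilon>\<^sup>2 / 8)) * (\<integral>\<^sup>+t. l t \<partial>lborel)"
    by (simp add: distrib_left mult.assoc)
  also have "ennreal (4 / \<epsilon>\<^sup>2) * ennreal (\<epsilon>\<^sup>2 / 8) = ennreal (1 / 2)"
    using \<epsilon>(1) by (simp add: ennreal_mult'[symmetric])
  finally have absorb: "(\<integral>\<^sup>+t. l t \<partial>lborel) \<le> (ennreal (4 / \<epsilon>\<^sup>2) * 2) * (\<integral>\<^sup>+t. r t \<partial>lborel) + ennreal (1 / 2) * (\<integral>\<^sup>+t. l t \<partial>lborel)" .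
  \<comment> \<open>Absorbing half of the left side requires it to be finite. It is, since
    \<open>u\<close> is bounded and supported in a cube times {t0..t1}, where the power of t is
    bounded too.\<close>
  have fin: "(\<integral>\<^sup>+t. l t \<partial>lborel) < \<infinity>"
  proof -
    obtain B where B: "B \<ge> 0" "\<And>x t. x \<in> cube d R \<Longrightarrow> t \<in> {t0..t1} \<Longrightarrow> \<bar>u x t\<bar> \<le> B"
      using bounded_on_cube_interval[OF cu t01(1), of R t1] by blast
    have "compact ((\<lambda>t. t powr (- 2 * \<alpha>)) ` {t0..t1})"
      using t01(1) by (intro compact_continuous_image continuous_intros) auto
    then obtain M where M: "\<And>s. s \<in> (\<lambda>t. t powr (- 2 * \<alpha>)) ` {t0..t1} \<Longrightarrow> \<bar>s\<bar> \<le> M"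
      using compact_imp_bounded by (metis bounded_real)
    let ?K = "ennreal (B\<^sup>2) * emeasure (lborel_Rd d) (cube d R)"
    have "l t \<le> (ennreal M * ?K) * indicator {t0..t1} t" for t
    proof (cases "t \<in> {t0..t1}")
      case True
      have "gauss_norm (\<lambda>x. u x t) t \<le> (\<integral>\<^sup>+x. ennreal (B\<^sup>2) * indicator (cube d R) x \<partial>lborel_Rd d)"
        unfolding gauss_norm_def
      proof (rule nn_integral_mono)
        fix x assume "x \<in> space (lborel_Rd d)"
        then have x: "x \<in> Rd d" by (simp add: space_PiM)
        show "ennreal ((u x t)\<^sup>2 * exp (- (\<Sum>i<d. (h x i)\<^sup>2) / (4 * t))) \<le> ennreal (B\<^sup>2) * indicator (cube d R) x"
        proof (cases "x \<in> cube d R")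
          case xK: True
          have "(u x t)\<^sup>2 \<le> B\<^sup>2" using power_mono[OF B(2)[OF xK True], of 2] by simp
          moreover have "exp (- (\<Sum>i<d. (h x i)\<^sup>2) / (4 * t)) \<le> 1"
            using True t01(1) by (auto intro!: divide_nonneg_pos sum_nonneg)
          ultimately have "(u x t)\<^sup>2 * exp (- (\<Sum>i<d. (h x i)\<^sup>2) / (4 * t)) \<le> B\<^sup>2 * 1"
            by (intro mult_mono) auto
          then show ?thesis using xK by (simp add: ennreal_leI)
        qed (use R[of t] x in \<open>simp add: vanishes_off_def\<close>)
      qed
      also have "\<dots> = ?K" by (simp add: nn_integral_cmult_indicator cube_measurable)
      finally have "gauss_norm (\<lambda>x. u x t) t \<le> ?K" .
      moreover have "ennreal (t powr (- 2 * \<alpha>)) \<le> ennreal M" using M[of "t powr (- 2 * \<alpha>)"] True by (intro ennreal_leI) auto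
      ultimately show ?thesis using True unfolding l_def by (simp add: mult_mono)
    qed (simp add: l_def)
    then have "(\<integral>\<^sup>+t. l t \<partial>lborel) \<le> (\<integral>\<^sup>+t. (ennreal M * ?K) * indicator {t0..t1} t \<partial>lborel)" by (intro nn_integral_mono)
    also have "\<dots> = (ennreal M * ?K) * emeasure lborel {t0..t1}" by (simp add: nn_integral_cmult_indicator)
    also have "\<dots> < \<infinity>" using emeasure_cube[of d R] t01(2) by (simp add: ennreal_mult_less_top)
    finally show ?thesis .
  qed
  have "(\<integral>\<^sup>+t. l t \<partial>lborel) \<le> 2 * ((ennreal (4 / \<epsilon>\<^sup>2) * 2) * (\<integral>\<^sup>+t. r t \<partial>lborel))"
    by (rule ennreal_absorb_half[OF absorb fin])
  also have "\<dots> = (2 * (ennreal (4 / \<epsilon>\<^sup>2) * 2)) * (\<integral>\<^sup>+t. r t \<partial>lborel)" by (simp only: mult.assoc)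
  also have "2 * (ennreal (4 / \<epsilon>\<^sup>2) * 2) = ennreal (16 / \<epsilon>\<^sup>2)"
    by (simp add: ennreal_mult'[symmetric] mult.commute flip: ennreal_numeral)
  finally show ?thesis unfolding l_def r_def .
qed

end

text \<open>The support is compact and lies over \<open>T\<close>, so its projection to time attains
  a least and a greatest element in \<open>T\<close>; in particular it keeps away from time 0. The
  first alternative is the zero function, whose support has no such times.\<close>

lemma test_function_support:
  assumes u: "u \<in> test_functions d (Rd d \<times> T - Z)" and conv: "\<And>s. s \<in> T \<Longrightarrow> s > (0::real)"
  obtains "\<And>x t. x \<in> Rd d \<Longrightarrow> u x t = 0"
  | R t0 t1 where "0 < t0" "t0 \<le> t1" "t0 \<in> T" "t1 \<in> T" "\<And>t. vanishes_off d R (\<lambda>x. u x t)"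
      "\<And>x t. x \<in> Rd d \<Longrightarrow> t \<notin> {t0..t1} \<Longrightarrow> u x t = 0"
proof (cases "\<forall>x\<in>Rd d. \<forall>t. u x t = 0")
  case False
  define K where "K = closure {(x, t). x \<in> Rd d \<and> u x t \<noteq> 0}"
  have K: "compact K" "K \<subseteq> Rd d \<times> T - Z" using u by (auto simp: test_functions_def K_def)
  have inK: "(x, t) \<in> K" if "x \<in> Rd d" "u x t \<noteq> 0" for x t
    unfolding K_def by (rule subsetD[OF closure_subset]) (use that in simp)
  have ne: "K \<noteq> {}" using False inK by blast
  have time: "compact (snd ` K)" "snd ` K \<noteq> {}"
    using ne by (auto intro!: compact_continuous_image K continuous_on_snd continuous_on_id)
  obtain t0 where t0: "t0 \<in> snd ` K" "\<And>s. s \<in> snd ` K \<Longrightarrow> t0 \<le> s" using compact_attains_inf[OF time] by blast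
  obtain t1 where t1: "t1 \<in> snd ` K" "\<And>s. s \<in> snd ` K \<Longrightarrow> s \<le> t1" using compact_attains_sup[OF time] by blast
  have "\<exists>B. \<forall>z\<in>K. \<bar>fst z i\<bar> \<le> B" for i
  proof -
    have "continuous_on K (\<lambda>z. (\<lambda>x. x i) (fst z))"
      by (rule continuous_on_compose2[OF continuous_on_product_coordinates]) (auto intro: continuous_on_fst continuous_on_id)
    from compact_continuous_image[OF this K(1)] have "bounded ((\<lambda>z. fst z i) ` K)" by (rule compact_imp_bounded)
    then show ?thesis by (auto simp: bounded_real)
  qed
  then obtain B where B: "\<And>i z. z \<in> K \<Longrightarrow> \<bar>fst z i\<bar> \<le> B i" by metis
  define R where "R = Max (insert 0 (B ` {..<d}))"
  show ?thesis
  proof (rule that(2)[of t0 t1 R])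
    show "t0 \<in> T" "t1 \<in> T" using t0(1) t1(1) K(2) by auto
    then show "0 < t0" using conv by blast
    show "t0 \<le> t1" using t0(2)[OF t1(1)] .
    show "u x t = 0" if "x \<in> Rd d" "t \<notin> {t0..t1}" for x t
    proof (rule ccontr)
      assume "u x t \<noteq> 0"
      then have "t \<in> snd ` K" using inK[OF that(1)] by force
      then show False using t0(2) t1(2) that(2) by auto
    qed
    show "vanishes_off d R (\<lambda>x. u x t)" for t
      unfolding vanishes_off_def
    proof (intro ballI impI)
      fix x assume x: "x \<in> Rd d" "x \<notin> cube d R"
      show "u x t = 0"
      proof (rule ccontr)
        assume "u x t \<noteq> 0"
        then have z: "(x, t) \<in> K" using inK[OF x(1)] by blast
        have "\<bar>x i\<bar> \<le> R" if "i < d" for i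
        proof -
          have "B i \<le> R" unfolding R_def using that by (intro Max_ge) auto
          then show ?thesis using B[OF z, of i] by simp
        qed
        then show False using x by (simp add: cube_iff)
      qed
    qed
  qed
next
  case True
  then show ?thesis by (intro that(1)) blast
qed

text \<open>For 0 < N < \<infinity> the bound is t N < \<epsilon> sqrt(1 - \<delta>) \<le>
  \<epsilon>, and N dominates |V| almost everywhere. For N = 0 every t is admissible because V
  vanishes almost everywhere.\<close>

lemma AE_small_of_time_bound:
  assumes "\<epsilon> > 0" "0 < \<delta>" "\<delta> < 1" and N: "N = Linf_norm d V"
    and t: "0 < t" "ereal t < (if N = 0 then \<infinity> else ereal (\<epsilon> * sqrt (1 - \<delta>)) / N)"
  shows "AE x in lborel_Rd d. \<bar>t * V x\<bar> \<le> \<epsilon>"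
proof -
  have ae: "AE x in lborel_Rd d. ereal \<bar>V x\<bar> \<le> N" unfolding N Linf_norm_def by (rule esssup_AE)
  define c where "c = \<epsilon> * sqrt (1 - \<delta>)"
  have "sqrt (1 - \<delta>) \<le> 1" "sqrt (1 - \<delta>) > 0" using assms by auto
  then have c: "0 < c" "c \<le> \<epsilon>" using \<open>\<epsilon> > 0\<close> by (simp_all add: c_def)
  show ?thesis
  proof (cases N)
    case (real r)
    have "t * r \<le> \<epsilon>"
    proof (cases "r = 0")
      case False
      then have "t < c / r" using t(2) real by (simp add: c_def)
      then have "r > 0" using t(1) c(1) by (metis divide_less_0_iff less_trans linorder_neqE_linordered_idom not_less_iff_gr_or_eq False)
      then show ?thesis using \<open>t < c / r\<close> c(2) by (simp add: field_simps)
    qed (use \<open>\<epsilon> > 0\<close> in simp)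
    show ?thesis using ae
    proof (rule AE_mp, intro AE_I2 impI)
      fix x assume "ereal \<bar>V x\<bar> \<le> N"
      then have "\<bar>V x\<bar> \<le> r" using real by simp
      then have "t * \<bar>V x\<bar> \<le> t * r" using t(1) by (intro mult_left_mono) auto
      with \<open>t * r \<le> \<epsilon>\<close> have "t * \<bar>V x\<bar> \<le> \<epsilon>" by linarith
      then show "\<bar>t * V x\<bar> \<le> \<epsilon>" using t(1) by (simp add: abs_mult)
    qed
  \<comment> \<open>For infinite N the quotient in \<open>ereal\<close> is 0, which contradicts 0 <
    t.\<close>
  qed (use t in auto)
qed

section \<open>Return to the matrix expressions of the statement\<close>

context oriented_diffeo
begin

abbreviation Hinv :: "(nat \<Rightarrow> real) \<Rightarrow> real mat" where
  "Hinv x \<equiv> minv (jacobian_mat d h x)"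

lemma matrix_flux:
  assumes x: "x \<in> Rd d" and i: "i < d"
  shows "vec_index ((Hinv x * transpose_mat (Hinv x)) *\<^sub>v grad d f x) i = flux f i x"
proof -
  have "Hinv x * transpose_mat (Hinv x) = Matrix.mat d d (\<lambda>(i, j). Amat i j x)"
    unfolding minv_jacobian[OF x] Amat_def
    by (rule eq_matI) (auto simp: scalar_prod_def atLeast0LessThan)
  then show ?thesis
    using i by (simp add: scalar_prod_def grad_def flux_def atLeast0LessThan)
qed

lemma divergence_eq_elliptic:
  assumes x: "x \<in> Rd d"
  shows "divergence d (\<lambda>x. (Hinv x * transpose_mat (Hinv x)) *\<^sub>v grad d f x) x = elliptic f x"
  unfolding divergence_def elliptic_def
  by (rule sum.cong[OF refl], rule partial_deriv_cong[OF matrix_flux]) (simp_all only: x lessThan_iff)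

lemma potential_eq:
  assumes x: "x \<in> Rd d"
  shows "2 * divergence d (\<lambda>x. (Hinv x * transpose_mat (Hinv x)) *\<^sub>v grad d (\<lambda>y. ln (Determinant.det (jacobian_mat d h y))) x) x
      + (vlen (transpose_mat (Hinv x) *\<^sub>v grad d (\<lambda>y. ln (Determinant.det (jacobian_mat d h y))) x))\<^sup>2 = potential x"
proof -
  have ln: "(\<lambda>y. ln (Determinant.det (jacobian_mat d h y))) = ln_jac"
    by (simp add: ln_jac_def[abs_def] jac_def[abs_def])
  have "vec_index (transpose_mat (Hinv x) *\<^sub>v grad d ln_jac x) m = drift m x" if "m < d" for m
    unfolding minv_jacobian[OF x] using that
    by (simp add: scalar_prod_def grad_def drift_def atLeast0LessThan)
  moreover have "dim_vec (transpose_mat (Hinv x) *\<^sub>v grad d ln_jac x) = d"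
    unfolding minv_jacobian[OF x] by simp
  ultimately have "scalar_prod (transpose_mat (Hinv x) *\<^sub>v grad d ln_jac x) (transpose_mat (Hinv x) *\<^sub>v grad d ln_jac x)
    = (\<Sum>m<d. (drift m x)\<^sup>2)"
    by (simp add: scalar_prod_def atLeast0LessThan power2_eq_square del: index_mult_mat_vec)
  then have "(vlen (transpose_mat (Hinv x) *\<^sub>v grad d ln_jac x))\<^sup>2 = (\<Sum>m<d. (drift m x)\<^sup>2)"
    by (simp add: vlen_def sum_nonneg)
  then show ?thesis unfolding ln potential_def divergence_eq_elliptic[OF x] by simp
qed

lemma gauss_norm_weighted:
  assumes "continuous_on (Rd d) p" "\<And>x. x \<in> Rd d \<Longrightarrow> f x = p x"
  shows "(\<integral>\<^sup>+x. ennreal (\<bar>f x\<bar>\<^sup>2 * t powr q * exp (- (\<Sum>i<d. (h x i)\<^sup>2) / (4 * t))) \<partial>lborel_Rd d)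
    = ennreal (t powr q) * gauss_norm p t"
proof -
  note [measurable] = borel_measurable_continuous_Rd[OF assms(1)] weight_measurable
  have "(\<integral>\<^sup>+x. ennreal (\<bar>f x\<bar>\<^sup>2 * t powr q * exp (- (\<Sum>i<d. (h x i)\<^sup>2) / (4 * t))) \<partial>lborel_Rd d)
    = (\<integral>\<^sup>+x. ennreal (t powr q) * ennreal ((p x)\<^sup>2 * exp (- (\<Sum>i<d. (h x i)\<^sup>2) / (4 * t))) \<partial>lborel_Rd d)"
    using assms(2) by (intro nn_integral_cong) (simp add: space_PiM ennreal_mult'[symmetric] mult_ac)
  also have "\<dots> = ennreal (t powr q) * gauss_norm p t"
    unfolding gauss_norm_def by (rule nn_integral_cmult) measurable
  finally show ?thesis .
qed

text \<open>On the left only times in {t0..t1} contribute, as \<open>u\<close> vanishes at all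
  others; on the right the integrand is nonnegative, so the interval may be enlarged to all times
  below \<open>T0\<close>, which may be infinite.\<close>

theorem carleman_test_function:
  assumes u: "u \<in> test_functions d (Rd d \<times> {t. 0 < t \<and> ereal t < T0} - Z)"
    and \<epsilon>: "\<epsilon> > 0" "\<And>n::nat. \<epsilon> \<le> \<bar>2 * \<alpha> - real d / 2 - 1 - real n\<bar>"
    and small: "\<And>t. 0 < t \<Longrightarrow> ereal t < T0 \<Longrightarrow> AE x in lborel_Rd d. \<bar>t * potential x\<bar> \<le> \<epsilon>"
  shows "(\<integral>\<^sup>+ t\<in>{t. 0 < t \<and> ereal t < T0}.
               (\<integral>\<^sup>+ x. ennreal (\<bar>u x t\<bar>\<^sup>2 * t powr (- 2 * \<alpha>)
                  * exp (- (\<Sum>i<d. (h x i)\<^sup>2) / (4 * t))) \<partial>lborel_Rd d) \<partial>lborel)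
            \<le> ennreal (16 / \<epsilon>\<^sup>2) *
            (\<integral>\<^sup>+ t\<in>{t. 0 < t \<and> ereal t < T0}.
               (\<integral>\<^sup>+ x. ennreal (\<bar>divergence d (\<lambda>y. (Hinv y * transpose_mat (Hinv y)) *\<^sub>v grad d (\<lambda>z. u z t) y) x
                     + deriv (\<lambda>s. u x s) t\<bar>\<^sup>2 * t powr (- 2 * \<alpha> + 2)
                  * exp (- (\<Sum>i<d. (h x i)\<^sup>2) / (4 * t))) \<partial>lborel_Rd d) \<partial>lborel)"
proof -
  let ?T = "{t. 0 < t \<and> ereal t < T0}"
  have U: "C_class (Suc d) k (\<lambda>z. u (restrict z {..<d}) (z d))" for k
    using u by (simp add: test_functions_def)
  have lhs: "(\<integral>\<^sup>+x. ennreal (\<bar>u x t\<bar>\<^sup>2 * t powr (- 2 * \<alpha>) * exp (- (\<Sum>i<d. (h x i)\<^sup>2) / (4 * t))) \<partial>lborel_Rd d)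
    = ennreal (t powr (- 2 * \<alpha>)) * gauss_norm (\<lambda>x. u x t) t" for t
    by (rule gauss_norm_weighted[OF C_class_continuous[OF C_class_space_slice[OF U[of 0]]]]) simp
  have rhs: "(\<integral>\<^sup>+x. ennreal (\<bar>divergence d (\<lambda>y. (Hinv y * transpose_mat (Hinv y)) *\<^sub>v grad d (\<lambda>z. u z t) y) x
                     + deriv (\<lambda>s. u x s) t\<bar>\<^sup>2 * t powr (- 2 * \<alpha> + 2) * exp (- (\<Sum>i<d. (h x i)\<^sup>2) / (4 * t))) \<partial>lborel_Rd d)
    = ennreal (t powr (- 2 * \<alpha> + 2)) * gauss_norm (backward_heat u t) t" for t
    by (rule gauss_norm_weighted[OF continuous_backward_heat[OF U]]) (simp only: divergence_eq_elliptic backward_heat_def)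
  have zero: "gauss_norm (\<lambda>x. u x t) t = 0" if "\<And>x. x \<in> Rd d \<Longrightarrow> u x t = 0" for t
  proof -
    have "gauss_norm (\<lambda>x. u x t) t = (\<integral>\<^sup>+x. 0 \<partial>lborel_Rd d)"
      unfolding gauss_norm_def by (rule nn_integral_cong) (simp add: that space_PiM)
    then show ?thesis by simp
  qed
  show ?thesis
    unfolding lhs rhs
  proof (rule test_function_support[OF u], goal_cases)
    case (2)
    then show ?case by (simp add: zero)
  next
    case (3 R t0 t1)
    have sub: "{t0..t1} \<subseteq> ?T"
    proof
      fix t assume t: "t \<in> {t0..t1}"
      then have "ereal t \<le> ereal t1" by simp
      also have "ereal t1 < T0" using 3 by simp
      finally show "t \<in> ?T" using t 3 by simp
    qed
    have "(\<integral>\<^sup>+t\<in>?T. ennreal (t powr (- 2 * \<alpha>)) * gauss_norm (\<lambda>x. u x t) t \<partial>lborel)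
      = (\<integral>\<^sup>+t. ennreal (t powr (- 2 * \<alpha>)) * gauss_norm (\<lambda>x. u x t) t * indicator {t0..t1} t \<partial>lborel)"
    proof (rule nn_integral_cong)
      fix t :: real
      show "ennreal (t powr (- 2 * \<alpha>)) * gauss_norm (\<lambda>x. u x t) t * indicator ?T t
        = ennreal (t powr (- 2 * \<alpha>)) * gauss_norm (\<lambda>x. u x t) t * indicator {t0..t1} t"
      proof (cases "t \<in> {t0..t1}")
        case True
        then have "t \<in> ?T" using sub by blast
        then show ?thesis using True by (simp only: indicator_simps)
      next
        case False
        then have "gauss_norm (\<lambda>x. u x t) t = 0" by (intro zero 3(6))
        then show ?thesis by (simp only: mult_zero_right mult_zero_left)
      qed
    qed
    also have "\<dots> \<le> ennreal (16 / \<epsilon>\<^sup>2) * (\<integral>\<^sup>+t. ennreal (t powr (- 2 * \<alpha> + 2)) * gauss_norm (backward_heat u t) t * indicator {t0..t1} t \<partial>lborel)"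
    proof (rule carleman_supported[OF U 3(5) 3(1,2,6) \<epsilon>])
      show "AE x in lborel_Rd d. \<bar>t * potential x\<bar> \<le> \<epsilon>" if "t \<in> {t0..t1}" for t
        using subsetD[OF sub that] by (intro small) auto
    qed
    also have "\<dots> \<le> ennreal (16 / \<epsilon>\<^sup>2) * (\<integral>\<^sup>+t\<in>?T. ennreal (t powr (- 2 * \<alpha> + 2)) * gauss_norm (backward_heat u t) t \<partial>lborel)"
    proof (rule mult_left_mono[OF nn_integral_mono])
      fix t :: real
      show "ennreal (t powr (- 2 * \<alpha> + 2)) * gauss_norm (backward_heat u t) t * indicator {t0..t1} t
        \<le> ennreal (t powr (- 2 * \<alpha> + 2)) * gauss_norm (backward_heat u t) t * indicator ?T t"
      proof (cases "t \<in> {t0..t1}")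
        case True
        then have "t \<in> ?T" using sub by blast
        then show ?thesis using True by (simp only: indicator_simps order_refl)
      qed simp
    qed simp
    finally show ?case .
  qed simp
qed

end

theorem theorem4p4:
  shows "\<exists>C :: real \<Rightarrow> real \<Rightarrow> real.
    \<forall>(d :: nat) (g :: (nat \<Rightarrow> real) \<Rightarrow> nat \<Rightarrow> real) (\<alpha> :: real) (\<delta> :: real).
      let h = inv_into (Rd d) g;
          H = jacobian_mat d h;
          Hi = (\<lambda>x. minv (H x));
          \<eta> = (\<lambda>x. Determinant.det (H x));
          A = (\<lambda>x. Hi x * transpose_mat (Hi x));
          b = (\<lambda>x. transpose_mat (Hi x) *\<^sub>v grad d (\<lambda>y. ln (\<eta> y)) x);
          q = divergence d (\<lambda>x. (Hi x * transpose_mat (Hi x)) *\<^sub>v grad d (\<lambda>y. ln (\<eta> y)) x);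
          \<epsilon> = infdist (2 * \<alpha> - real d / 2 - 1) (\<nat> :: real set);
          N = Linf_norm d (\<lambda>x. 2 * q x + (vlen (b x))\<^sup>2);
          T0 = (if N = 0 then \<infinity> else ereal (\<epsilon> * sqrt (1 - \<delta>)) / N)
      in d \<ge> 1 \<and> C3_diffeo d g \<and> (\<forall>x\<in>Rd d. Determinant.det (jacobian_mat d g x) > 0) \<and>
         (\<lambda>x. vlen (b x)) \<in> Linf d \<and> q \<in> Linf d \<and>
         2 * \<alpha> - real d / 2 - 3 \<in> {0<..} - \<int> \<and> \<delta> \<in> {0<..<1} \<longrightarrow>
         (\<forall>u \<in> test_functions d (Rd d \<times> {t. 0 < t \<and> ereal t < T0} - {(origin d, 0)}).
            (\<integral>\<^sup>+ t\<in>{t. 0 < t \<and> ereal t < T0}.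
               (\<integral>\<^sup>+ x. ennreal (\<bar>u x t\<bar>\<^sup>2 * t powr (- 2 * \<alpha>)
                  * exp (- (\<Sum>i<d. (h x i)\<^sup>2) / (4 * t))) \<partial>lborel_Rd d) \<partial>lborel)
            \<le> ennreal (C \<epsilon> \<delta>) *
            (\<integral>\<^sup>+ t\<in>{t. 0 < t \<and> ereal t < T0}.
               (\<integral>\<^sup>+ x. ennreal (\<bar>divergence d (\<lambda>y. A y *\<^sub>v grad d (\<lambda>z. u z t) y) x
                     + deriv (\<lambda>s. u x s) t\<bar>\<^sup>2 * t powr (- 2 * \<alpha> + 2)
                  * exp (- (\<Sum>i<d. (h x i)\<^sup>2) / (4 * t))) \<partial>lborel_Rd d) \<partial>lborel))"
proof (intro exI[of _ "\<lambda>\<epsilon> \<delta>. 16 / \<epsilon>\<^sup>2"] allI, unfold Let_def, intro impI ballI, elim conjE, goal_cases)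
  case (1 d g \<alpha> \<delta> u)
  interpret oriented_diffeo d g
    by standard (use 1 in auto)
  define \<epsilon> where "\<epsilon> = infdist (2 * \<alpha> - real d / 2 - 1) (\<nat> :: real set)"
  have le: "\<epsilon> \<le> \<bar>2 * \<alpha> - real d / 2 - 1 - real n\<bar>" for n :: nat
    unfolding \<epsilon>_def using infdist_le[of "real n" \<nat> "2 * \<alpha> - real d / 2 - 1"] by (simp add: dist_real_def)
  \<comment> \<open>This number exceeds the one in the hypothesis by 2, so it is not an integer;
    since the naturals are closed, its distance \<epsilon> to them is positive.\<close>
  have "2 * \<alpha> - real d / 2 - 1 \<notin> \<nat>"
  proof
    assume "2 * \<alpha> - real d / 2 - 1 \<in> \<nat>"
    then have "(2 * \<alpha> - real d / 2 - 1) - 2 \<in> \<int>" by (intro Ints_diff Nats_subset_Ints[THEN subsetD]) auto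
    moreover have "(2 * \<alpha> - real d / 2 - 1) - 2 = 2 * \<alpha> - real d / 2 - 3" by simp
    ultimately show False using 1 by simp
  qed
  then have pos: "\<epsilon> > 0"
    unfolding \<epsilon>_def by (intro infdist_pos_not_in_closed) auto
  define T0 where "T0 = (let N = Linf_norm d (\<lambda>x. 2 * divergence d (\<lambda>x. (Hinv x * transpose_mat (Hinv x)) *\<^sub>v grad d (\<lambda>y. ln (Determinant.det (jacobian_mat d h y))) x) x
      + (vlen (transpose_mat (Hinv x) *\<^sub>v grad d (\<lambda>y. ln (Determinant.det (jacobian_mat d h y))) x))\<^sup>2)
    in if N = 0 then \<infinity> else ereal (\<epsilon> * sqrt (1 - \<delta>)) / N)"
  have small: "AE x in lborel_Rd d. \<bar>t * potential x\<bar> \<le> \<epsilon>" if t: "0 < t" "ereal t < T0" for t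
  proof -
    have "0 < \<delta>" "\<delta> < 1" using 1 by simp_all
    from AE_small_of_time_bound[OF pos this refl t(1) t(2)[unfolded T0_def Let_def]]
    show ?thesis
      by (rule AE_mp) (rule AE_I2, simp only: space_PiM space_lborel space_borel potential_eq simp_thms)
  qed
  have u: "u \<in> test_functions d (Rd d \<times> {t. 0 < t \<and> ereal t < T0} - {(origin d, 0)})"
    unfolding T0_def \<epsilon>_def Let_def h_def by (rule 1(1))
  show ?case
    using carleman_test_function[OF u pos le small] unfolding T0_def \<epsilon>_def Let_def h_def .
qed

end
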